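(* Let $M\ge2$ be an integer, let $\nu_1,\ldots,\nu_M\ge0$ be fixed integers (with $\nu_0=0$), and let $\kappa>\nu_1$ be a fixed integer. Let $K_n(x,y)$ be the correlation kernel of the squared singular values of the product of $M-1$ Ginibre matrices with one truncated unitary matrix given by the double contour integral in the context. Let $x_0\in\left(0,\frac{(M+1)^{\frac{M+1}{2}}}{2(M-1)^{\frac{M-1}{2}}}\right)$ and let $\varphi\in\left(0,\frac{2\pi}{M+1}\right)$ be the unique number with $$x_0=\frac{\left(\sin\left(\frac{M+1}{2}\varphi\right)\right)^{\frac{M+1}{2}}}{\sin\varphi\,\left(\sin\left(\frac{M-1}{2}\varphi\right)\right)^{\frac{M-1}{2}}}.$$ Set $$\rho(\varphi)=\frac{1}{\pi x_0}\left(\frac{\sin\left(\frac{M+1}{2}\varphi\right)}{\sin\left(\frac{M-1}{2}\varphi\right)}\right)^{1/2}\sin\frac{\varphi}{2}.$$ Then $$\lim_{n\to\infty}\frac{e^{-\pi\xi\cot\frac{\varphi}{2}}}{e^{-\pi\eta\cot\frac{\varphi}{2}}}\,\frac{n^{M-2}}{\rho(\varphi)}\,K_n\left(n^{M-1}\left(x_0+\frac{\xi}{n\rho(\varphi)}\right),\,n^{M-1}\left(x_0+\frac{\eta}{n\rho(\varphi)}\right)\right)=K_{\sin}(\xi,\eta)$$ uniformly for $\xi$ and $\eta$ in any compact subset of $\mathbb{R}$, where $K_{\sin}(x,y)=\frac{\sin\pi(x-y)}{\pi(x-y)}$ (equal to $1$ when $x=y$).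
   Context: Setting: $Y=X_M\cdots X_2V$, where $X_i$ ($i=2,\ldots,M$) are independent complex Ginibre matrices (i.i.d. standard complex Gaussian entries) of size $(n+\nu_i)\times(n+\nu_{i-1})$, $\nu_i\ge0$, and $V$, independent of them, is the $(n+\nu_1)\times n$ left upper block of an $l\times l$ Haar distributed unitary matrix with $l\ge2n+\nu_1$. Put $\nu_0=0$ and $\kappa=l+1-2n>\nu_1$; $\kappa$ is kept fixed, so $l=2n+\kappa-1$ varies with $n$. The squared singular values of $Y$ form a determinantal point process on $(0,\infty)$ with correlation kernel, for $x,y>0$, $$K_n(x,y)=\frac{1}{(2\pi i)^2}\int_{-1/2-i\infty}^{-1/2+i\infty}ds\oint_\Sigma dt\,\prod_{j=0}^M\frac{\Gamma(s+\nu_j+1)}{\Gamma(t+\nu_j+1)}\,\frac{\Gamma(t-n+1)}{\Gamma(s-n+1)}\,\frac{\Gamma(t+n+\kappa)}{\Gamma(s+n+\kappa)}\,\frac{x^ty^{-s-1}}{s-t},$$ where $\Sigma$ is a closed contour going around $0,1,\ldots,n-1$ once in the positive direction with $\operatorname{Re}t>-1/2$ for $t\in\Sigma$. This formula is taken as the definition of $K_n$. The displayed parametrization $\varphi\mapsto x_0$ is a one-to-one map from $(0,2\pi/(M+1))$ onto $\left(0,\frac{(M+1)^{(M+1)/2}}{2(M-1)^{(M-1)/2}}\right)$. For $\xi,\eta$ in a fixed compact set the arguments of $K_n$ are positive for all large $n$. *)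

theory Defs
  imports "HOL-Complex_Analysis.Complex_Analysis"
begin

text \<open>
  Closed contours in \<open>Re t > -1/2\<close> going around \<open>0, \<dots>, n - 1\<close> once in the positive direction;
  ``once in the positive direction'' is read as winding number 1 about each of these points.
\<close>

definition encircling_contour :: "nat \<Rightarrow> (real \<Rightarrow> complex) \<Rightarrow> bool" where
  "encircling_contour n \<Sigma> \<longleftrightarrow>
     valid_path \<Sigma> \<and> pathfinish \<Sigma> = pathstart \<Sigma> \<and>
     path_image \<Sigma> \<subseteq> {t. Re t > - (1 / 2)} - of_nat ` {..<n} \<and>
     (\<forall>k<n. winding_number \<Sigma> (of_nat k) = 1)"

definition kernel_integrand ::
    "nat \<Rightarrow> (nat \<Rightarrow> nat) \<Rightarrow> nat \<Rightarrow> nat \<Rightarrow> real \<Rightarrow> real \<Rightarrow> complex \<Rightarrow> complex \<Rightarrow> complex" where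
  "kernel_integrand M \<nu> \<kappa> n x y s t =
     (\<Prod>j=0..M. Gamma (s + of_nat (\<nu> j) + 1) / Gamma (t + of_nat (\<nu> j) + 1)) *
     (Gamma (t - of_nat n + 1) / Gamma (s - of_nat n + 1)) *
     (Gamma (t + of_nat n + of_nat \<kappa>) / Gamma (s + of_nat n + of_nat \<kappa>)) *
     (complex_of_real x powr t * complex_of_real y powr (- s - 1) / (s - t))"

text \<open>
  The \<open>s\<close>-integral runs upwards over the line \<open>Re s = -1/2\<close>, parametrized by
  \<open>s = -1/2 + \<i> u\<close>, \<open>ds = \<i> du\<close>. For \<open>M \<ge> 2\<close> and \<open>x, y > 0\<close> the integrand decays like
  \<open>exp (- (M - 1) \<pi> \<bar>u\<bar> / 2)\<close> up to powers of \<open>\<bar>u\<bar>\<close>, so the Lebesgue integral converges absolutely.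
  On \<open>Re s = -1/2\<close> and on an encircling contour no Gamma factor is evaluated at a pole
  (where the library sets it to 0), and \<open>s \<noteq> t\<close>.
\<close>

definition corr_kernel ::
    "nat \<Rightarrow> (nat \<Rightarrow> nat) \<Rightarrow> nat \<Rightarrow> nat \<Rightarrow> (real \<Rightarrow> complex) \<Rightarrow> real \<Rightarrow> real \<Rightarrow> complex" where
  "corr_kernel M \<nu> \<kappa> n \<Sigma> x y =
     1 / (2 * complex_of_real pi * \<i>)\<^sup>2 *
     (LBINT u. \<i> * contour_integral \<Sigma> (kernel_integrand M \<nu> \<kappa> n x y (Complex (- (1 / 2)) u)))"

definition sine_kernel :: "real \<Rightarrow> real \<Rightarrow> real" where
  "sine_kernel x y = (if x = y then 1 else sin (pi * (x - y)) / (pi * (x - y)))"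

end

theory Submission
  imports Defs "HOL-Probability.Sinc_Integral"
begin

text \<open>
  The integrand is \<open>\<Phi>(s) / \<Phi>(t) \<cdot> x\<^sup>t y\<^sup>-\<^sup>s\<^sup>-\<^sup>1 / (s - t)\<close>. Evaluating the \<open>t\<close>-integral by residues leaves
  a function of \<open>s\<close> that is holomorphic in \<open>Re s > -1\<close>, so that the \<open>s\<close>-line may be moved to
  \<open>Re s = n a - 1/2\<close>, through the two saddle points \<open>n (a \<plusminus> \<i> b) - 1/2\<close>. There the sum of residues is
  written as an integral over a new contour, the arc \<open>n Z(\<theta>) - 1/2\<close>, \<open>\<bar>\<theta>\<bar> \<le> \<theta>\<^sub>1\<close>, through the saddle points
  closed by two segments to the point \<open>-1/2\<close>. Now \<open>s\<close> lies inside this contour exactly if \<open>\<bar>Im s\<bar> < n b\<close>,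
  and its residue \<open>x\<^sup>s y\<^sup>-\<^sup>s\<^sup>-\<^sup>1\<close>, integrated over this segment, gives the sine kernel.

  In the remaining double integral the moduli of the \<open>s\<close>- and the \<open>t\<close>-factor are, up to constants, maximal
  at the saddle points, the second one exponentially small elsewhere, and
  \<open>1 / \<bar>s - t\<bar>\<close> is at most a constant times \<open>1 / (sqrt \<bar>\<bar>u\<bar> - b\<bar> * sqrt \<bar>\<bar>\<theta>\<bar> - \<theta>\<^sub>0\<bar>)\<close>, integrable in each variable.
  Dominated convergence in \<open>\<theta>\<close> then suffices, and no local expansion at the saddle points is needed.
\<close>

subsection \<open>Estimates for the Digamma and Gamma functions\<close>

text \<open>All sizes are read off from the logarithmic derivative \<open>Lam\<close> of
  \<open>Phi\<close>. With t = n z - 1/2 the differences t - i are midpoints of unit steps, so sums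
  become telescoping logarithms with error O(1/n). Integrated against dt = n dz this costs O(1) in
  ln |Phi|: moduli are known up to constant factors, which is all that domination needs.

  Each Z \<theta> is the saddle point for its own parameter exp (lnX \<theta>), so on the whole arc
  the limit of \<open>Lam\<close> is real. The exponent there has the derivative n (lnX \<theta> -
  lnX \<theta>0) Re Z', whose sign follows from the monotonicity of lnX and of Re Z. On the vertical
  line only the imaginary part of the same function counts, and its sign tells the side of the
  curve.

  The obstacle is the segment [0, 1] of the z-plane, filled by the rescaled zeros of
  \<open>Phi\<close>, where the approximation fails. The line may cross it and the closing segments
  end at 0. On the line the zeros act with a favourable sign; on the closing segments a cruder bound
  sqrt (n / \<rho>) can be integrated, and the result is small since the curve runs into 0 as
  \<theta> tends to \<tau>.\<close>

lemma inverse_Ln_diff_bound: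
  fixes w :: complex
  assumes "cmod w \<ge> 1" and "Im w \<noteq> 0 \<or> Re w > 1/2"
  shows "cmod (1 / w - (Ln (w + 1/2) - Ln (w - 1/2))) \<le> 1 / (cmod w)\<^sup>2"
proof -
  let ?S = "closed_segment (-1/2 :: complex) (1/2)"
  have S: "\<exists>t. y = complex_of_real t \<and> \<bar>t\<bar> \<le> 1/2" if "y \<in> ?S" for y
  proof -
    have "y \<in> closed_segment (of_real (-1/2)) (of_real (1/2) :: complex)" using that by simp
    then show ?thesis
      unfolding closed_segment_of_real by (auto simp: closed_segment_eq_real_ivl)
  qed
  have np: "w + y \<notin> \<real>\<^sub>\<le>\<^sub>0" if "y \<in> ?S" for y
    using S[OF that] assms(2) by (auto simp: complex_nonpos_Reals_iff)
  \<comment> \<open>The midpoint rule for the integral of 1 / (w + y) over [-1/2, 1/2]: the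
    increment of \<open>f\<close> over this segment is the error, and its derivative is y / (w (w +
    y)). The second hypothesis keeps w + y off the branch cut.\<close>
  define f where "f = (\<lambda>y. y / w - Ln (w + y))"
  have "cmod (f (1/2) - f (-1/2)) \<le> 1 / (cmod w)\<^sup>2 * cmod (1/2 - (-1/2 :: complex))"
  proof (rule field_differentiable_bound[where S = ?S and f' = "\<lambda>y. 1 / w - 1 / (w + y)"])
    show "(f has_field_derivative 1 / w - 1 / (w + y)) (at y within ?S)" if "y \<in> ?S" for y
    proof -
      have "((\<lambda>y. Ln (w + y)) has_field_derivative 1 / (w + y)) (at y within ?S)"
      proof (rule has_field_derivative_at_within)
        have "((\<lambda>y. w + y) has_field_derivative 1) (at y)"
          by (auto intro!: derivative_eq_intros)
        then show "((\<lambda>y. Ln (w + y)) has_field_derivative 1 / (w + y)) (at y)"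
          using DERIV_chain2[where g = "\<lambda>y. w + y" and x = y, OF has_field_derivative_Ln[OF np[OF that]]] by (simp add: inverse_eq_divide)
      qed
      moreover have "((\<lambda>y. y / w) has_field_derivative 1 / w) (at y within ?S)"
        by (rule DERIV_cdivide[OF DERIV_ident])
      ultimately show ?thesis unfolding f_def by (metis DERIV_diff)
    qed
  next
    fix y assume y: "y \<in> ?S"
    then obtain t where t: "y = of_real t" "\<bar>t\<bar> \<le> 1/2" using S by blast
    have ny: "cmod y \<le> 1/2" using t by simp
    have "cmod w - cmod y \<le> cmod (w + y)" by (metis norm_diff_ineq)
    then have g: "cmod (w + y) \<ge> cmod w / 2" using ny assms(1) by linarith
    have "w \<noteq> 0" "w + y \<noteq> 0" using assms(1) g by auto
    then have "1 / w - 1 / (w + y) = y / (w * (w + y))" by (simp add: field_simps)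
    then have "cmod (1 / w - 1 / (w + y)) = cmod y / (cmod w * cmod (w + y))"
      by (simp add: norm_divide norm_mult)
    also have "\<dots> \<le> (1/2) / (cmod w * (cmod w / 2))"
      using ny g assms(1) by (intro frac_le mult_left_mono mult_pos_pos) auto
    also have "\<dots> = 1 / (cmod w)\<^sup>2" by (simp add: power2_eq_square)
    finally show "cmod (1 / w - 1 / (w + y)) \<le> 1 / (cmod w)\<^sup>2" .
  qed (auto)
  moreover have "f (1/2) - f (-1/2) = 1 / w - (Ln (w + 1/2) - Ln (w - 1/2))"
    unfolding f_def by (simp add: field_simps)
  ultimately show ?thesis by simp
qed

lemma cmod_add_nonneg_ge:
  assumes "Re z \<ge> 0" "c \<ge> 0"
  shows "(cmod z + c)\<^sup>2 \<le> 2 * (cmod (z + of_real c))\<^sup>2"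
proof -
  have "(cmod (z + of_real c))\<^sup>2 = (cmod z)\<^sup>2 + 2 * c * Re z + c\<^sup>2"
    unfolding cmod_power2 by (simp add: power2_eq_square algebra_simps)
  also have "\<dots> \<ge> (cmod z)\<^sup>2 + c\<^sup>2" using assms by simp
  finally have "2 * (cmod (z + of_real c))\<^sup>2 \<ge> 2 * ((cmod z)\<^sup>2 + c\<^sup>2)" by simp
  moreover have "(cmod z + c)\<^sup>2 \<le> 2 * ((cmod z)\<^sup>2 + c\<^sup>2)"
    using zero_le_power2[of "cmod z - c"] by (simp add: power2_eq_square algebra_simps)
  ultimately show ?thesis by (rule order_trans[rotated])
qed

text \<open>\<open>Digamma (z + 1/2)\<close> is the limit of ln m minus the sum of 1 / (z + k + 1/2)
  over k < m. By the midpoint rule each term is close to \<open>Ln (z + k + 1) - Ln (z + k)\<close>,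
  and these differences telescope. This is the reason for the -1/2 in the rescaling
  \<open>pt\<close>.\<close>

lemma Digamma_Ln_bound:
  fixes z :: complex
  assumes "Re z \<ge> 0" and "cmod z \<ge> 1"
  shows "cmod (Digamma (z + 1/2) - Ln z) \<le> 2 / cmod z"
proof -
  let ?w = "\<lambda>k::nat. z + 1/2 + of_nat k"
  define X where "X = cmod z"
  have X: "X \<ge> 1" using assms by (simp add: X_def)
  have w: "(cmod (?w k))\<^sup>2 \<ge> (X + (real k + 1/2))\<^sup>2 / 2" for k
  proof -
    have "(X + (real k + 1/2))\<^sup>2 \<le> 2 * (cmod (z + of_real (real k + 1/2)))\<^sup>2"
      unfolding X_def by (rule cmod_add_nonneg_ge) (use assms in auto)
    also have "z + of_real (real k + 1/2) = ?w k" by simp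
    finally show ?thesis by simp
  qed
  have w1: "cmod (?w k) \<ge> 1" for k
  proof -
    have "(1::real)\<^sup>2 \<le> (cmod (?w k))\<^sup>2"
    proof -
      have "(cmod (?w k))\<^sup>2 = (cmod z)\<^sup>2 + 2 * (real k + 1/2) * Re z + (real k + 1/2)\<^sup>2"
        unfolding cmod_power2 by (simp add: power2_eq_square field_simps)
      moreover have "2 * (real k + 1/2) * Re z \<ge> 0" using assms by simp
      moreover have "(cmod z)\<^sup>2 \<ge> 1" using assms by simp
      ultimately show ?thesis by (smt (verit) zero_le_power2 one_power2)
    qed
    then show ?thesis by (rule power2_le_imp_le) simp
  qed
  have wI: "Im (?w k) \<noteq> 0 \<or> Re (?w k) > 1/2" for k
  proof (cases "Im z = 0")
    case True
    then have "Re z \<noteq> 0" using assms(2) by (auto simp: cmod_def)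
    then show ?thesis using assms(1) by simp
  qed simp
  \<comment> \<open>The error 1 / |w|^2 is majorized by a difference, so that the sum of all errors
    telescopes to at most 2 / X.\<close>
  have e: "cmod (1 / ?w k - (Ln (z + of_nat (Suc k)) - Ln (z + of_nat k)))
            \<le> 2 / (X + real k) - 2 / (X + real (Suc k))" for k
  proof -
    have "?w k + 1/2 = z + of_nat (Suc k)" "?w k - 1/2 = z + of_nat k" by simp_all
    then have "cmod (1 / ?w k - (Ln (z + of_nat (Suc k)) - Ln (z + of_nat k))) \<le> 1 / (cmod (?w k))\<^sup>2"
      using inverse_Ln_diff_bound[OF w1 wI, of k] by (simp only:)
    also have "\<dots> \<le> 1 / ((X + (real k + 1/2))\<^sup>2 / 2)"
    proof (rule divide_left_mono[OF w])
      have "(X + (real k + 1/2))\<^sup>2 > 0" using X by (intro zero_less_power) auto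
      moreover have "(cmod (?w k))\<^sup>2 > 0" using w1[of k] by (intro zero_less_power) linarith
      ultimately show "0 < (cmod (?w k))\<^sup>2 * ((X + (real k + 1/2))\<^sup>2 / 2)" by simp
    qed simp
    also have "\<dots> \<le> 2 / ((X + real k) * (X + real (Suc k)))"
    proof -
      have "(X + real k) * (X + real (Suc k)) \<le> (X + (real k + 1/2))\<^sup>2"
        by (simp add: power2_eq_square algebra_simps)
      moreover have "(X + real k) * (X + real (Suc k)) > 0" using X by simp
      ultimately show ?thesis by (simp add: frac_le)
    qed
    also have "\<dots> = 2 / (X + real k) - 2 / (X + real (Suc k))"
      using X by (simp add: field_simps)
    finally show ?thesis .
  qed
  have part: "cmod ((\<Sum>k<m. inverse (?w k)) - (Ln (z + of_nat m) - Ln z)) \<le> 2 / X" for m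
  proof -
    have "(\<Sum>k<m. Ln (z + of_nat (Suc k)) - Ln (z + of_nat k)) = Ln (z + of_nat m) - Ln z"
      by (subst sum_lessThan_telescope) simp
    then have "(\<Sum>k<m. inverse (?w k)) - (Ln (z + of_nat m) - Ln z)
         = (\<Sum>k<m. 1 / ?w k - (Ln (z + of_nat (Suc k)) - Ln (z + of_nat k)))"
      by (simp only: sum_subtractf inverse_eq_divide)
    also have "cmod \<dots> \<le> (\<Sum>k<m. 2 / (X + real k) - 2 / (X + real (Suc k)))"
      by (intro sum_norm_le e)
    also have "\<dots> = 2 / X - 2 / (X + real m)"
      by (subst sum_lessThan_telescope') simp
    also have "\<dots> \<le> 2 / X" using X by simp
    finally show ?thesis .
  qed
  have lim: "(\<lambda>m. of_real (ln (real m)) - Ln (z + of_nat m)) \<longlonglongrightarrow> 0"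
  proof -
    have "(\<lambda>m. - Ln (1 + z / of_nat m)) \<longlonglongrightarrow> - Ln (1 + 0)"
      by (intro tendsto_intros tendsto_Ln lim_const_over_n) auto
    moreover have "eventually (\<lambda>m. - Ln (1 + z / of_nat m) = of_real (ln (real m)) - Ln (z + of_nat m)) sequentially"
    proof (rule eventually_mono[OF eventually_gt_at_top[of 0]])
      fix m :: nat assume m: "m > 0"
      have nz: "1 + z / of_nat m \<noteq> 0"
      proof
        assume "1 + z / of_nat m = 0"
        then have "z = - of_nat m" using m by (simp add: field_simps add_eq_0_iff2)
        then show False using assms(1) m by simp
      qed
      have "Ln (z + of_nat m) = Ln (of_real (real m) * (1 + z / of_nat m))"
        using m by (simp add: distrib_left add.commute)
      also have "\<dots> = ln (real m) + Ln (1 + z / of_nat m)"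
        using m nz by (subst Ln_times_of_real) auto
      finally show "- Ln (1 + z / of_nat m) = of_real (ln (real m)) - Ln (z + of_nat m)" by simp
    qed
    ultimately show ?thesis by (simp add: tendsto_cong)
  qed
  have np: "z + 1/2 \<notin> \<int>\<^sub>\<le>\<^sub>0" using assms(1) by (auto elim!: nonpos_Ints_cases simp: complex_eq_iff)
  have "(\<lambda>m. of_real (ln (real m)) - (\<Sum>k<m. inverse (?w k))) \<longlonglongrightarrow> Digamma (z + 1/2)"
    by (rule Digamma_LIMSEQ) (use assms(1) in \<open>auto simp: complex_eq_iff\<close>)
  then have "(\<lambda>m. (of_real (ln (real m)) - (\<Sum>k<m. inverse (?w k)))
       - (of_real (ln (real m)) - Ln (z + of_nat m)) - Ln z) \<longlonglongrightarrow> Digamma (z + 1/2) - 0 - Ln z"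
    by (intro tendsto_intros lim)
  then have L: "(\<lambda>m. cmod ((of_real (ln (real m)) - (\<Sum>k<m. inverse (?w k)))
       - (of_real (ln (real m)) - Ln (z + of_nat m)) - Ln z)) \<longlonglongrightarrow> cmod (Digamma (z + 1/2) - 0 - Ln z)"
    by (rule tendsto_norm)
  have "cmod (Digamma (z + 1/2) - 0 - Ln z) \<le> 2 / X"
  proof (rule LIMSEQ_le_const2[OF L], intro exI allI impI)
    fix m
    have "(of_real (ln (real m)) - (\<Sum>k<m. inverse (?w k)))
       - (of_real (ln (real m)) - Ln (z + of_nat m)) - Ln z
       = - ((\<Sum>k<m. inverse (?w k)) - (Ln (z + of_nat m) - Ln z))" by simp
    then show "cmod ((of_real (ln (real m)) - (\<Sum>k<m. inverse (?w k)))
       - (of_real (ln (real m)) - Ln (z + of_nat m)) - Ln z) \<le> 2 / X"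
      using part[of m] by (simp only: norm_minus_cancel)
  qed
  then show ?thesis by (simp add: X_def)
qed

text \<open>Dividing \<open>F\<close> by its value at the point moves nearby values close to 1,
  where the principal logarithm is holomorphic; no branch of log F along the curve has to be chosen.
  The division changes ln |F| by a constant only.\<close>

lemma has_real_derivative_ln_cmod:
  fixes F :: "complex \<Rightarrow> complex" and c :: "real \<Rightarrow> complex"
  assumes c: "(c has_vector_derivative c') (at t within S)"
    and F: "(F has_field_derivative L * F (c t)) (at (c t))" and nz: "F (c t) \<noteq> 0"
  shows "((\<lambda>t. ln (cmod (F (c t)))) has_real_derivative Re (L * c')) (at t within S)"
proof -
  define w where "w = F (c t)"
  have d1: "((\<lambda>z. Ln (F z / w)) has_field_derivative L) (at (c t))"
    using F nz unfolding w_def by (auto intro!: derivative_eq_intros)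
  have d2: "(((\<lambda>z. Ln (F z / w)) \<circ> c) has_vector_derivative c' * L) (at t within S)"
    by (rule field_vector_diff_chain_within[OF c]) (rule has_field_derivative_at_within[OF d1])
  then have d3: "((\<lambda>t. Re (Ln (F (c t) / w))) has_real_derivative Re (L * c')) (at t within S)"
    unfolding o_def has_real_derivative_iff_has_vector_derivative
    using bounded_linear.has_vector_derivative[OF bounded_linear_Re, OF d2]
    by (simp add: mult.commute o_def)
  have "(c \<longlongrightarrow> c t) (at t within S)"
    using c has_vector_derivative_continuous continuous_within by blast
  moreover have "isCont F (c t)" using F DERIV_isCont by blast
  ultimately have lim: "((\<lambda>t. F (c t)) \<longlongrightarrow> F (c t)) (at t within S)"
    by (metis isCont_tendsto_compose)
  have ev: "eventually (\<lambda>s. F (c s) \<noteq> 0) (at t within S)"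
    using tendsto_imp_eventually_ne[OF lim nz] .
  have "((\<lambda>t. ln (cmod w) + Re (Ln (F (c t) / w))) has_real_derivative Re (L * c')) (at t within S)"
    using DERIV_add[OF DERIV_const d3] by simp
  moreover have "eventually (\<lambda>s. ln (cmod (F (c s))) = ln (cmod w) + Re (Ln (F (c s) / w))) (at t within S)"
    using ev by eventually_elim (use nz in \<open>simp add: w_def norm_divide ln_div\<close>)
  ultimately show ?thesis
    by (subst has_field_derivative_cong_eventually) (use nz in \<open>auto simp: w_def\<close>)
qed

text \<open>Unlike \<open>Ln z\<close>, the comparison term \<open>Ln (z + 1)\<close> stays bounded
  near z = 0, so this version covers the whole closed right half plane. It follows from the bound at
  z + 1 by the recurrence for \<open>Digamma\<close>.\<close>

lemma Digamma_Ln_plus1_bound: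
  fixes z :: complex
  assumes "Re z \<ge> 0"
  shows "cmod (Digamma (z + 1/2) - Ln (z + 1)) \<le> 4"
proof -
  have nz: "z + 1/2 \<noteq> 0" using assms by (auto simp: complex_eq_iff)
  have D: "Digamma (z + 1 + 1/2) = Digamma (z + 1/2) + 1 / (z + 1/2)"
    using Digamma_plus1[OF nz] by (simp add: add_ac)
  have r1: "cmod (z + 1) \<ge> 1"
    using abs_Re_le_cmod[of "z + 1"] assms by simp
  have r2: "cmod (z + 1/2) \<ge> 1/2"
    using abs_Re_le_cmod[of "z + 1/2"] assms by simp
  have "cmod (Digamma (z + 1 + 1/2) - Ln (z + 1)) \<le> 2 / cmod (z + 1)"
    by (rule Digamma_Ln_bound) (use assms r1 in auto)
  also have "\<dots> \<le> 2" using r1 by (simp add: divide_le_eq)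
  finally have a: "cmod (Digamma (z + 1 + 1/2) - Ln (z + 1)) \<le> 2" .
  have b: "cmod (1 / (z + 1/2)) \<le> 2" using r2 nz by (simp add: norm_divide divide_le_eq)
  have "Digamma (z + 1/2) - Ln (z + 1) = (Digamma (z + 1 + 1/2) - Ln (z + 1)) - 1 / (z + 1/2)"
    using D by simp
  also have "cmod \<dots> \<le> 2 + 2" using a b norm_triangle_ineq4 add_mono order_trans by blast
  finally show ?thesis by simp
qed

lemma cmod_Gamma_le:
  assumes "Re s > 0"
  shows "cmod (Gamma s) \<le> Gamma (Re s)"
proof -
  have c: "((\<lambda>t. of_real t powr (s - 1) / of_real (exp t)) has_integral Gamma s) {0..}"
    by (rule Gamma_integral_complex[OF assms])
  have r: "((\<lambda>t. t powr (Re s - 1) / exp t) has_integral Gamma (Re s)) {0..}"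
    by (rule Gamma_integral_real[OF assms])
  have "norm (integral {0..} (\<lambda>t. of_real t powr (s - 1) / of_real (exp t) :: complex))
      \<le> integral {0..} (\<lambda>t. t powr (Re s - 1) / exp t)"
    by (rule integral_norm_bound_integral[OF has_integral_integrable[OF c] has_integral_integrable[OF r]])
      (auto simp: norm_divide norm_powr_real_powr)
  then have "norm (Gamma s) \<le> integral {0..} (\<lambda>t. t powr (Re s - 1) / exp t)"
    using integral_unique[OF c] by simp
  then show ?thesis using integral_unique[OF r] by simp
qed

lemma Gamma_strip_bounded:
  fixes \<alpha> \<beta> :: real
  assumes "\<alpha> > 0"
  obtains C where "C > 0" "\<And>s. \<alpha> \<le> Re s \<Longrightarrow> Re s \<le> \<beta> \<Longrightarrow> cmod (Gamma s) \<le> C"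
proof -
  have "continuous_on {\<alpha>..\<beta>} (Gamma :: real \<Rightarrow> real)"
    using assms by (intro continuous_on_Gamma) (auto elim!: nonpos_Ints_cases)
  then have "bounded ((Gamma :: real \<Rightarrow> real) ` {\<alpha>..\<beta>})"
    using compact_continuous_image compact_imp_bounded by blast
  then obtain C where C: "C > 0" "\<And>x. x \<in> {\<alpha>..\<beta>} \<Longrightarrow> \<bar>Gamma x\<bar> \<le> C"
    unfolding bounded_pos by (metis imageI real_norm_def)
  show thesis
  proof
    show "C > 0" by fact
    fix s :: complex assume s: "\<alpha> \<le> Re s" "Re s \<le> \<beta>"
    have "cmod (Gamma s) \<le> Gamma (Re s)" using cmod_Gamma_le assms s by simp
    also have "\<dots> \<le> C" using C(2)[of "Re s"] s by simp
    finally show "cmod (Gamma s) \<le> C" .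
  qed
qed

text \<open>Two steps of the functional equation divide a bounded Gamma value by s (s + 1).
  Quadratic decay is all that integrability on vertical lines requires, so Stirling's formula is
  avoided.\<close>

lemma Gamma_strip_decay:
  fixes \<alpha> \<beta> :: real
  assumes "\<alpha> > 0"
  obtains C where "C > 0" "\<And>s. \<alpha> \<le> Re s \<Longrightarrow> Re s \<le> \<beta> \<Longrightarrow> cmod (Gamma s) \<le> C / (1 + (Im s)\<^sup>2)"
proof -
  obtain C where C: "C > 0" "\<And>s. \<alpha> + 2 \<le> Re s \<Longrightarrow> Re s \<le> \<beta> + 2 \<Longrightarrow> cmod (Gamma s) \<le> C"
    using Gamma_strip_bounded[of "\<alpha> + 2" "\<beta> + 2"] assms by auto
  define m where "m = min (\<alpha>\<^sup>2) 1"
  have m: "m > 0" "m \<le> 1" "m \<le> \<alpha>\<^sup>2" using assms by (auto simp: m_def)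
  show thesis
  proof
    show "C / m > 0" using C m by simp
    fix s :: complex assume s: "\<alpha> \<le> Re s" "Re s \<le> \<beta>"
    have np: "s \<notin> \<int>\<^sub>\<le>\<^sub>0" using s assms by (auto elim!: nonpos_Ints_cases)
    have "pochhammer s 2 = Gamma (s + 2) / Gamma s"
      using pochhammer_Gamma[OF np, of 2] by simp
    moreover have "pochhammer s 2 = s * (s + 1)" by (simp add: pochhammer_rec numeral_2_eq_2)
    moreover have "Gamma s \<noteq> 0" using np by (simp add: Gamma_eq_zero_iff)
    moreover have "s \<noteq> 0" "s + 1 \<noteq> 0" using s assms by (auto simp: complex_eq_iff)
    ultimately have "s * (s + 1) * Gamma s = Gamma (s + 2)" "s * (s + 1) \<noteq> 0"
      by (simp_all add: eq_divide_eq)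
    then have G: "Gamma s = Gamma (s + 2) / (s * (s + 1))" by (metis nonzero_mult_div_cancel_left)
    have sq: "cmod s * cmod s = (Re s)\<^sup>2 + (Im s)\<^sup>2"
      using cmod_power2[of s] by (simp add: power2_eq_square)
    have "m * (1 + (Im s)\<^sup>2) \<le> \<alpha>\<^sup>2 + (Im s)\<^sup>2"
    proof -
      have "m * (Im s)\<^sup>2 \<le> 1 * (Im s)\<^sup>2" by (rule mult_right_mono) (use m in auto)
      then show ?thesis using m by (simp add: distrib_left)
    qed
    also have "\<dots> \<le> cmod s * cmod s" unfolding sq using s assms by (simp add: power_mono)
    also have "\<dots> \<le> cmod s * cmod (s + 1)"
    proof (rule mult_left_mono)
      have "(cmod s)\<^sup>2 \<le> (cmod (s + 1))\<^sup>2"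
        unfolding cmod_power2 using s assms by (simp add: power2_eq_square algebra_simps)
      then show "cmod s \<le> cmod (s + 1)" by (rule power2_le_imp_le) simp
    qed simp
    finally have low: "m * (1 + (Im s)\<^sup>2) \<le> cmod s * cmod (s + 1)" .
    have pos: "0 < m * (1 + (Im s)\<^sup>2)" using m by (intro mult_pos_pos) (auto intro: add_pos_nonneg)
    have "cmod (Gamma s) = cmod (Gamma (s + 2)) / (cmod s * cmod (s + 1))"
      by (subst G) (simp add: norm_divide norm_mult)
    also have "\<dots> \<le> C / (m * (1 + (Im s)\<^sup>2))"
      using C(2)[of "s + 2"] s low pos C(1) by (intro frac_le) auto
    finally show "cmod (Gamma s) \<le> C / m / (1 + (Im s)\<^sup>2)" by simp
  qed
qed

subsection \<open>Line and contour integrals\<close>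

lemma integrable_inverse_1_plus_sq: "integrable lborel (\<lambda>u::real. 1 / (1 + u\<^sup>2))"
proof -
  have "set_integrable lborel UNIV (\<lambda>x::real. inverse (1 + x^2))"
    using integrable_inverse_1_plus_square by simp
  then show ?thesis unfolding set_integrable_def by (simp add: inverse_eq_divide)
qed

text \<open>Cauchy's theorem through a primitive \<open>F\<close> on the convex set S: the integral
  over [-k, k] on either line is an increment of \<open>F\<close>, and the increments of
  \<open>F\<close> along the horizontal sides at heights k and -k are O(1 / (1 + k^2)).\<close>

lemma vertical_line_shift:
  fixes W :: "complex \<Rightarrow> complex" and \<alpha> \<beta> D :: real
  assumes ab: "\<alpha> \<le> \<beta>" and S: "open S" "convex S" and W: "W holomorphic_on S"
    and sub: "{z. \<alpha> \<le> Re z \<and> Re z \<le> \<beta>} \<subseteq> S"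
    and bound: "\<And>z. \<alpha> \<le> Re z \<Longrightarrow> Re z \<le> \<beta> \<Longrightarrow> cmod (W z) \<le> D / (1 + (Im z)\<^sup>2)"
  shows "integrable lborel (\<lambda>u. W (Complex \<beta> u))"
    and "(LBINT u. W (Complex \<alpha> u)) = (LBINT u. W (Complex \<beta> u))"
proof -
  obtain F where F: "\<And>z. z \<in> S \<Longrightarrow> (F has_field_derivative W z) (at z)"
    using holomorphic_convex_primitive'[OF S(2) S(1) W] S(1) at_within_open by metis
  have cont: "continuous_on A (\<lambda>u. W (Complex \<gamma> u))" if "\<alpha> \<le> \<gamma>" "\<gamma> \<le> \<beta>" for \<gamma> A
  proof -
    have "continuous_on {z. \<alpha> \<le> Re z \<and> Re z \<le> \<beta>} W"
      using holomorphic_on_imp_continuous_on[OF W] continuous_on_subset sub by blast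
    then show ?thesis
      by (rule continuous_on_compose2) (use that in \<open>auto intro!: continuous_intros\<close>)
  qed
  have int: "integrable lborel (\<lambda>u. W (Complex \<gamma> u))" if g: "\<alpha> \<le> \<gamma>" "\<gamma> \<le> \<beta>" for \<gamma>
  proof (rule Bochner_Integration.integrable_bound)
    show "integrable lborel (\<lambda>u. D * (1 / (1 + u\<^sup>2)))"
      using integrable_inverse_1_plus_sq by (rule integrable_mult_right)
    show "(\<lambda>u. W (Complex \<gamma> u)) \<in> borel_measurable lborel"
      using borel_measurable_continuous_onI[OF cont[OF g]] by simp
    show "AE u in lborel. norm (W (Complex \<gamma> u)) \<le> norm (D * (1 / (1 + u\<^sup>2)))"
    proof (rule AE_I2)
      fix u :: real
      have "norm (W (Complex \<gamma> u)) \<le> D / (1 + u\<^sup>2)" using bound[of "Complex \<gamma> u"] g by simp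
      also have "\<dots> \<le> norm (D * (1 / (1 + u\<^sup>2)))" using abs_ge_self[of "D * (1 / (1 + u\<^sup>2))"] by simp
      finally show "norm (W (Complex \<gamma> u)) \<le> norm (D * (1 / (1 + u\<^sup>2)))" .
    qed
  qed
  show "integrable lborel (\<lambda>u. W (Complex \<beta> u))" using int ab by simp
  define J where "J = (\<lambda>\<gamma> (k::nat). LBINT u. indicator {- real k..real k} u *\<^sub>R W (Complex \<gamma> u))"
  have J: "J \<gamma> \<longlonglongrightarrow> (LBINT u. W (Complex \<gamma> u))" if g: "\<alpha> \<le> \<gamma>" "\<gamma> \<le> \<beta>" for \<gamma>
    unfolding J_def
  proof (rule integral_dominated_convergence)
    show "integrable lborel (\<lambda>u. norm (W (Complex \<gamma> u)))" using int[OF g] by simp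
    show "(\<lambda>u. W (Complex \<gamma> u)) \<in> borel_measurable lborel" using int[OF g] by auto
    show "(\<lambda>u. indicat_real {- real k..real k} u *\<^sub>R W (Complex \<gamma> u)) \<in> borel_measurable lborel" for k
      using int[OF g] by (auto intro!: borel_measurable_scaleR)
    show "AE u in lborel. (\<lambda>k. indicat_real {- real k..real k} u *\<^sub>R W (Complex \<gamma> u)) \<longlonglongrightarrow> W (Complex \<gamma> u)"
    proof (rule AE_I2)
      fix u :: real
      obtain K :: nat where K: "\<bar>u\<bar> \<le> real K" using real_arch_simple by blast
      have "eventually (\<lambda>k. indicat_real {- real k..real k} u *\<^sub>R W (Complex \<gamma> u) = W (Complex \<gamma> u)) sequentially"
        using eventually_ge_at_top[of K] by eventually_elim (use K in \<open>auto simp: indicator_def\<close>)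
      then show "(\<lambda>k. indicat_real {- real k..real k} u *\<^sub>R W (Complex \<gamma> u)) \<longlonglongrightarrow> W (Complex \<gamma> u)"
        by (rule tendsto_eventually)
    qed
    show "AE u in lborel. norm (indicat_real {- real k..real k} u *\<^sub>R W (Complex \<gamma> u)) \<le> norm (W (Complex \<gamma> u))" for k
      by (auto simp: indicator_def)
  qed
  have JF: "J \<gamma> k = (F (Complex \<gamma> (real k)) - F (Complex \<gamma> (- real k))) / \<i>"
    if g: "\<alpha> \<le> \<gamma>" "\<gamma> \<le> \<beta>" for \<gamma> k
  proof -
    have "J \<gamma> k = F (Complex \<gamma> (real k)) / \<i> - F (Complex \<gamma> (- real k)) / \<i>"
      unfolding J_def
    proof (rule integral_FTC_Icc)
      show "((\<lambda>u. F (Complex \<gamma> u) / \<i>) has_vector_derivative W (Complex \<gamma> u)) (at u within {- real k..real k})" for u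
      proof -
        have c: "(Complex \<gamma> has_vector_derivative \<i>) (at u within {- real k..real k})"
          unfolding Complex_eq by (auto intro!: derivative_eq_intros)
        have "Complex \<gamma> u \<in> S" using sub g by auto
        then have "((F \<circ> Complex \<gamma>) has_vector_derivative \<i> * W (Complex \<gamma> u)) (at u within {- real k..real k})"
          by (rule field_vector_diff_chain_within[OF c has_field_derivative_at_within[OF F]])
        then have "((\<lambda>u. F (Complex \<gamma> u) / \<i>) has_vector_derivative \<i> * W (Complex \<gamma> u) / \<i>) (at u within {- real k..real k})"
          unfolding o_def by (rule has_vector_derivative_divide)
        then show ?thesis by simp
      qed
    qed (use cont[OF g] in auto)
    then show ?thesis by (simp add: diff_divide_distrib right_diff_distrib)
  qed
  have hor: "cmod (F (Complex \<beta> T) - F (Complex \<alpha> T)) \<le> D / (1 + T\<^sup>2) * (\<beta> - \<alpha>)" for T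
  proof -
    have seg: "Im z = T \<and> \<alpha> \<le> Re z \<and> Re z \<le> \<beta>" if "z \<in> closed_segment (Complex \<alpha> T) (Complex \<beta> T)" for z
      using that ab unfolding closed_segment_same_Im[of "Complex \<alpha> T" "Complex \<beta> T", simplified]
      by (auto simp: closed_segment_eq_real_ivl)
    have "cmod (F (Complex \<beta> T) - F (Complex \<alpha> T)) \<le> D / (1 + T\<^sup>2) * cmod (Complex \<beta> T - Complex \<alpha> T)"
    proof (rule field_differentiable_bound[where S = "closed_segment (Complex \<alpha> T) (Complex \<beta> T)" and f' = W])
      show "(F has_field_derivative W z) (at z within closed_segment (Complex \<alpha> T) (Complex \<beta> T))"
        if "z \<in> closed_segment (Complex \<alpha> T) (Complex \<beta> T)" for z
        using seg[OF that] sub by (auto intro: has_field_derivative_at_within[OF F])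
      show "cmod (W z) \<le> D / (1 + T\<^sup>2)" if "z \<in> closed_segment (Complex \<alpha> T) (Complex \<beta> T)" for z
        using bound[of z] seg[OF that] by auto
    qed auto
    also have "cmod (Complex \<beta> T - Complex \<alpha> T) = \<beta> - \<alpha>" using ab by (simp add: cmod_def)
    finally show ?thesis .
  qed
  have "(\<lambda>k. J \<beta> k - J \<alpha> k) \<longlonglongrightarrow> 0"
  proof (rule Lim_null_comparison)
    show "eventually (\<lambda>k. norm (J \<beta> k - J \<alpha> k) \<le> 2 * (D * (\<beta> - \<alpha>)) * (1 / (1 + (real k)\<^sup>2))) sequentially"
    proof (rule always_eventually, rule allI)
      fix k
      have "J \<beta> k - J \<alpha> k = ((F (Complex \<beta> (real k)) - F (Complex \<alpha> (real k)))
              - (F (Complex \<beta> (- real k)) - F (Complex \<alpha> (- real k)))) / \<i>"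
        using JF ab by (simp add: diff_divide_distrib right_diff_distrib)
      also have "norm \<dots> \<le> cmod (F (Complex \<beta> (real k)) - F (Complex \<alpha> (real k)))
              + cmod (F (Complex \<beta> (- real k)) - F (Complex \<alpha> (- real k)))"
        unfolding norm_divide by (simp add: norm_triangle_ineq4)
      also have "\<dots> \<le> D / (1 + (real k)\<^sup>2) * (\<beta> - \<alpha>) + D / (1 + (- real k)\<^sup>2) * (\<beta> - \<alpha>)"
        by (intro add_mono hor)
      also have "\<dots> = 2 * (D * (\<beta> - \<alpha>)) * (1 / (1 + (real k)\<^sup>2))" by (simp add: field_simps)
      finally show "norm (J \<beta> k - J \<alpha> k) \<le> 2 * (D * (\<beta> - \<alpha>)) * (1 / (1 + (real k)\<^sup>2))" .
    qed
    have "(\<lambda>k. 1 / (1 + (real k)\<^sup>2)) \<longlonglongrightarrow> 0" by real_asymp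
    then show "(\<lambda>k. 2 * (D * (\<beta> - \<alpha>)) * (1 / (1 + (real k)\<^sup>2))) \<longlonglongrightarrow> 0"
      by (rule tendsto_mult_right_zero)
  qed
  moreover have "(\<lambda>k. J \<beta> k - J \<alpha> k) \<longlonglongrightarrow> (LBINT u. W (Complex \<beta> u)) - (LBINT u. W (Complex \<alpha> u))"
    by (intro tendsto_diff J) (use ab in auto)
  ultimately show "(LBINT u. W (Complex \<alpha> u)) = (LBINT u. W (Complex \<beta> u))"
    using LIMSEQ_unique by fastforce
qed

lemma integrable_inverse_sqrt:
  "integrable lborel (\<lambda>u::real. indicator {c-1..c+1} u / sqrt \<bar>u - c\<bar>)"
proof -
  have "((\<lambda>x. x powr (-1/2)) has_integral (1 powr (-1/2+1) / (-1/2+1))) {0..(1::real)}"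
    by (rule has_integral_powr_from_0) auto
  then have "(\<lambda>x::real. x powr (-1/2)) absolutely_integrable_on {0..1}"
    by (intro nonnegative_absolutely_integrable_1) (auto simp: has_integral_iff)
  then have "integrable lebesgue (\<lambda>x::real. indicator {0..1} x *\<^sub>R x powr (-1/2))"
    by (simp add: set_integrable_def)
  then have i1: "integrable lborel (\<lambda>x::real. indicator {0..1} x *\<^sub>R x powr (-1/2))"
    by (subst (asm) integrable_completion) auto
  have "integrable lborel (\<lambda>x::real. indicator {0..1} (0 + (-1) * x) *\<^sub>R (0 + (-1) * x) powr (-1/2))"
    using lborel_integrable_real_affine[OF i1, of "-1" 0] by simp
  with i1 have "integrable lborel (\<lambda>x::real. indicator {0..1} x *\<^sub>R x powr (-1/2)
        + indicator {0..1} (0 + (-1) * x) *\<^sub>R (0 + (-1) * x) powr (-1/2))"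
    by (rule Bochner_Integration.integrable_add)
  also have "(\<lambda>x::real. indicator {0..1} x *\<^sub>R x powr (-1/2)
        + indicator {0..1} (0 + (-1) * x) *\<^sub>R (0 + (-1) * x) powr (-1/2)) = (\<lambda>x. indicator {-1..1} x / sqrt \<bar>x\<bar>)"
  proof (rule ext)
    fix x :: real
    have p: "y powr (-1/2) = 1 / sqrt y" if "y \<ge> 0" for y :: real
    proof -
      have "y powr (-1/2) = y powr (- (1/2))" by simp
      also have "\<dots> = 1 / y powr (1/2)" by (rule powr_minus_divide)
      finally show ?thesis by (simp only: powr_half_sqrt[OF that])
    qed
    \<comment> \<open>At x = 0 both sides are 0, since division by \<open>sqrt 0\<close> gives
      0.\<close>
    consider "x > 0" | "x = 0" | "x < 0" by linarith
    then show "indicator {0..1} x *\<^sub>R x powr (-1/2)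
        + indicator {0..1} (0 + (-1) * x) *\<^sub>R (0 + (-1) * x) powr (-1/2) = indicator {-1..1} x / sqrt \<bar>x\<bar>"
    proof cases
      case 1
      then show ?thesis using p[of x] by (auto simp: indicator_def)
    next
      case 3
      then show ?thesis using p[of "-x"] by (auto simp: indicator_def)
    qed simp
  qed
  finally have "integrable lborel (\<lambda>x::real. indicator {-1..1} x / sqrt \<bar>x\<bar>)" .
  then have "integrable lborel (\<lambda>x::real. indicator {-1..1} (-c + 1 * x) / sqrt \<bar>-c + 1 * x\<bar>)"
    using lborel_integrable_real_affine[of "\<lambda>x::real. indicator {-1..1} x / sqrt \<bar>x\<bar>" 1 "-c"] by simp
  also have "(\<lambda>x::real. indicator {-1..1} (-c + 1 * x) / sqrt \<bar>-c + 1 * x\<bar>) = (\<lambda>u. indicator {c-1..c+1} u / sqrt \<bar>u - c\<bar>)"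
    by (rule ext) (auto simp: indicator_def)
  finally show ?thesis .
qed

text \<open>Where |u| differs from b by at least 1, the square root is at least 1 and
  \<open>g\<close> dominates; elsewhere \<open>g\<close> is at most 1 and the two local
  singularities are integrable.\<close>

lemma integrable_mult_inverse_sqrt:
  fixes g :: "real \<Rightarrow> real" and b :: real
  assumes g: "integrable lborel g" and g1: "\<And>u. 0 \<le> g u" "\<And>u. g u \<le> 1" and b: "b \<ge> 0"
  shows "integrable lborel (\<lambda>u. g u / sqrt \<bar>\<bar>u\<bar> - b\<bar>)"
proof (rule Bochner_Integration.integrable_bound)
  let ?h = "\<lambda>u. g u + indicator {b-1..b+1} u / sqrt \<bar>u - b\<bar> + indicator {-b-1..-b+1} u / sqrt \<bar>u - (-b)\<bar>"
  show "integrable lborel ?h"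
    by (intro Bochner_Integration.integrable_add g integrable_inverse_sqrt)
  have [measurable]: "g \<in> borel_measurable borel" using g by auto
  show "(\<lambda>u. g u / sqrt \<bar>\<bar>u\<bar> - b\<bar>) \<in> borel_measurable lborel" by measurable
  show "AE u in lborel. norm (g u / sqrt \<bar>\<bar>u\<bar> - b\<bar>) \<le> norm (?h u)"
  proof (rule AE_I2)
    fix u :: real
    have nn: "0 \<le> indicator {b-1..b+1} u / sqrt \<bar>u - b\<bar>" "0 \<le> indicator {-b-1..-b+1} u / sqrt \<bar>u - (-b)\<bar>"
      by auto
    have "g u / sqrt \<bar>\<bar>u\<bar> - b\<bar> \<le> ?h u"
    proof (cases "\<bar>\<bar>u\<bar> - b\<bar> \<ge> 1")
      case True
      then have "g u / sqrt \<bar>\<bar>u\<bar> - b\<bar> \<le> g u / 1" by (intro divide_left_mono) (use g1 in auto)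
      then show ?thesis using nn by linarith
    next
      case False
      have "g u / sqrt \<bar>\<bar>u\<bar> - b\<bar> \<le> 1 / sqrt \<bar>\<bar>u\<bar> - b\<bar>" by (intro divide_right_mono g1) auto
      also have "\<dots> \<le> indicator {b-1..b+1} u / sqrt \<bar>u - b\<bar> + indicator {-b-1..-b+1} u / sqrt \<bar>u - (-b)\<bar>"
      proof (cases "u \<ge> 0")
        case True
        then have "u \<in> {b-1..b+1}" using False by auto
        then show ?thesis using True nn(2) by simp
      next
        case u: False
        then have "u \<in> {-b-1..-b+1}" using False by auto
        moreover have "\<bar>\<bar>u\<bar> - b\<bar> = \<bar>u - (-b)\<bar>" using u by simp
        ultimately show ?thesis using nn(1) by simp
      qed
      finally show ?thesis using g1(1)[of u] by linarith
    qed
    moreover have "0 \<le> g u / sqrt \<bar>\<bar>u\<bar> - b\<bar>" using g1(1) by simp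
    ultimately show "norm (g u / sqrt \<bar>\<bar>u\<bar> - b\<bar>) \<le> norm (?h u)"
      unfolding real_norm_def by linarith
  qed
qed

text \<open>Used twice: for the contour of the kernel, where s lies outside, and for the contour
  through the saddle points, where s may lie inside. So the winding number about s is left open. The
  factor 1 / (s - t) has residue -1 at t = s, whence the minus sign.\<close>

lemma contour_integral_simple_poles:
  fixes P :: "complex \<Rightarrow> complex" and n :: nat and \<gamma> :: "real \<Rightarrow> complex"
  assumes P: "P holomorphic_on {z. Re z > -1}"
    and s: "Re s > -1" "s \<notin> of_nat ` {..<n}"
    and \<gamma>: "valid_path \<gamma>" "pathfinish \<gamma> = pathstart \<gamma>"
      "path_image \<gamma> \<subseteq> {z. Re z > -1} - insert s (of_nat ` {..<n})"
    and wn: "\<And>k. k < n \<Longrightarrow> winding_number \<gamma> (of_nat k) = 1"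
  shows "contour_integral \<gamma> (\<lambda>t::complex. P t / (\<Prod>i<n. t - of_nat i) / (s - t)) =
    2 * pi * \<i> * ((\<Sum>k<n. P (of_nat k) / (\<Prod>i\<in>{..<n}-{k}. of_nat k - of_nat i) / (s - of_nat k))
       - winding_number \<gamma> s * (P s / (\<Prod>i<n. s - of_nat i)))"
proof -
  let ?f = "\<lambda>t::complex. P t / (\<Prod>i<n. t - of_nat i) / (s - t)"
  let ?H = "{z::complex. Re z > -1}"
  let ?pts = "insert s (of_nat ` {..<n})"
  have oH: "open ?H" by (simp add: open_halfspace_Re_gt)
  have cH: "convex ?H" by (simp add: convex_halfspace_Re_gt)
  have holo: "?f holomorphic_on ?H - ?pts"
    by (intro holomorphic_intros holomorphic_on_subset[OF P]) auto
  have "contour_integral \<gamma> ?f = 2 * pi * \<i> * (\<Sum>p\<in>?pts. winding_number \<gamma> p * residue ?f p)"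
  proof (rule Residue_theorem[OF oH _ _ holo \<gamma>])
    show "connected ?H" using cH convex_connected by blast
    show "\<forall>z. z \<notin> ?H \<longrightarrow> winding_number \<gamma> z = 0"
      using \<gamma> by (auto intro!: winding_number_zero_outside[OF valid_path_imp_path cH])
  qed simp
  also have "(\<Sum>p\<in>?pts. winding_number \<gamma> p * residue ?f p)
      = winding_number \<gamma> s * residue ?f s + (\<Sum>k<n. winding_number \<gamma> (of_nat k) * residue ?f (of_nat k))"
    using s by (simp add: sum.reindex inj_on_def)
  also have "residue ?f s = - (P s / (\<Prod>i<n. s - of_nat i))"
  proof -
    have "?f = (\<lambda>t::complex. (- (P t / (\<Prod>i<n. t - of_nat i))) / (t - s))"
      by (rule ext) (metis minus_diff_eq minus_divide_divide minus_minus)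
    moreover have "residue (\<lambda>t::complex. (- (P t / (\<Prod>i<n. t - of_nat i))) / (t - s)) s = - (P s / (\<Prod>i<n. s - of_nat i))"
    proof (rule residue_simple)
      show "open (?H - of_nat ` {..<n})" by (intro open_Diff oH finite_imp_closed) simp
      show "(\<lambda>t::complex. - (P t / (\<Prod>i<n. t - of_nat i))) holomorphic_on ?H - of_nat ` {..<n}"
        by (intro holomorphic_intros holomorphic_on_subset[OF P]) auto
    qed (use s in auto)
    ultimately show ?thesis by simp
  qed
  also have "(\<Sum>k<n. winding_number \<gamma> (of_nat k) * residue ?f (of_nat k))
      = (\<Sum>k<n. P (of_nat k) / (\<Prod>i\<in>{..<n}-{k}. of_nat k - of_nat i) / (s - of_nat k))"
  proof (rule sum.cong[OF refl])
    fix k assume k: "k \<in> {..<n}"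
    let ?g = "\<lambda>t::complex. P t / (\<Prod>i\<in>{..<n}-{k}. t - of_nat i) / (s - t)"
    have "?f = (\<lambda>t. ?g t / (t - of_nat k))"
    proof (rule ext)
      fix t :: complex
      have "(\<Prod>i<n. t - of_nat i) = (t - of_nat k) * (\<Prod>i\<in>{..<n}-{k}. t - of_nat i)"
        using k by (simp add: prod.remove)
      then show "?f t = ?g t / (t - of_nat k)" by simp
    qed
    moreover have "residue (\<lambda>t. ?g t / (t - of_nat k)) (of_nat k) = ?g (of_nat k)"
    proof (rule residue_simple)
      show "open (?H - insert s (of_nat ` ({..<n} - {k})))" by (intro open_Diff oH finite_imp_closed) simp
      show "?g holomorphic_on ?H - insert s (of_nat ` ({..<n} - {k}))"
        by (intro holomorphic_intros holomorphic_on_subset[OF P]) auto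
    qed (use s k in auto)
    ultimately show "winding_number \<gamma> (of_nat k) * residue ?f (of_nat k) = ?g (of_nat k)"
      using wn k by simp
  qed
  finally have "contour_integral \<gamma> ?f = 2 * pi * \<i> *
      (winding_number \<gamma> s * - (P s / (\<Prod>i<n. s - of_nat i)) +
       (\<Sum>k<n. P (of_nat k) / (\<Prod>i\<in>{..<n}-{k}. of_nat k - of_nat i) / (s - of_nat k)))" .
  moreover have "a * - X + S = S - a * X" for a X S :: complex by simp
  ultimately show ?thesis by (simp only:)
qed

subsection \<open>The curve of saddle points\<close>

text \<open>
  \<open>sin ((m + 1) \<theta>) / sin \<theta>\<close>, written as a cosine sum so that it is smooth at \<open>\<theta> = 0\<close>.
\<close>

definition sin_quot :: "nat \<Rightarrow> real \<Rightarrow> real" where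
  "sin_quot m \<theta> = (\<Sum>k\<le>m. cos ((real m - 2 * real k) * \<theta>))"

lemma sin_quot_mult_sin: "sin_quot m \<theta> * sin \<theta> = sin ((real m + 1) * \<theta>)"
proof -
  define a where "a = (\<lambda>k::nat. sin ((real m + 1 - 2 * real k) * \<theta>))"
  have t: "cos ((real m - 2 * real k) * \<theta>) * sin \<theta> = (a k - a (Suc k)) / 2" for k
  proof -
    have "(real m + 1 - 2 * real k) * \<theta> = (real m - 2 * real k) * \<theta> + \<theta>"
         "(real m + 1 - 2 * real (Suc k)) * \<theta> = (real m - 2 * real k) * \<theta> - \<theta>"
      by (simp_all add: algebra_simps)
    then show ?thesis unfolding a_def by (simp only: sin_add sin_diff) simp
  qed
  have "sin_quot m \<theta> * sin \<theta> = (\<Sum>k\<le>m. (a k - a (Suc k)) / 2)"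
    unfolding sin_quot_def sum_distrib_right by (simp only: t)
  also have "\<dots> = (a 0 - a (Suc m)) / 2"
    using sum_telescope[of a m] by (simp flip: sum_divide_distrib)
  also have "a (Suc m) = - a 0"
  proof -
    have "(real m + 1 - 2 * real (Suc m)) * \<theta> = - ((real m + 1 - 2 * real 0) * \<theta>)"
      by (simp add: algebra_simps)
    then show ?thesis unfolding a_def by (simp only: sin_minus)
  qed
  finally show ?thesis by (simp add: a_def)
qed

lemma sin_quot_minus [simp]: "sin_quot m (- \<theta>) = sin_quot m \<theta>"
  unfolding sin_quot_def by simp

lemma sin_quot_0 [simp]: "sin_quot m 0 = real m + 1"
  unfolding sin_quot_def by simp

lemma sin_quot_eq: "sin \<theta> \<noteq> 0 \<Longrightarrow> sin_quot m \<theta> = sin ((real m + 1) * \<theta>) / sin \<theta>"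
  using sin_quot_mult_sin[of m \<theta>] by (simp add: eq_divide_eq)

lemma sin_quot_pos:
  assumes "\<bar>\<theta>\<bar> < pi / (real m + 1)"
  shows "sin_quot m \<theta> > 0"
proof -
  have pos: "sin_quot m t > 0" if t: "0 < t" "t < pi / (real m + 1)" for t
  proof -
    have "t * (real m + 1) < pi" using t by (simp add: less_divide_eq)
    moreover have "t * 1 \<le> t * (real m + 1)" using t by (intro mult_left_mono) auto
    ultimately have "t * (real m + 1) < pi" "t < pi" by linarith+
    then have "sin ((real m + 1) * t) > 0" "sin t > 0"
      using t by (auto intro!: sin_gt_zero simp: mult.commute)
    then show ?thesis using sin_quot_eq[of t m] by simp
  qed
  consider "\<theta> = 0" | "\<theta> > 0" | "- \<theta> > 0" by linarith
  then show ?thesis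
  proof cases
    case 3
    then have "sin_quot m (- \<theta>) > 0" using assms by (intro pos) auto
    then show ?thesis by simp
  qed (use pos assms in auto)
qed

definition sin_quot_deriv :: "nat \<Rightarrow> real \<Rightarrow> real" where
  "sin_quot_deriv m \<theta> = (\<Sum>k\<le>m. - sin ((real m - 2 * real k) * \<theta>) * (real m - 2 * real k))"

lemma has_field_derivative_sin_quot:
  "(sin_quot m has_real_derivative sin_quot_deriv m \<theta>) (at \<theta>)"
  unfolding sin_quot_def[abs_def] sin_quot_deriv_def by (auto intro!: derivative_eq_intros)

lemma continuous_on_sin_quot_deriv: "continuous_on A (sin_quot_deriv m)"
  unfolding sin_quot_deriv_def by (intro continuous_intros)

lemma abs_sin_nat_mult_le: "\<bar>sin (real m * x)\<bar> \<le> real m * \<bar>sin x\<bar>"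
proof (induction m)
  case (Suc m)
  have "sin (real (Suc m) * x) = sin (real m * x) * cos x + cos (real m * x) * sin x"
    using sin_add[of "real m * x" x] by (simp add: distrib_right add.commute)
  also have "\<bar>\<dots>\<bar> \<le> \<bar>sin (real m * x)\<bar> * \<bar>cos x\<bar> + \<bar>cos (real m * x)\<bar> * \<bar>sin x\<bar>"
    by (metis abs_mult abs_triangle_ineq)
  also have "\<dots> \<le> \<bar>sin (real m * x)\<bar> * 1 + 1 * \<bar>sin x\<bar>"
    by (intro add_mono mult_mono) auto
  finally show ?case using Suc by (simp add: algebra_simps)
qed simp

lemma cis_square: "(cis t)\<^sup>2 = cis (2 * t)"
  using Complex.DeMoivre[of t 2] by simp

locale geometry =
  fixes M :: nat
  assumes M2: "M \<ge> 2"
begin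

text \<open>Half of the right end 2 pi / (M + 1) of the range of \<phi>, since \<theta> stands for
  \<phi> / 2.\<close>

definition \<tau> :: real where "\<tau> = pi / (real M + 1)"

text \<open>The squared modulus r^2 of a point z = r cis \<theta> at which z^(M+1) / (z^2 - 1) is
  real: the imaginary part vanishes when r^2 sin((M-1)\<theta>) = sin((M+1)\<theta>), here with the
  common factor sin \<theta> removed.\<close>

definition R :: "real \<Rightarrow> real" where "R \<theta> = sin_quot M \<theta> / sin_quot (M - 2) \<theta>"

definition R' :: "real \<Rightarrow> real" where
  "R' \<theta> = (sin_quot_deriv M \<theta> * sin_quot (M - 2) \<theta> - sin_quot M \<theta> * sin_quot_deriv (M - 2) \<theta>)
          / (sin_quot (M - 2) \<theta> * sin_quot (M - 2) \<theta>)"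

definition Z :: "real \<Rightarrow> complex" where "Z \<theta> = of_real (sqrt (R \<theta>)) * cis \<theta>"

definition Z' :: "real \<Rightarrow> complex" where
  "Z' \<theta> = of_real (R' \<theta> / (2 * sqrt (R \<theta>))) * cis \<theta> + of_real (sqrt (R \<theta>)) * (\<i> * cis \<theta>)"

text \<open>
  For \<open>\<theta> = \<phi> / 2\<close> this is \<open>ln x\<^sub>0\<close>; the saddle point equation for \<open>Z \<theta>\<close> is the lemma \<open>Ln_Z\<close> below.
\<close>

definition lnX :: "real \<Rightarrow> real" where
  "lnX \<theta> = (real M + 1) / 2 * ln (R \<theta>) - ln (2 * cos \<theta> / sin_quot (M - 2) \<theta>)"

lemma tau: "0 < \<tau>" "\<tau> \<le> pi / 3" "\<tau> < pi / 2"
proof -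
  show "0 < \<tau>" by (simp add: \<tau>_def)
  have "pi / (real M + 1) \<le> pi / 3" using M2 by (intro divide_left_mono) auto
  then show "\<tau> \<le> pi / 3" by (simp add: \<tau>_def)
  then show "\<tau> < pi / 2" using pi_gt_zero by linarith
qed

lemma sin_quot_M2_pos: "\<bar>\<theta>\<bar> \<le> \<tau> \<Longrightarrow> sin_quot (M - 2) \<theta> > 0"
proof (rule sin_quot_pos)
  assume "\<bar>\<theta>\<bar> \<le> \<tau>"
  also have "\<tau> < pi / (real (M - 2) + 1)"
    unfolding \<tau>_def using M2 by (intro divide_strict_left_mono) (auto simp: of_nat_diff)
  finally show "\<bar>\<theta>\<bar> < pi / (real (M - 2) + 1)" .
qed

lemma sin_quot_M_pos: "\<bar>\<theta>\<bar> < \<tau> \<Longrightarrow> sin_quot M \<theta> > 0"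
  by (rule sin_quot_pos) (simp add: \<tau>_def)

lemma R_pos: "\<bar>\<theta>\<bar> < \<tau> \<Longrightarrow> R \<theta> > 0"
  unfolding R_def using sin_quot_M2_pos[of \<theta>] sin_quot_M_pos[of \<theta>] by simp

lemma R_minus [simp]: "R (- \<theta>) = R \<theta>"
  by (simp add: R_def)

lemma Z_minus: "Z (- \<theta>) = cnj (Z \<theta>)"
  by (simp add: Z_def cis_cnj)

lemma sin_pos: assumes "0 < \<theta>" "\<theta> < \<tau>"
  shows "sin \<theta> > 0" "cos \<theta> > 0" "sin ((real M + 1) * \<theta>) > 0" "sin ((real M - 1) * \<theta>) > 0" "sin (2 * \<theta>) > 0"
proof -
  have t: "\<theta> * (real M + 1) < pi" using assms by (simp add: \<tau>_def less_divide_eq)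
  have t2: "\<theta> < pi / 2" using assms tau by linarith
  show "sin \<theta> > 0" "cos \<theta> > 0" using assms t2 by (auto intro!: sin_gt_zero cos_gt_zero)
  show "sin ((real M + 1) * \<theta>) > 0" using assms t by (intro sin_gt_zero) (auto simp: mult.commute)
  have "(real M - 1) * \<theta> \<le> (real M + 1) * \<theta>" using assms by (intro mult_right_mono) auto
  also have "\<dots> < pi" using t by (simp add: mult.commute)
  finally show "sin ((real M - 1) * \<theta>) > 0" using assms M2 by (intro sin_gt_zero) auto
  show "sin (2 * \<theta>) > 0" using assms t2 by (intro sin_gt_zero) auto
qed

lemma sin_quot_M2_eq: "0 < \<theta> \<Longrightarrow> \<theta> < \<tau> \<Longrightarrow> sin_quot (M - 2) \<theta> = sin ((real M - 1) * \<theta>) / sin \<theta>"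
  using sin_quot_eq[of \<theta> "M - 2"] sin_pos[of \<theta>] M2 by (simp add: of_nat_diff)

lemma R_eq:
  assumes "0 < \<theta>" "\<theta> < \<tau>"
  shows "R \<theta> = sin ((real M + 1) * \<theta>) / sin ((real M - 1) * \<theta>)"
  unfolding R_def sin_quot_M2_eq[OF assms] using sin_quot_eq[of \<theta> M] sin_pos[OF assms] by simp

lemma R_at_tau: "R \<tau> = 0"
proof -
  have "sin_quot M \<tau> * sin \<tau> = 0"
    unfolding sin_quot_mult_sin by (simp add: \<tau>_def)
  moreover have "sin \<tau> > 0" using tau pi_gt_zero by (intro sin_gt_zero; linarith)
  ultimately show ?thesis by (simp add: R_def)
qed

lemma R_has_derivative:
  assumes "\<bar>\<theta>\<bar> \<le> \<tau>"
  shows "(R has_real_derivative R' \<theta>) (at \<theta>)"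
  unfolding R_def[abs_def] R'_def
  using sin_quot_M2_pos[OF assms]
  by (intro DERIV_divide has_field_derivative_sin_quot) simp

lemma continuous_on_R: "continuous_on {-\<tau>..\<tau>} R"
  by (rule DERIV_continuous_on[OF has_field_derivative_at_within[OF R_has_derivative]]) auto

text \<open>By the addition formulas the numerator of the derivative of sin((M+1)\<theta>) /
  sin((M-1)\<theta>) is sin(2M\<theta>) - M sin(2\<theta>), which is nonpositive by
  \<open>abs_sin_nat_mult_le\<close>.\<close>

lemma R'_nonpos:
  assumes "0 < \<theta>" "\<theta> < \<tau>"
  shows "R' \<theta> \<le> 0"
proof -
  let ?p = "(real M + 1) * \<theta>" and ?q = "(real M - 1) * \<theta>"
  let ?D = "(cos ?p * (real M + 1) * sin ?q - sin ?p * (cos ?q * (real M - 1))) / (sin ?q * sin ?q)"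
  note s = sin_pos[OF assms]
  have "((\<lambda>\<theta>. sin ((real M + 1) * \<theta>) / sin ((real M - 1) * \<theta>)) has_real_derivative ?D) (at \<theta>)"
    using s by (auto intro!: derivative_eq_intros)
  then have "(R has_real_derivative ?D) (at \<theta>)"
    by (rule has_field_derivative_transform_within_open[where S = "{0<..<\<tau>}"]) (use assms R_eq in auto)
  moreover have "(R has_real_derivative R' \<theta>) (at \<theta>)" by (rule R_has_derivative) (use assms in auto)
  ultimately have "R' \<theta> = ?D" by (metis DERIV_unique)
  also have "\<dots> \<le> 0"
  proof -
    have "?p - ?q = 2 * \<theta>" "?p + ?q = real M * (2 * \<theta>)" by (simp_all add: algebra_simps)
    then have "sin (2 * \<theta>) = sin ?p * cos ?q - cos ?p * sin ?q"
      "sin (real M * (2 * \<theta>)) = sin ?p * cos ?q + cos ?p * sin ?q"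
      by (metis sin_diff, metis sin_add)
    moreover have "cp * (m + 1) * sq - sp * (cq * (m - 1)) = (sp * cq + cp * sq) - m * (sp * cq - cp * sq)"
      for cp cq sp sq m :: real by (simp add: algebra_simps)
    ultimately have "cos ?p * (real M + 1) * sin ?q - sin ?p * (cos ?q * (real M - 1))
        = sin (real M * (2 * \<theta>)) - real M * sin (2 * \<theta>)"
      by (simp only:)
    also have "\<dots> \<le> 0" using abs_sin_nat_mult_le[of M "2 * \<theta>"] s by simp
    finally show ?thesis using s by (intro divide_nonpos_pos) auto
  qed
  finally show ?thesis .
qed

lemma R_antimono:
  assumes "0 \<le> x" "x \<le> y" "y \<le> \<tau>"
  shows "R y \<le> R x"
proof (cases "x = y")
  case False
  show ?thesis
  proof (rule DERIV_nonpos_imp_decreasing_open[of x y R])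
    show "\<exists>d. DERIV R t :> d \<and> d \<le> 0" if "x < t" "t < y" for t
      using R_has_derivative[of t] R'_nonpos[of t] that assms by auto
    show "continuous_on {x..y} R"
      using continuous_on_R by (rule continuous_on_subset) (use assms tau in auto)
  qed (use assms False in auto)
qed simp

lemma Re_Z: "Re (Z \<theta>) = sqrt (R \<theta>) * cos \<theta>" and Im_Z: "Im (Z \<theta>) = sqrt (R \<theta>) * sin \<theta>"
  by (simp_all add: Z_def)

text \<open>Either radius may be kept as the factor. So the radius at \<theta>0 can be used on both
  sides of \<theta>0, and the bound does not degenerate near \<tau>, where R tends to 0.\<close>

lemma Re_Z_diff:
  assumes "0 \<le> x" "x \<le> y" "y < \<tau>"
  shows "Re (Z x) - Re (Z y) \<ge> sqrt (R x) * (cos x - cos y)"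
    and "Re (Z x) - Re (Z y) \<ge> sqrt (R y) * (cos x - cos y)"
proof -
  have c: "cos y > 0" "cos x > 0"
    using assms tau pi_gt_zero by (intro cos_gt_zero_pi; linarith)+
  have r: "sqrt (R y) \<le> sqrt (R x)" using R_antimono assms by simp
  show "Re (Z x) - Re (Z y) \<ge> sqrt (R x) * (cos x - cos y)"
    using mult_right_mono[OF r, of "cos y"] c by (simp add: Re_Z algebra_simps)
  show "Re (Z x) - Re (Z y) \<ge> sqrt (R y) * (cos x - cos y)"
    using mult_right_mono[OF r, of "cos x"] c by (simp add: Re_Z algebra_simps)
qed

lemma Re_Z_strict_antimono:
  assumes "0 \<le> x" "x < y" "y < \<tau>"
  shows "Re (Z y) < Re (Z x)"
proof -
  have "cos y < cos x" using assms tau pi_gt_zero by (intro cos_monotone_0_pi; linarith)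
  then have "0 < sqrt (R x) * (cos x - cos y)" using R_pos[of x] assms by simp
  then show ?thesis using Re_Z_diff(1)[of x y] assms by simp
qed

lemma Re_Z_pos: "\<bar>\<theta>\<bar> < \<tau> \<Longrightarrow> Re (Z \<theta>) > 0"
  unfolding Re_Z using R_pos[of \<theta>] tau by (auto intro!: mult_pos_pos cos_gt_zero_pi)

lemma Im_Z_pos: "0 < \<theta> \<Longrightarrow> \<theta> < \<tau> \<Longrightarrow> Im (Z \<theta>) > 0"
  unfolding Im_Z using R_pos[of \<theta>] sin_pos[of \<theta>] by (auto intro!: mult_pos_pos)

lemma Z_has_vector_derivative:
  assumes "\<bar>\<theta>\<bar> < \<tau>"
  shows "(Z has_vector_derivative Z' \<theta>) (at \<theta>)"
proof -
  have "((\<lambda>\<theta>. sqrt (R \<theta>)) has_real_derivative R' \<theta> / (2 * sqrt (R \<theta>))) (at \<theta>)"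
    using R_has_derivative[of \<theta>] R_pos[OF assms] assms
    by (auto intro!: derivative_eq_intros simp: field_simps)
  then have "((\<lambda>\<theta>. complex_of_real (sqrt (R \<theta>))) has_vector_derivative of_real (R' \<theta> / (2 * sqrt (R \<theta>)))) (at \<theta>)"
    by (intro has_vector_derivative_of_real) (simp add: has_real_derivative_iff_has_vector_derivative)
  moreover have "(cis has_vector_derivative \<i> * cis \<theta>) (at \<theta>)"
    unfolding cis_conv_exp[abs_def]
    by (rule has_vector_derivative_real_field) (auto intro!: derivative_eq_intros)
  ultimately show ?thesis
    unfolding Z_def[abs_def] Z'_def by (rule has_vector_derivative_mult[THEN has_vector_derivative_eq_rhs]) simp
qed

lemma continuous_on_Z': "continuous_on {-\<tau><..<\<tau>} Z'"
proof -
  have sq: "continuous_on A (sin_quot m)" for A m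
    by (rule DERIV_continuous_on[OF has_field_derivative_at_within[OF has_field_derivative_sin_quot]])
  have nz: "sin_quot (M - 2) x \<noteq> 0" "R x \<noteq> 0" if "x \<in> {-\<tau><..<\<tau>}" for x
  proof -
    have "\<bar>x\<bar> < \<tau>" using that by auto
    then show "sin_quot (M - 2) x \<noteq> 0" "R x \<noteq> 0"
      using sin_quot_M2_pos[of x] R_pos[of x] by auto
  qed
  have c: "continuous_on {-\<tau><..<\<tau>} R'"
    unfolding R'_def by (intro continuous_intros continuous_on_sin_quot_deriv sq) (use nz in auto)
  have "continuous_on {-\<tau><..<\<tau>} R"
    by (rule continuous_on_subset[OF continuous_on_R]) auto
  then show ?thesis
    unfolding Z'_def by (intro continuous_intros c) (use nz in auto)
qed

lemma Re_Z'_nonpos: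
  assumes "0 < \<theta>" "\<theta> < \<tau>"
  shows "Re (Z' \<theta>) \<le> 0"
proof -
  have "R' \<theta> / (2 * sqrt (R \<theta>)) * cos \<theta> \<le> 0"
    using R'_nonpos[OF assms] R_pos[of \<theta>] sin_pos[OF assms] assms
    by (intro mult_nonpos_nonneg divide_nonpos_pos) auto
  moreover have "sqrt (R \<theta>) * sin \<theta> \<ge> 0" using R_pos[of \<theta>] sin_pos[OF assms] assms by simp
  ultimately show ?thesis by (simp add: Z'_def)
qed

text \<open>On the curve, z^2 - 1 has the argument (M+1)\<theta> of z^(M+1). After multiplication by
  sin \<theta> the identity \<open>id\<close> is the addition theorem; \<theta> = 0 is checked
  separately, since sin \<theta> cannot be cancelled there.\<close>

lemma Z_square:
  assumes "\<bar>\<theta>\<bar> < \<tau>"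
  shows "(Z \<theta>)\<^sup>2 - 1 = of_real (2 * cos \<theta> / sin_quot (M - 2) \<theta>) * cis ((real M + 1) * \<theta>)"
proof -
  let ?S = "sin_quot M \<theta>" and ?T = "sin_quot (M - 2) \<theta>"
  have T: "?T > 0" using sin_quot_M2_pos assms by simp
  have id: "of_real ?S * cis (2 * \<theta>) - of_real ?T = of_real (2 * cos \<theta>) * cis ((real M + 1) * \<theta>)"
  proof (cases "\<theta> = 0")
    case True
    then show ?thesis using M2 by (simp add: of_nat_diff)
  next
    case False
    have "sin \<bar>\<theta>\<bar> > 0" using sin_pos[of "\<bar>\<theta>\<bar>"] assms False by simp
    then have s: "sin \<theta> \<noteq> 0" by (cases "\<theta> \<ge> 0") auto
    have S: "?S * sin \<theta> = sin ((real M + 1) * \<theta>)" by (rule sin_quot_mult_sin)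
    have Tm: "?T * sin \<theta> = sin ((real M - 1) * \<theta>)" using sin_quot_mult_sin[of "M - 2" \<theta>] M2 by (simp add: of_nat_diff)
    have a: "(real M - 1) * \<theta> = (real M + 1) * \<theta> - 2 * \<theta>" by (simp add: algebra_simps)
    have "of_real (sin \<theta>) * (of_real ?S * cis (2 * \<theta>) - of_real ?T)
        = of_real (?S * sin \<theta>) * cis (2 * \<theta>) - of_real (?T * sin \<theta>)" by (simp add: algebra_simps)
    also have "\<dots> = of_real (sin (2 * \<theta>)) * cis ((real M + 1) * \<theta>)"
      unfolding S Tm a by (simp add: complex_eq_iff sin_diff)
    also have "\<dots> = of_real (sin \<theta>) * (of_real (2 * cos \<theta>) * cis ((real M + 1) * \<theta>))"
      by (simp add: sin_double)
    finally show ?thesis using s by simp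
  qed
  have "(Z \<theta>)\<^sup>2 = of_real (R \<theta>) * cis (2 * \<theta>)"
    using R_pos[OF assms] by (simp add: Z_def power_mult_distrib cis_square flip: of_real_power)
  also have "\<dots> - 1 = (of_real ?S * cis (2 * \<theta>) - of_real ?T) / of_real ?T"
    using T by (simp add: R_def diff_divide_distrib)
  finally show ?thesis unfolding id by simp
qed

lemma Ln_of_real_mult_cis:
  assumes "r > 0" "-pi < t" "t \<le> pi"
  shows "Ln (of_real r * cis t) = of_real (ln r) + \<i> * of_real t"
proof -
  have "of_real r * cis t = exp (of_real (ln r) + \<i> * of_real t)"
    using assms by (simp add: exp_add cis_conv_exp exp_of_real)
  then show ?thesis using assms by (simp add: Ln_exp)
qed

text \<open>As |(M+1)\<theta>| < pi, the principal logarithms give both terms the imaginary part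
  (M+1)\<theta> without a jump of 2 pi, so the imaginary parts cancel exactly.\<close>

lemma Ln_Z:
  assumes "\<bar>\<theta>\<bar> < \<tau>"
  shows "of_real (real M + 1) * Ln (Z \<theta>) - Ln ((Z \<theta>)\<^sup>2 - 1) = of_real (lnX \<theta>)"
proof -
  have t: "\<bar>(real M + 1) * \<theta>\<bar> < pi" using assms by (simp add: \<tau>_def abs_mult less_divide_eq mult.commute)
  have c: "cos \<theta> > 0" using assms tau by (intro cos_gt_zero_pi) auto
  have "Ln (Z \<theta>) = of_real (ln (sqrt (R \<theta>))) + \<i> * of_real \<theta>"
    unfolding Z_def using R_pos[OF assms] assms tau by (intro Ln_of_real_mult_cis) auto
  moreover have "Ln ((Z \<theta>)\<^sup>2 - 1) = of_real (ln (2 * cos \<theta> / sin_quot (M - 2) \<theta>)) + \<i> * of_real ((real M + 1) * \<theta>)"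
    unfolding Z_square[OF assms] using c t sin_quot_M2_pos[of \<theta>] assms by (intro Ln_of_real_mult_cis) auto
  moreover have "ln (sqrt (R \<theta>)) = ln (R \<theta>) / 2" using R_pos[OF assms] by (simp add: ln_sqrt)
  ultimately show ?thesis by (simp add: lnX_def algebra_simps)
qed

lemma lnX_eq:
  assumes "0 < \<theta>" "\<theta> < \<tau>"
  shows "lnX \<theta> = (real M + 1) / 2 * ln (sin ((real M + 1) * \<theta>)) - (real M - 1) / 2 * ln (sin ((real M - 1) * \<theta>))
      - ln (sin (2 * \<theta>))"
proof -
  note s = sin_pos[OF assms]
  have "2 * cos \<theta> / sin_quot (M - 2) \<theta> = sin (2 * \<theta>) / sin ((real M - 1) * \<theta>)"
    unfolding sin_quot_M2_eq[OF assms] using s by (simp add: sin_double)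
  then have "ln (2 * cos \<theta> / sin_quot (M - 2) \<theta>) = ln (sin (2 * \<theta>)) - ln (sin ((real M - 1) * \<theta>))"
    using s by (simp add: ln_div)
  moreover have "ln (R \<theta>) = ln (sin ((real M + 1) * \<theta>)) - ln (sin ((real M - 1) * \<theta>))"
    unfolding R_eq[OF assms] using s by (simp add: ln_div)
  moreover have "(m + 1) / 2 * (a - b) - (c - b) = (m + 1) / 2 * a - (m - 1) / 2 * b - c" for m a b c :: real
    by (simp add: field_simps)
  ultimately show ?thesis unfolding lnX_def by (simp only:)
qed

text \<open>With a = cot((M-1)\<theta>), c = cot(2\<theta>) and B = (M-1)/2, the addition theorem
  for cot turns the derivative into -2 ((c - B a)^2 + (B + 1)^2) / (a + c). Here a + c > 0 because
  sin((M+1)\<theta>) is positive.\<close>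

lemma lnX_strict_antimono:
  assumes "0 < x" "x < y" "y < \<tau>"
  shows "lnX y < lnX x"
proof (rule DERIV_neg_imp_decreasing[of x y])
  fix \<theta> assume "x \<le> \<theta>" "\<theta> \<le> y"
  then have t: "0 < \<theta>" "\<theta> < \<tau>" using assms by auto
  note s = sin_pos[OF t]
  let ?p = "(real M + 1) * \<theta>" and ?q = "(real M - 1) * \<theta>"
  let ?D = "(real M + 1) / 2 * (cos ?p * (real M + 1) / sin ?p) - (real M - 1) / 2 * (cos ?q * (real M - 1) / sin ?q)
     - cos (2 * \<theta>) * 2 / sin (2 * \<theta>)"
  have "((\<lambda>\<theta>. (real M + 1) / 2 * ln (sin ((real M + 1) * \<theta>)) - (real M - 1) / 2 * ln (sin ((real M - 1) * \<theta>))
      - ln (sin (2 * \<theta>))) has_real_derivative ?D) (at \<theta>)"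
    using s by (auto intro!: derivative_eq_intros simp: field_simps)
  then have "(lnX has_real_derivative ?D) (at \<theta>)"
    by (rule has_field_derivative_transform_within_open[where S = "{0<..<\<tau>}"]) (use t lnX_eq in auto)
  moreover have "?D < 0"
  proof -
    define a where "a = cos ?q / sin ?q"
    define c where "c = cos (2 * \<theta>) / sin (2 * \<theta>)"
    define B where "B = (real M - 1) / 2"
    have pq: "?p = ?q + 2 * \<theta>" by (simp add: algebra_simps)
    have sp: "sin ?p = sin ?q * sin (2 * \<theta>) * (a + c)"
      unfolding pq sin_add a_def c_def using s by (simp add: field_simps)
    have cp: "cos ?p = sin ?q * sin (2 * \<theta>) * (a * c - 1)"
      unfolding pq cos_add a_def c_def using s by (simp add: field_simps)
    have "0 < sin ?q * sin (2 * \<theta>)" using s by simp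
    then have ac: "a + c > 0" using sp s by (metis zero_less_mult_pos)
    have quot: "cos ?p / sin ?p = (a * c - 1) / (a + c)" unfolding sp cp using s by simp
    have "(m + 1) / 2 * (x * (m + 1) / y) - (m - 1) / 2 * (z * (m - 1) / v) - e * 2 / g
        = 2 * (((m - 1) / 2 + 1)\<^sup>2 * (x / y) - ((m - 1) / 2)\<^sup>2 * (z / v) - e / g)" for m x y z v e g :: real
    proof -
      define X Y E where "X = x / y" "Y = z / v" "E = e / g"
      have e: "x * (m + 1) / y = (m + 1) * X" "z * (m - 1) / v = (m - 1) * Y" "e * 2 / g = 2 * E"
        by (simp_all add: X_Y_E_def)
      show ?thesis unfolding e X_Y_E_def[symmetric] by (simp add: power2_eq_square field_simps)
    qed
    then have "?D = 2 * ((B + 1)\<^sup>2 * (cos ?p / sin ?p) - B\<^sup>2 * a - c)"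
      by (simp only: B_def a_def c_def)
    also have "(B + 1)\<^sup>2 * (cos ?p / sin ?p) - B\<^sup>2 * a - c = - (((c - B * a)\<^sup>2 + (B + 1)\<^sup>2) / (a + c))"
      unfolding quot using ac by (simp add: field_simps power2_eq_square)
    also have "2 * \<dots> < 0"
    proof -
      have "B > 0" using M2 by (simp add: B_def)
      then have "(c - B * a)\<^sup>2 + (B + 1)\<^sup>2 > 0" by (intro add_nonneg_pos) auto
      then show ?thesis using ac by simp
    qed
    finally show ?thesis .
  qed
  ultimately show "\<exists>d. DERIV lnX \<theta> :> d \<and> d < 0" by blast
qed (use assms in auto)

text \<open>The sign of the phase (M+1)\<theta> - Arg(z^2 - 1) tells on which side of the curve z =
  r cis \<theta> lies. Its sine times |z^2 - 1| is r^2 sin((M-1)\<theta>) - sin((M+1)\<theta>), and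
  for \<theta> < \<tau> the phase lies between -pi and pi, so it has the sign of its sine. From
  \<tau> on, (M+1)\<theta> \<ge> pi exceeds the argument.\<close>

lemma Arg_sign:
  assumes r: "r > 0" and t: "0 < \<theta>" "\<theta> < pi / 2"
  defines "w \<equiv> (of_real r * cis \<theta>)\<^sup>2 - 1"
  shows "\<theta> < \<tau> \<Longrightarrow> r\<^sup>2 < R \<theta> \<Longrightarrow> (real M + 1) * \<theta> < Im (Ln w)"
    and "\<theta> \<ge> \<tau> \<or> r\<^sup>2 > R \<theta> \<Longrightarrow> (real M + 1) * \<theta> > Im (Ln w)"
    and "0 < Im w" "0 < Im (Ln w)" "Im (Ln w) < pi"
proof -
  have w: "w = of_real (r\<^sup>2) * cis (2 * \<theta>) - 1"
    by (simp add: w_def power_mult_distrib cis_square)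
  have "sin (2 * \<theta>) > 0" using t by (intro sin_gt_zero) auto
  then show Iw: "0 < Im w" using r by (simp add: w)
  then show A: "0 < Im (Ln w)" "Im (Ln w) < pi"
    using Im_Ln_pos_lt_imp by (auto simp: Im_Ln_pos_lt_imp)
  have w0: "w \<noteq> 0" using Iw by auto
  let ?d = "(real M + 1) * \<theta> - Im (Ln w)"
  have key: "cmod w * sin ?d = r\<^sup>2 * sin ((real M - 1) * \<theta>) - sin ((real M + 1) * \<theta>)"
  proof -
    have wc: "w = of_real (cmod w) * cis (Im (Ln w))"
      using w0 by (metis Arg_eq_Im_Ln rcis_cmod_Arg rcis_def)
    have "Im (cis ((real M + 1) * \<theta>) * cnj w) = cmod w * sin ?d"
      by (subst wc) (simp add: sin_diff algebra_simps)
    moreover have "Im (cis p * cnj w) = r\<^sup>2 * sin (p - 2 * \<theta>) - sin p" for p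
      by (simp add: w sin_diff algebra_simps)
    moreover have "(real M + 1) * \<theta> - 2 * \<theta> = (real M - 1) * \<theta>" by (simp add: algebra_simps)
    ultimately show ?thesis by simp
  qed
  have lt: "(real M + 1) * \<theta> < pi" if "\<theta> < \<tau>" using that by (simp add: \<tau>_def less_divide_eq mult.commute)
  have sgn: "0 < sin ((real M - 1) * \<theta>)" "r\<^sup>2 * sin ((real M - 1) * \<theta>) - sin ((real M + 1) * \<theta>)
       = (r\<^sup>2 - R \<theta>) * sin ((real M - 1) * \<theta>)" if "\<theta> < \<tau>"
    using R_eq[OF t(1) that] sin_pos[OF t(1) that] by (auto simp: left_diff_distrib)
  show "(real M + 1) * \<theta> < Im (Ln w)" if "\<theta> < \<tau>" "r\<^sup>2 < R \<theta>"
  proof (rule ccontr)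
    assume "\<not> ?thesis"
    then have "sin ?d \<ge> 0" using A lt[OF that(1)] by (intro sin_ge_zero) auto
    then have "0 \<le> (r\<^sup>2 - R \<theta>) * sin ((real M - 1) * \<theta>)" using key sgn[OF that(1)] by (metis mult_nonneg_nonneg norm_ge_zero)
    then show False using sgn(1)[OF that(1)] that(2) by (simp add: zero_le_mult_iff)
  qed
  show "(real M + 1) * \<theta> > Im (Ln w)" if h: "\<theta> \<ge> \<tau> \<or> r\<^sup>2 > R \<theta>"
  proof (cases "\<theta> < \<tau>")
    case False
    then have "pi \<le> (real M + 1) * \<theta>" by (simp add: \<tau>_def not_less divide_le_eq mult.commute)
    then show ?thesis using A by simp
  next
    case True
    show ?thesis
    proof (rule ccontr)
      assume "\<not> ?thesis"
      moreover have "0 \<le> (real M + 1) * \<theta>" using t by simp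
      ultimately have "sin (- ?d) \<ge> 0" using A by (intro sin_ge_zero; linarith)
      then have "sin ?d \<le> 0" unfolding sin_minus by linarith
      then have "cmod w * sin ?d \<le> 0" by (simp add: mult_nonneg_nonpos)
      then have "(r\<^sup>2 - R \<theta>) * sin ((real M - 1) * \<theta>) \<le> 0" using key sgn[OF True] by simp
      then show False using sgn(1)[OF True] h True by (simp add: mult_le_0_iff)
    qed
  qed
qed

end

section \<open>The logarithmic derivative of the Gamma products\<close>

lemma cmod_add_of_real_ge: "Re z \<ge> 0 \<Longrightarrow> c \<ge> 0 \<Longrightarrow> cmod z \<le> cmod (z + of_real c)"
proof (rule power2_le_imp_le)
  assume "Re z \<ge> 0" "c \<ge> 0"
  then show "(cmod z)\<^sup>2 \<le> (cmod (z + of_real c))\<^sup>2"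
    unfolding cmod_power2 by (simp add: power2_eq_square algebra_simps)
qed simp

lemma cmod_Ln_add_diff_le:
  assumes "Re w > 0" "c \<ge> 0"
  shows "cmod (Ln (w + of_real c) - Ln w) \<le> c / cmod w"
proof -
  let ?S = "closed_segment w (w + of_real c)"
  have S: "Re y > 0 \<and> cmod w \<le> cmod y" if y: "y \<in> ?S" for y
  proof -
    obtain u where u: "0 \<le> u" "u \<le> 1" "y = (1 - u) *\<^sub>R w + u *\<^sub>R (w + of_real c)"
      using y by (auto simp: closed_segment_def)
    then have "y = w + of_real (u * c)" by (simp add: scaleR_conv_of_real algebra_simps)
    then show ?thesis using cmod_add_of_real_ge[of w "u * c"] assms u by (auto simp: add_pos_nonneg)
  qed
  have "cmod (Ln (w + of_real c) - Ln w) \<le> (1 / cmod w) * cmod (w + of_real c - w)"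
  proof (rule field_differentiable_bound[where S = ?S and f' = "\<lambda>y. inverse y"])
    show "(Ln has_field_derivative inverse y) (at y within ?S)" if "y \<in> ?S" for y
      by (rule has_field_derivative_at_within[OF has_field_derivative_Ln])
        (use S[OF that] in \<open>auto simp: complex_nonpos_Reals_iff\<close>)
    show "cmod (inverse y) \<le> 1 / cmod w" if "y \<in> ?S" for y
    proof -
      have "cmod w > 0" using assms by auto
      then show ?thesis using S[OF that] by (simp add: norm_divide inverse_eq_divide frac_le)
    qed
  qed auto
  then show ?thesis using assms by simp
qed

text \<open>In the upper half plane the arguments of z - 1 and z + 1 are positive with sum below 3
  pi / 2, and the sine of the sum is positive because Im (z^2 - 1) > 0. So the sum is below pi and
  no correction by 2 pi arises. The lower half plane follows by conjugation.\<close>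

lemma Ln_square_minus_1:
  assumes "Re z > 0" "Im z \<noteq> 0 \<or> Re z > 1"
  shows "Ln (z\<^sup>2 - 1) = Ln (z - 1) + Ln (z + 1)"
proof -
  have f: "z\<^sup>2 - 1 = (z - 1) * (z + 1)" by (simp add: power2_eq_square algebra_simps)
  have up: "Ln (w\<^sup>2 - 1) = Ln (w - 1) + Ln (w + 1)" if w: "Re w > 0" "Im w > 0" for w
  proof -
    have f: "w\<^sup>2 - 1 = (w - 1) * (w + 1)" by (simp add: power2_eq_square algebra_simps)
    have nz: "w - 1 \<noteq> 0" "w + 1 \<noteq> 0" using w by (auto simp: complex_eq_iff)
    define s where "s = Im (Ln (w - 1)) + Im (Ln (w + 1))"
    have a: "0 < Im (Ln (w - 1))" "Im (Ln (w - 1)) < pi"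
      using Im_Ln_pos_lt_imp[of "w - 1"] w by auto
    have b: "0 < Im (Ln (w + 1))" using Im_Ln_pos_lt_imp[of "w + 1"] w by auto
    have c: "\<bar>Im (Ln (w + 1))\<bar> < pi / 2" using Re_Ln_pos_lt[of "w + 1"] nz w by auto
    have "w\<^sup>2 - 1 = exp (Ln (w - 1) + Ln (w + 1))"
      unfolding f using nz by (simp add: exp_add)
    then have "Im (w\<^sup>2 - 1) = exp (Re (Ln (w - 1) + Ln (w + 1))) * sin s"
      unfolding s_def by (simp add: Im_exp)
    moreover have "Im (w\<^sup>2 - 1) > 0" using w by (simp add: power2_eq_square)
    ultimately have sp: "sin s > 0" by (simp add: zero_less_mult_iff)
    have "s < pi"
    proof (rule ccontr)
      assume "\<not> s < pi"
      then have "sin (s - pi) \<ge> 0" using a b c s_def by (intro sin_ge_zero) auto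
      then show False using sp by (simp add: sin_diff)
    qed
    then show ?thesis unfolding f using nz a b s_def by (intro Ln_times_simple) auto
  qed
  consider "Im z > 0" | "Im z < 0" | "Im z = 0" "Re z > 1" using assms by linarith
  then show ?thesis
  proof cases
    case 1
    then show ?thesis using up assms by simp
  next
    case 2
    have np: "z - 1 \<notin> \<real>\<^sub>\<le>\<^sub>0" "z + 1 \<notin> \<real>\<^sub>\<le>\<^sub>0" "z\<^sup>2 - 1 \<notin> \<real>\<^sub>\<le>\<^sub>0"
      using 2 assms(1) by (auto simp: complex_nonpos_Reals_iff power2_eq_square)
    have "Ln (cnj (z\<^sup>2 - 1)) = Ln (cnj (z - 1)) + Ln (cnj (z + 1))" using up[of "cnj z"] 2 assms by simp
    then have "cnj (Ln (z\<^sup>2 - 1)) = cnj (Ln (z - 1) + Ln (z + 1))"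
      unfolding complex_cnj_add[of "Ln (z - 1)"] cnj_Ln[OF np(1)] cnj_Ln[OF np(2)] cnj_Ln[OF np(3)] .
    then show ?thesis by (simp only: complex_cnj_cancel_iff)
  next
    case 3
    then have z: "z = of_real (Re z)" by (simp add: complex_eq_iff)
    have "Ln (z - 1) = of_real (ln (Re z - 1))" "Ln (z + 1) = of_real (ln (Re z + 1))"
      using 3 Ln_of_real[of "Re z - 1"] Ln_of_real[of "Re z + 1"] z by auto
    then have "Im (Ln (z - 1)) = 0" "Im (Ln (z + 1)) = 0" by auto
    moreover have "z - 1 \<noteq> 0" "z + 1 \<noteq> 0" using 3 by (auto simp: complex_eq_iff)
    ultimately show ?thesis unfolding f using pi_gt_zero by (intro Ln_times_simple) auto
  qed
qed

lemma has_field_derivative_prod_log: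
  fixes f :: "'i \<Rightarrow> complex \<Rightarrow> complex"
  assumes "finite I" "\<And>i. i \<in> I \<Longrightarrow> (f i has_field_derivative L i * f i s) (at s)"
  shows "((\<lambda>s. \<Prod>i\<in>I. f i s) has_field_derivative (\<Sum>i\<in>I. L i) * (\<Prod>i\<in>I. f i s)) (at s)"
  using assms
proof (induction I rule: finite_induct)
  case (insert x F)
  have "((\<lambda>s. f x s * (\<Prod>i\<in>F. f i s)) has_field_derivative
      (L x * f x s) * (\<Prod>i\<in>F. f i s) + ((\<Sum>i\<in>F. L i) * (\<Prod>i\<in>F. f i s)) * f x s) (at s)"
    by (rule DERIV_mult) (use insert in auto)
  then show ?case using insert by (simp add: algebra_simps)
qed simp

text \<open>Comparison with the increments of sqrt: sqrt (i + 1) + sqrt i is at most 3 sqrt (i +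
  1/2).\<close>

lemma sum_inverse_sqrt_le: "(\<Sum>i<n. 1 / sqrt (real i + 1/2)) \<le> 3 * sqrt (real n)"
proof -
  have "1 / sqrt (real i + 1/2) \<le> 3 * (sqrt (real (Suc i)) - sqrt (real i))" for i
  proof -
    let ?a = "sqrt (real i)" and ?b = "sqrt (real (Suc i))" and ?c = "sqrt (real i + 1/2)"
    have c: "?c > 0" by simp
    have ac: "?a \<le> ?c" by simp
    have "?b \<le> 2 * ?c"
      by (rule real_le_lsqrt) (auto simp: power_mult_distrib)
    then have "?b + ?a \<le> 3 * ?c" using ac by linarith
    moreover have "(?b - ?a) * (?b + ?a) = 1" by (simp add: algebra_simps)
    moreover have "?b - ?a \<ge> 0" by simp
    ultimately have "1 \<le> (?b - ?a) * (3 * ?c)" by (metis mult_left_mono)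
    then have "1 \<le> 3 * (?b - ?a) * ?c" by (simp only: mult.assoc mult.commute mult.left_commute)
    then show ?thesis using pos_divide_le_eq[OF c] by (simp only:)
  qed
  then have "(\<Sum>i<n. 1 / sqrt (real i + 1/2)) \<le> (\<Sum>i<n. 3 * (sqrt (real (Suc i)) - sqrt (real i)))"
    by (meson sum_mono)
  also have "\<dots> = 3 * sqrt (real n)"
    by (subst sum_distrib_left[symmetric], subst sum_lessThan_telescope) simp
  finally show ?thesis .
qed

lemma ln_le_2_sqrt: "x > 0 \<Longrightarrow> ln x \<le> 2 * sqrt (x::real)"
proof -
  assume x: "x > 0"
  have "ln x = 2 * ln (sqrt x)" using x by (simp add: ln_sqrt)
  also have "ln (sqrt x) \<le> sqrt x" using ln_bound[of "sqrt x"] x by simp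
  finally show ?thesis by simp
qed

locale kernel_setting = geometry +
  fixes \<nu> :: "nat \<Rightarrow> nat" and \<kappa> :: nat and \<theta>0 :: real
  assumes kappa: "\<kappa> > \<nu> 1" and theta0: "0 < \<theta>0" "\<theta>0 < \<tau>"
begin

definition a :: real where "a = Re (Z \<theta>0)"
definition b :: real where "b = Im (Z \<theta>0)"

lemma a_pos: "a > 0" and b_pos: "b > 0"
  using Re_Z_pos[of \<theta>0] Im_Z_pos[of \<theta>0] theta0 by (auto simp: a_def b_def)

text \<open>
  Here \<open>\<Gamma>(s + 1) / \<Gamma>(s - n + 1)\<close> is replaced by the falling product, which removes the
  apparent singularities at the points \<open>0, \<dots>, n - 1\<close>.
\<close>

definition Phi :: "nat \<Rightarrow> complex \<Rightarrow> complex" where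
  "Phi n s = (\<Prod>i<n. s - of_nat i) * (\<Prod>j=1..M. Gamma (s + of_nat (\<nu> j) + 1)) * rGamma (s + of_nat n + of_nat \<kappa>)"

text \<open>The logarithmic derivative of \<open>Phi\<close>, away from the zeros of the falling
  product.\<close>

definition Lam :: "nat \<Rightarrow> complex \<Rightarrow> complex" where
  "Lam n s = (\<Sum>i<n. 1 / (s - of_nat i)) + (\<Sum>j=1..M. Digamma (s + of_nat (\<nu> j) + 1)) - Digamma (s + of_nat n + of_nat \<kappa>)"

lemma not_nonpos_Ints: "Re s > 0 \<Longrightarrow> s \<notin> \<int>\<^sub>\<le>\<^sub>0"
  by (auto elim!: nonpos_Ints_cases)

lemma Phi_has_derivative:
  assumes "Re s > -1" "s \<notin> of_nat ` {..<n}"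
  shows "(Phi n has_field_derivative Lam n s * Phi n s) (at s)"
proof -
  have 1: "((\<lambda>s. \<Prod>i<n. s - of_nat i) has_field_derivative (\<Sum>i<n. 1 / (s - of_nat i)) * (\<Prod>i<n. s - of_nat i)) (at s)"
    by (rule has_field_derivative_prod_log) (use assms in \<open>auto intro!: derivative_eq_intros\<close>)
  have 2: "((\<lambda>s. \<Prod>j=1..M. Gamma (s + of_nat (\<nu> j) + 1)) has_field_derivative
      (\<Sum>j=1..M. Digamma (s + of_nat (\<nu> j) + 1)) * (\<Prod>j=1..M. Gamma (s + of_nat (\<nu> j) + 1))) (at s)"
  proof (rule has_field_derivative_prod_log)
    show "((\<lambda>s. Gamma (s + of_nat (\<nu> j) + 1)) has_field_derivative
        Digamma (s + of_nat (\<nu> j) + 1) * Gamma (s + of_nat (\<nu> j) + 1)) (at s)" for j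
      using not_nonpos_Ints[of "s + of_nat (\<nu> j) + 1"] assms
      by (auto intro!: derivative_eq_intros)
  qed simp
  have 3: "((\<lambda>s. rGamma (s + of_nat n + of_nat \<kappa>)) has_field_derivative
      - Digamma (s + of_nat n + of_nat \<kappa>) * rGamma (s + of_nat n + of_nat \<kappa>)) (at s)"
    using not_nonpos_Ints[of "s + of_nat n + of_nat \<kappa>"] assms kappa
    by (auto intro!: derivative_eq_intros)
  show ?thesis
    unfolding Phi_def[abs_def] Lam_def
    by (rule DERIV_cong[OF DERIV_mult[OF DERIV_mult[OF 1 2] 3]]) (simp add: algebra_simps)
qed

lemma Phi_nonzero:
  assumes "Re s > -1" "s \<notin> of_nat ` {..<n}"
  shows "Phi n s \<noteq> 0"
proof -
  have "Gamma (s + of_nat (\<nu> j) + 1) \<noteq> 0" for j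
    using not_nonpos_Ints[of "s + of_nat (\<nu> j) + 1"] assms by (auto simp: Gamma_eq_zero_iff)
  moreover have "rGamma (s + of_nat n + of_nat \<kappa>) \<noteq> 0"
    using not_nonpos_Ints[of "s + of_nat n + of_nat \<kappa>"] assms kappa by (auto simp: rGamma_eq_zero_iff)
  ultimately show ?thesis using assms by (auto simp: Phi_def)
qed

lemma kappa_split: "of_nat n + of_nat \<kappa> = (of_real (real n + real (\<kappa> - 1)) + 1 :: complex)"
  using kappa by (simp add: of_nat_diff)

text \<open>With w = n z, the terms 1 / (t - i) are midpoint values for
  \<open>Ln (w - i) - Ln (w - i - 1)\<close> and telescope to \<open>Ln w - Ln (w - n)\<close>; each
  of the M Digamma terms is near \<open>Ln w\<close>, the last one near \<open>Ln (w + n)\<close>.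
  Pulling out ln n leaves the main term. The distance \<epsilon> from [0, 1] keeps the midpoints t -
  i of size n.\<close>

lemma Lam_approx:
  assumes \<epsilon>: "\<epsilon> > 0"
  obtains C where "C > 0"
    "\<And>n z. real n * \<epsilon> \<ge> 1 \<Longrightarrow> Re z > 0 \<Longrightarrow> (\<And>x. 0 \<le> x \<Longrightarrow> x \<le> 1 \<Longrightarrow> \<epsilon> \<le> cmod (z - of_real x)) \<Longrightarrow>
      cmod (Lam n (of_nat n * z - 1/2) -
        (of_real ((real M - 1) * ln (real n)) + (of_real (real M + 1) * Ln z - Ln (z\<^sup>2 - 1)))) \<le> C / real n"
proof
  \<comment> \<open>One summand each for the falling product, for the M Digamma terms, and for the
    Digamma term at s + n + \<kappa>.\<close>
  define C where "C = 1 / \<epsilon>\<^sup>2 + (\<Sum>j=1..M. 2 / \<epsilon> + real (\<nu> j) / \<epsilon>) + (2 + real \<kappa>)"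
  show "C > 0" unfolding C_def using \<epsilon> kappa by (intro add_nonneg_pos add_nonneg_nonneg sum_nonneg) auto
  fix n :: nat and z :: complex
  assume n: "real n * \<epsilon> \<ge> 1" and z: "Re z > 0" and d: "\<And>x. 0 \<le> x \<Longrightarrow> x \<le> 1 \<Longrightarrow> \<epsilon> \<le> cmod (z - of_real x)"
  have n0: "real n > 0" using n \<epsilon> by (cases "n = 0") auto
  have z\<epsilon>: "cmod z \<ge> \<epsilon>" using d[of 0] by simp
  have I: "Im z \<noteq> 0 \<or> Re z > 1"
  proof (rule ccontr)
    assume "\<not> ?thesis"
    then have "z = of_real (Re z)" "Re z \<le> 1" by (auto simp: complex_eq_iff)
    then show False using d[of "Re z"] z \<epsilon> by simp
  qed
  let ?t = "of_nat n * z - 1/2"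
  let ?w = "of_nat n * z"
  have wRe: "Re ?w > 0" using z n0 by simp
  have wn: "cmod ?w \<ge> real n * \<epsilon>" using z\<epsilon> n0 by (simp add: norm_mult)
  have e1: "cmod ((\<Sum>i<n. 1 / (?t - of_nat i)) - (Ln ?w - Ln (?w - of_nat n))) \<le> 1 / \<epsilon>\<^sup>2 / real n"
  proof -
    have b: "cmod (1 / (?t - of_nat i) - (Ln (?w - of_nat i) - Ln (?w - of_nat (Suc i)))) \<le> 1 / (real n * \<epsilon>)\<^sup>2"
      if i: "i < n" for i
    proof -
      let ?v = "?t - of_nat i"
      have x: "0 \<le> (real i + 1/2) / real n" "(real i + 1/2) / real n \<le> 1" using i n0 by auto
      have "?v = of_nat n * (z - of_real ((real i + 1/2) / real n))" using n0 by (simp add: field_simps)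
      then have "cmod ?v = real n * cmod (z - of_real ((real i + 1/2) / real n))" by (simp add: norm_mult)
      then have v: "cmod ?v \<ge> real n * \<epsilon>" using d[OF x] n0 by simp
      have vI: "Im ?v \<noteq> 0 \<or> Re ?v > 1/2"
      proof (cases "Im z = 0")
        case True
        then have "Re z > 1" using I by simp
        then have "real n * Re z > real n" using n0 by simp
        moreover have "real i + 1 \<le> real n" using i by simp
        ultimately have "real n * Re z > real i + 1" by linarith
        then show ?thesis by simp
      qed (use n0 in simp)
      have "cmod (1 / ?v - (Ln (?v + 1/2) - Ln (?v - 1/2))) \<le> 1 / (cmod ?v)\<^sup>2"
        by (rule inverse_Ln_diff_bound) (use v n vI in auto)
      also have "\<dots> \<le> 1 / (real n * \<epsilon>)\<^sup>2" using v n by (intro frac_le power_mono zero_less_power) linarith+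
      finally show ?thesis by (simp add: algebra_simps)
    qed
    have tel: "(\<Sum>i<n. Ln (?w - of_nat i) - Ln (?w - of_nat (Suc i))) = Ln ?w - Ln (?w - of_nat n)"
      by (subst sum_lessThan_telescope') simp
    have "(\<Sum>i<n. 1 / (?t - of_nat i) - (Ln (?w - of_nat i) - Ln (?w - of_nat (Suc i))))
        = (\<Sum>i<n. 1 / (?t - of_nat i)) - (Ln ?w - Ln (?w - of_nat n))"
      by (subst sum_subtractf) (simp only: tel)
    note eq = this
    have "cmod (\<Sum>i<n. 1 / (?t - of_nat i) - (Ln (?w - of_nat i) - Ln (?w - of_nat (Suc i)))) \<le> (\<Sum>i<n. 1 / (real n * \<epsilon>)\<^sup>2)"
      by (intro sum_norm_le b) auto
    also have "\<dots> = 1 / \<epsilon>\<^sup>2 / real n" using n0 by (simp add: power2_eq_square)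
    finally show ?thesis unfolding eq .
  qed
  have e2: "cmod (Digamma (?t + of_nat m + 1) - Ln ?w) \<le> (2 / \<epsilon> + real m / \<epsilon>) / real n" for m
  proof -
    have g: "cmod ?w \<le> cmod (?w + of_real (real m))" using cmod_add_of_real_ge[of ?w "real m"] wRe by simp
    have "cmod (Digamma ((?w + of_real (real m)) + 1/2) - Ln (?w + of_real (real m))) \<le> 2 / cmod (?w + of_real (real m))"
      by (rule Digamma_Ln_bound) (use g wn n wRe in auto)
    also have "\<dots> \<le> 2 / (real n * \<epsilon>)" by (rule frac_le) (use g wn n in linarith)+
    finally have 1: "cmod (Digamma ((?w + of_real (real m)) + 1/2) - Ln (?w + of_real (real m))) \<le> 2 / (real n * \<epsilon>)" .
    have "cmod (Ln (?w + of_real (real m)) - Ln ?w) \<le> real m / cmod ?w"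
      by (rule cmod_Ln_add_diff_le) (use wRe in auto)
    also have "\<dots> \<le> real m / (real n * \<epsilon>)" by (rule frac_le) (use wn n in linarith)+
    finally have 2: "cmod (Ln (?w + of_real (real m)) - Ln ?w) \<le> real m / (real n * \<epsilon>)" .
    have "?t + of_nat m + 1 = (?w + of_real (real m)) + 1/2" by simp
    then have "Digamma (?t + of_nat m + 1) - Ln ?w
       = (Digamma ((?w + of_real (real m)) + 1/2) - Ln (?w + of_real (real m))) + (Ln (?w + of_real (real m)) - Ln ?w)"
      by (simp only:) simp
    then have "cmod (Digamma (?t + of_nat m + 1) - Ln ?w) \<le> 2 / (real n * \<epsilon>) + real m / (real n * \<epsilon>)"
      using norm_triangle_le[OF add_mono[OF 1 2]] by (simp only:)
    also have "\<dots> = (2 / \<epsilon> + real m / \<epsilon>) / real n" by (simp add: add_divide_distrib mult.commute)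
    finally show ?thesis .
  qed
  have e3: "cmod (Digamma (?t + of_nat n + of_nat \<kappa>) - Ln (?w + of_nat n)) \<le> (2 + real \<kappa>) / real n"
  proof -
    let ?y = "?w + of_nat n" and ?k = "real (\<kappa> - 1)"
    have yRe: "Re ?y > 0" "real n \<le> Re ?y" using wRe n0 by auto
    have yn: "real n \<le> cmod ?y" using abs_Re_le_cmod[of ?y] yRe by linarith
    have n1: "real n \<ge> 1" using n0 by simp
    have g: "cmod ?y \<le> cmod (?y + of_real ?k)" using cmod_add_of_real_ge[of ?y ?k] yRe by simp
    have "cmod (Digamma ((?y + of_real ?k) + 1/2) - Ln (?y + of_real ?k)) \<le> 2 / cmod (?y + of_real ?k)"
      by (rule Digamma_Ln_bound) (use g yn n1 yRe in auto)
    also have "\<dots> \<le> 2 / real n" using g yn n1 by (intro divide_left_mono) (auto intro!: mult_pos_pos)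
    finally have 1: "cmod (Digamma ((?y + of_real ?k) + 1/2) - Ln (?y + of_real ?k)) \<le> 2 / real n" .
    have "cmod (Ln (?y + of_real ?k) - Ln ?y) \<le> ?k / cmod ?y"
      by (rule cmod_Ln_add_diff_le) (use yRe in auto)
    also have "\<dots> \<le> real \<kappa> / real n" using yn n1 by (intro frac_le) auto
    finally have 2: "cmod (Ln (?y + of_real ?k) - Ln ?y) \<le> real \<kappa> / real n" .
    have "?t + of_nat n + of_nat \<kappa> = (?y + of_real ?k) + 1/2"
      using kappa by (simp add: of_nat_diff)
    then have "Digamma (?t + of_nat n + of_nat \<kappa>) - Ln ?y
       = (Digamma ((?y + of_real ?k) + 1/2) - Ln (?y + of_real ?k)) + (Ln (?y + of_real ?k) - Ln ?y)"
      by (simp only:) simp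
    then show ?thesis
      using norm_triangle_le[OF add_mono[OF 1 2]] by (simp only: add_divide_distrib)
  qed
  have lns: "Ln ?w = of_real (ln (real n)) + Ln z" "Ln (?w - of_nat n) = of_real (ln (real n)) + Ln (z - 1)"
    "Ln (?w + of_nat n) = of_real (ln (real n)) + Ln (z + 1)"
  proof -
    have nz: "z \<noteq> 0" "z - 1 \<noteq> 0" "z + 1 \<noteq> 0" using z I by (auto simp: complex_eq_iff)
    have f: "?w - of_nat n = of_nat n * (z - 1)" "?w + of_nat n = of_nat n * (z + 1)" by (simp_all add: algebra_simps)
    have lnn: "Ln (of_nat n) = of_real (ln (real n))" using Ln_of_real[OF n0] by simp
    show "Ln ?w = of_real (ln (real n)) + Ln z" using Ln_times_of_real[OF n0 nz(1)] lnn by simp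
    show "Ln (?w - of_nat n) = of_real (ln (real n)) + Ln (z - 1)" unfolding f using Ln_times_of_real[OF n0 nz(2)] lnn by simp
    show "Ln (?w + of_nat n) = of_real (ln (real n)) + Ln (z + 1)" unfolding f using Ln_times_of_real[OF n0 nz(3)] lnn by simp
  qed
  let ?E1 = "(\<Sum>i<n. 1 / (?t - of_nat i)) - (Ln ?w - Ln (?w - of_nat n))"
  let ?E2 = "\<Sum>j=1..M. Digamma (?t + of_nat (\<nu> j) + 1) - Ln ?w"
  let ?E3 = "Digamma (?t + of_nat n + of_nat \<kappa>) - Ln (?w + of_nat n)"
  have E2: "cmod ?E2 \<le> (\<Sum>j=1..M. 2 / \<epsilon> + real (\<nu> j) / \<epsilon>) / real n"
    unfolding sum_divide_distrib by (intro sum_norm_le e2)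
  have "Lam n ?t - (of_real ((real M - 1) * ln (real n)) + (of_real (real M + 1) * Ln z - Ln (z\<^sup>2 - 1)))
      = ?E1 + ?E2 - ?E3"
    unfolding Lam_def Ln_square_minus_1[OF z I] lns sum_subtractf by (simp add: algebra_simps)
  also have "cmod \<dots> \<le> 1 / \<epsilon>\<^sup>2 / real n + (\<Sum>j=1..M. 2 / \<epsilon> + real (\<nu> j) / \<epsilon>) / real n + (2 + real \<kappa>) / real n"
    using norm_triangle_ineq4[of "?E1 + ?E2" ?E3] norm_triangle_ineq[of ?E1 ?E2] e1 E2 e3 by linarith
  also have "\<dots> = C / real n" by (simp add: C_def add_divide_distrib)
  finally show "cmod (Lam n ?t - (of_real ((real M - 1) * ln (real n)) + (of_real (real M + 1) * Ln z - Ln (z\<^sup>2 - 1)))) \<le> C / real n" .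
qed

end

lemma increment_bounds:
  fixes f :: "real \<Rightarrow> real"
  assumes "p \<le> q" "continuous_on {p..q} f"
    and d: "\<And>x. p < x \<Longrightarrow> x < q \<Longrightarrow> (f has_real_derivative f' x) (at x)"
  shows "(\<And>x. p < x \<Longrightarrow> x < q \<Longrightarrow> f' x \<le> c) \<Longrightarrow> f q - f p \<le> c * (q - p)"
    and "(\<And>x. p < x \<Longrightarrow> x < q \<Longrightarrow> c \<le> f' x) \<Longrightarrow> c * (q - p) \<le> f q - f p"
proof -
  have "p = q \<or> (\<exists>z. p < z \<and> z < q \<and> f q - f p = f' z * (q - p))"
  proof (cases "p = q")
    case False
    have "f differentiable (at x)" if "p < x" "x < q" for x
      using d[OF that] real_differentiable_def by blast
    then obtain l z where z: "p < z" "z < q" "DERIV f z :> l" "f q - f p = (q - p) * l"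
      using MVT[of p q f] assms False by auto
    then have "l = f' z" using d DERIV_unique by blast
    then show ?thesis using z by (auto simp: mult.commute)
  qed simp
  then show "(\<And>x. p < x \<Longrightarrow> x < q \<Longrightarrow> f' x \<le> c) \<Longrightarrow> f q - f p \<le> c * (q - p)"
    and "(\<And>x. p < x \<Longrightarrow> x < q \<Longrightarrow> c \<le> f' x) \<Longrightarrow> c * (q - p) \<le> f q - f p"
    using assms(1) by (auto intro!: mult_right_mono)
qed

lemma Complex_polar:
  assumes "x > 0"
  shows "Complex x v = of_real (x / cos (arctan (v / x))) * cis (arctan (v / x))"
proof -
  have c: "cos (arctan (v / x)) > 0" using cos_arctan_not_zero arctan_bounded cos_gt_zero_pi by blast
  have "sin (arctan (v / x)) = cos (arctan (v / x)) * (v / x)"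
    using tan_arctan[of "v / x"] c unfolding tan_def by (simp add: divide_eq_eq mult.commute)
  then show ?thesis using c assms by (simp add: complex_eq_iff)
qed

lemma Im_Ln_eq_arctan:
  assumes "Re z > 0"
  shows "Im (Ln z) = arctan (Im z / Re z)"
proof -
  let ?t = "arctan (Im z / Re z)"
  have t: "- (pi/2) < ?t" "?t < pi/2" by (rule arctan_lbound, rule arctan_ubound)
  have "cos ?t > 0" using t cos_gt_zero_pi by simp
  then have "Ln (of_real (Re z / cos ?t) * cis ?t) = of_real (ln (Re z / cos ?t)) + \<i> * of_real ?t"
    using assms t pi_gt_zero by (intro geometry.Ln_of_real_mult_cis) (auto simp: geometry_def)
  then show ?thesis using Complex_polar[OF assms, of "Im z"] by simp
qed

lemma abs_Im_Digamma_le: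
  assumes "p \<ge> 1" "Re z \<ge> p" "Im z \<ge> 0"
  shows "\<bar>Im (Digamma (z + 1/2))\<bar> \<le> Im z / p + 2 / p"
proof -
  have cz: "cmod z \<ge> p" using abs_Re_le_cmod[of z] assms by linarith
  have "cmod (Digamma (z + 1/2) - Ln z) \<le> 2 / cmod z"
    by (rule Digamma_Ln_bound) (use assms cz in auto)
  also have "\<dots> \<le> 2 / p" by (rule frac_le) (use cz assms in auto)
  finally have "\<bar>Im (Digamma (z + 1/2) - Ln z)\<bar> \<le> 2 / p" using abs_Im_le_cmod order_trans by blast
  moreover have "\<bar>Im (Ln z)\<bar> \<le> Im z / p"
  proof -
    have "\<bar>Im (Ln z)\<bar> = arctan (Im z / Re z)" using Im_Ln_eq_arctan[of z] assms by simp
    also have "\<dots> \<le> Im z / Re z" using assms by (intro arctan_le_self) auto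
    also have "\<dots> \<le> Im z / p" using assms by (intro divide_left_mono) auto
    finally show ?thesis .
  qed
  ultimately show ?thesis by auto
qed

context kernel_setting
begin

text \<open>The rescaling of the plane by n. The zeros k = 0, ..., n - 1 of the falling product come
  from the points (k + 1/2) / n of (0, 1), and z = 0 goes to the point -1/2 of the original
  line.\<close>

definition pt :: "nat \<Rightarrow> complex \<Rightarrow> complex" where "pt n z = of_nat n * z - 1/2"

lemma pt_simps [simp]: "Re (pt n z) = real n * Re z - 1/2" "Im (pt n z) = real n * Im z"
  by (simp_all add: pt_def)

lemma pt_not_pole:
  assumes "Re z \<ge> 0" "Im z \<noteq> 0 \<or> Re z > 1 \<or> z = 0"
  shows "Re (pt n z) > -1" "pt n z \<notin> of_nat ` {..<n}"
proof -
  have "0 \<le> real n * Re z" using assms by simp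
  then show "Re (pt n z) > -1" by simp
  show "pt n z \<notin> of_nat ` {..<n}"
  proof
    assume "pt n z \<in> of_nat ` {..<n}"
    then obtain k where k: "k < n" "pt n z = of_nat k" by auto
    have "real n * Im z = 0" "real n * Re z - 1/2 = real k"
      using arg_cong[OF k(2), of Im] arg_cong[OF k(2), of Re] by simp_all
    then have "Im z = 0" "real n * Re z = real k + 1/2" using k by auto
    moreover have "real k + 1 \<le> real n" using k by simp
    ultimately have "z \<noteq> 0" "\<not> Re z > 1"
      using mult_strict_left_mono[of 1 "Re z" "real n"] by auto
    then show False using assms(2) \<open>Im z = 0\<close> by auto
  qed
qed

lemma Phi_cnj: "Phi n (cnj s) = cnj (Phi n s)"
  by (simp add: Phi_def cnj_Gamma cnj_rGamma)

lemma Phi_pt_cnj: "cmod (Phi n (pt n (cnj z))) = cmod (Phi n (pt n z))"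
proof -
  have "pt n (cnj z) = cnj (pt n z)" by (simp add: pt_def)
  then show ?thesis by (simp add: Phi_cnj)
qed

lemma ln_Phi_has_derivative:
  assumes c: "(c has_vector_derivative c') (at t within S)"
    and "Re (c t) \<ge> 0" "Im (c t) \<noteq> 0 \<or> Re (c t) > 1 \<or> c t = 0"
  shows "((\<lambda>t. ln (cmod (Phi n (pt n (c t))))) has_real_derivative real n * Re (Lam n (pt n (c t)) * c')) (at t within S)"
proof -
  note p = pt_not_pole[OF assms(2,3), of n]
  have "((\<lambda>t. pt n (c t)) has_vector_derivative of_nat n * c') (at t within S)"
    unfolding pt_def using c by (auto intro!: derivative_eq_intros)
  then have "((\<lambda>t. ln (cmod (Phi n (pt n (c t))))) has_real_derivative Re (Lam n (pt n (c t)) * (of_nat n * c'))) (at t within S)"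
    by (rule has_real_derivative_ln_cmod) (use Phi_has_derivative[OF p] Phi_nonzero[OF p] in auto)
  moreover have "Re (Lam n (pt n (c t)) * (of_nat n * c')) = real n * Re (Lam n (pt n (c t)) * c')"
    by (simp add: algebra_simps)
  ultimately show ?thesis by simp
qed

subsection \<open>The vertical line\<close>

text \<open>
  \<open>- n h(u)\<close> is the leading term of the derivative of \<open>V n\<close>, and \<open>h\<close> changes sign only at \<open>b\<close>.
\<close>

definition h :: "real \<Rightarrow> real" where
  "h u = Im (of_real (real M + 1) * Ln (Complex a u) - Ln ((Complex a u)\<^sup>2 - 1))"

definition V :: "nat \<Rightarrow> real \<Rightarrow> real" where "V n u = ln (cmod (Phi n (pt n (Complex a u))))"

lemma V_has_derivative:
  assumes "u \<noteq> 0"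
  shows "(V n has_real_derivative - real n * Im (Lam n (pt n (Complex a u)))) (at u)"
proof -
  have c: "(Complex a has_vector_derivative \<i>) (at u)"
    unfolding Complex_eq[abs_def] by (auto intro!: derivative_eq_intros)
  show ?thesis unfolding V_def[abs_def]
    using ln_Phi_has_derivative[OF c, of n] assms a_pos by simp
qed

lemma h_eq: "h u = (real M + 1) * arctan (u / a) - Im (Ln ((Complex a u)\<^sup>2 - 1))"
  using Im_Ln_eq_arctan[of "Complex a u"] a_pos by (simp add: h_def)

lemma arctan_b: "arctan (b / a) = \<theta>0"
proof (rule arctan_unique)
  show "- (pi/2) < \<theta>0" "\<theta>0 < pi/2" using theta0 tau by auto
  show "tan \<theta>0 = b / a" using R_pos[of \<theta>0] theta0 by (simp add: a_def b_def Re_Z Im_Z tan_def)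
qed

text \<open>In polar form a + \<i>u has the angle t = arctan (u / a) and the modulus r = a / cos t,
  so r compares with sqrt (R t) as a compares with Re (Z t). As Re Z is strictly decreasing, the
  line lies inside the curve for u < b and outside for u > b, and \<open>Arg_sign\<close>
  applies.\<close>

lemma
  assumes "u > 0"
  shows h_neg: "u < b \<Longrightarrow> h u < 0" and h_pos: "b < u \<Longrightarrow> h u > 0"
    and h_large: "u \<ge> a * tan (5 * pi / 12) \<Longrightarrow> h u \<ge> pi / 4"
proof -
  define t where "t = arctan (u / a)"
  define r where "r = a / cos t"
  have t: "0 < t" "t < pi/2" using assms a_pos arctan_ubound by (auto simp: t_def)
  have ct: "cos t > 0" using t cos_gt_zero by simp
  have r: "r > 0" using ct a_pos by (simp add: r_def)
  have C: "Complex a u = of_real r * cis t" unfolding r_def t_def by (rule Complex_polar[OF a_pos])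
  have hu0: "h u = (real M + 1) * t - Im (Ln ((Complex a u)\<^sup>2 - 1))"
    unfolding t_def by (rule h_eq)
  have hu: "h u = (real M + 1) * t - Im (Ln ((of_real r * cis t)\<^sup>2 - 1))"
    by (simp only: hu0 C)
  note A = Arg_sign[OF r t]
  show "h u < 0" if "u < b"
  proof -
    have "u / a < b / a" using that a_pos by (simp add: divide_strict_right_mono)
    then have "arctan (u / a) < arctan (b / a)" by (simp only: arctan_less_iff)
    then have t0: "t < \<theta>0" by (simp only: arctan_b t_def)
    then have "a < sqrt (R t) * cos t"
      using Re_Z_strict_antimono[of t \<theta>0] t theta0 by (simp add: a_def Re_Z)
    then have "r < sqrt (R t)" using ct by (simp add: r_def divide_less_eq)
    then have "r\<^sup>2 < (sqrt (R t))\<^sup>2" using r by (intro power_strict_mono) auto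
    then have "r\<^sup>2 < R t" using R_pos[of t] t t0 theta0 by simp
    then show ?thesis using A(1) t0 theta0 hu by simp
  qed
  show "h u > 0" if "b < u"
  proof -
    have "b / a < u / a" using that a_pos by (simp add: divide_strict_right_mono)
    then have "arctan (b / a) < arctan (u / a)" by (simp only: arctan_less_iff)
    then have t0: "\<theta>0 < t" by (simp only: arctan_b t_def)
    have "r\<^sup>2 > R t" if tt: "t < \<tau>"
    proof -
      have "sqrt (R t) * cos t < a"
        using Re_Z_strict_antimono[of \<theta>0 t] t0 theta0 tt by (simp add: a_def Re_Z)
      then have "sqrt (R t) < r" using ct by (simp add: r_def less_divide_eq)
      then have "(sqrt (R t))\<^sup>2 < r\<^sup>2" using R_pos[of t] t tt by (intro power_strict_mono) auto
      then show ?thesis using R_pos[of t] t tt by simp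
    qed
    then show ?thesis using A(2) hu by force
  qed
  show "h u \<ge> pi / 4" if "u \<ge> a * tan (5 * pi / 12)"
  proof -
    have "tan (5 * pi / 12) \<le> u / a" using that a_pos by (simp add: le_divide_eq mult.commute)
    then have "arctan (tan (5 * pi / 12)) \<le> t" unfolding t_def arctan_le_iff .
    then have "5 * pi / 12 \<le> t" by (subst (asm) arctan_tan) auto
    then have "3 * (5 * pi / 12) \<le> (real M + 1) * t" using M2 by (intro mult_mono) auto
    then show ?thesis using hu A(5) by simp
  qed
qed

lemma continuous_on_h: "p > 0 \<Longrightarrow> continuous_on {p..q} h"
proof -
  assume p: "p > 0"
  have np: "Complex a u \<notin> \<real>\<^sub>\<le>\<^sub>0" "(Complex a u)\<^sup>2 - 1 \<notin> \<real>\<^sub>\<le>\<^sub>0" if "u \<in> {p..q}" for u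
    using that p a_pos by (auto simp: complex_nonpos_Reals_iff power2_eq_square)
  show ?thesis unfolding h_def[abs_def]
    by (intro continuous_intros) (use np in auto)
qed

lemma Lam_small_u:
  obtains K where "K > 0"
    "\<And>n u. real n * a \<ge> 1 \<Longrightarrow> u > 0 \<Longrightarrow> - Im (Lam n (pt n (Complex a u))) \<ge> - K * (u + 1 / real n)"
proof
  define K where "K = (real M + 1) * (2 / a)"
  show "K > 0" using a_pos by (simp add: K_def)
  fix n :: nat and u :: real
  assume n: "real n * a \<ge> 1" and u: "u > 0"
  let ?s = "pt n (Complex a u)"
  have n0: "real n > 0" using n a_pos by (cases "n = 0") auto
  have D: "\<bar>Im (Digamma (?s + of_real c + 1))\<bar> \<le> 2 / a * (u + 1 / real n)" if "c \<ge> 0" for c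
  proof -
    let ?z = "of_nat n * Complex a u + of_real c"
    have "\<bar>Im (Digamma (?z + 1/2))\<bar> \<le> Im ?z / (real n * a) + 2 / (real n * a)"
      by (rule abs_Im_Digamma_le) (use n u n0 that in auto)
    also have "\<dots> = u / a + 2 / a * (1 / real n)" using n0 a_pos by (simp add: field_simps)
    also have "\<dots> \<le> 2 / a * (u + 1 / real n)" using a_pos u by (simp add: field_simps)
    also have "?z + 1/2 = ?s + of_real c + 1" by (simp add: pt_def)
    finally show ?thesis .
  qed
  have 1: "Im (\<Sum>i<n. 1 / (?s - of_nat i)) \<le> 0"
  proof -
    have "Im (1 / (?s - of_nat i)) \<le> 0" for i
      using u n0 by (simp add: Im_divide divide_nonpos_nonneg)
    then show ?thesis by (simp add: sum_nonpos)
  qed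
  have 2: "\<bar>Im (\<Sum>j=1..M. Digamma (?s + of_nat (\<nu> j) + 1))\<bar> \<le> real M * (2 / a * (u + 1 / real n))"
  proof -
    have "\<bar>\<Sum>j=1..M. Im (Digamma (?s + of_nat (\<nu> j) + 1))\<bar> \<le> (\<Sum>j=1..M. 2 / a * (u + 1 / real n))"
      using D[of "real (\<nu> _)"] by (intro order_trans[OF sum_abs] sum_mono) simp
    then show ?thesis by simp
  qed
  have 3: "\<bar>Im (Digamma (?s + of_nat n + of_nat \<kappa>))\<bar> \<le> 2 / a * (u + 1 / real n)"
  proof -
    have "?s + of_nat n + of_nat \<kappa> = ?s + of_real (real n + real (\<kappa> - 1)) + 1"
      using kappa_split[of n] by (simp add: add.assoc)
    then show ?thesis using D[of "real n + real (\<kappa> - 1)"] by (metis add_nonneg_nonneg of_nat_0_le_iff)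
  qed
  have "K * (u + 1 / real n) = real M * (2 / a * (u + 1 / real n)) + 2 / a * (u + 1 / real n)"
    by (simp only: K_def distrib_right mult.assoc mult_1)
  then show "- Im (Lam n ?s) \<ge> - K * (u + 1 / real n)"
    using 1 2 3 unfolding Lam_def minus_complex.sel plus_complex.sel by linarith
qed

text \<open>The derivative of \<open>V n\<close> is -n h(u) + O(1), so up to O(1) it rises to b and
  falls afterwards. Below \<epsilon> only the one-sided bound is available; the drop from u to
  \<epsilon> is at most n g + K, and it is repaid by the rise of n g over the middle third of
  [0, b]. Beyond B the slope is at most -1, which gives decay in u uniformly in n.\<close>

lemma vertical_bound:
  obtains C B N where "B > 0"
    "\<And>n u. n \<ge> N \<Longrightarrow> u > 0 \<Longrightarrow> V n u \<le> V n b + C - (u - B)"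
proof -
  obtain K where K: "K > 0"
    "\<And>n u. real n * a \<ge> 1 \<Longrightarrow> u > 0 \<Longrightarrow> - Im (Lam n (pt n (Complex a u))) \<ge> - K * (u + 1 / real n)"
    using Lam_small_u by blast
  define B where "B = max b (a * tan (5 * pi / 12))"
  have B: "B \<ge> b" "B > 0" using b_pos by (auto simp: B_def)
  have "compact {b/3..2*b/3}" "{b/3..2*b/3} \<noteq> {}" using b_pos by auto
  then obtain u0 where u0: "u0 \<in> {b/3..2*b/3}" "\<And>u. u \<in> {b/3..2*b/3} \<Longrightarrow> h u \<le> h u0"
    using continuous_attains_sup[OF _ _ continuous_on_h[of "b/3" "2*b/3"]] b_pos by auto
  define c where "c = - h u0"
  have c: "c > 0" using h_neg[of u0] u0(1) b_pos by (auto simp: c_def)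
  define g where "g = c * b / 3"
  have g: "g > 0" using c b_pos by (simp add: g_def)
  \<comment> \<open>On (0, \<epsilon>) the slope is at least -(n K \<epsilon> + K), so \<epsilon>
    \<le> 1 and \<epsilon> \<le> g / K bound the drop by n g + K; \<epsilon> \<le> b / 3 puts the
    middle third into the range of the two-sided estimate.\<close>
  define \<epsilon> where "\<epsilon> = min 1 (min (b/3) (g / K))"
  have e: "\<epsilon> > 0" "\<epsilon> \<le> 1" "\<epsilon> \<le> b / 3" "\<epsilon> \<le> g / K"
    unfolding \<epsilon>_def using b_pos g K by (simp_all only: min_le_iff_disj min_less_iff_conj order_refl simp_thms) auto
  obtain C1 where C1: "C1 > 0"
    "\<And>n z. real n * \<epsilon> \<ge> 1 \<Longrightarrow> Re z > 0 \<Longrightarrow> (\<And>x. 0 \<le> x \<Longrightarrow> x \<le> 1 \<Longrightarrow> \<epsilon> \<le> cmod (z - of_real x)) \<Longrightarrow>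
      cmod (Lam n (of_nat n * z - 1/2) -
        (of_real ((real M - 1) * ln (real n)) + (of_real (real M + 1) * Ln z - Ln (z\<^sup>2 - 1)))) \<le> C1 / real n"
    using Lam_approx[OF e(1)] by blast
  \<comment> \<open>The last condition makes the slope beyond B at most -1, since h \<ge> pi / 4
    there.\<close>
  obtain N :: nat where N: "N \<ge> 1" "real N * \<epsilon> \<ge> 1" "real N * a \<ge> 1" "real N * (pi / 4) \<ge> C1 + 1"
  proof -
    obtain N :: nat where "real N \<ge> max 1 (max (1 / \<epsilon>) (max (1 / a) ((C1 + 1) / (pi / 4))))"
      using real_arch_simple by blast
    then show thesis using e a_pos by (intro that[of N]) (auto simp: field_simps)
  qed
  have appr: "\<bar>Im (Lam n (pt n (Complex a u))) - h u\<bar> \<le> C1 / real n" if n: "n \<ge> N" and u: "u \<ge> \<epsilon>" for n u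
  proof -
    have nN: "real n * \<epsilon> \<ge> real N * \<epsilon>" using n e by simp
    let ?X = "Lam n (pt n (Complex a u)) -
        (of_real ((real M - 1) * ln (real n)) + (of_real (real M + 1) * Ln (Complex a u) - Ln ((Complex a u)\<^sup>2 - 1)))"
    have "cmod ?X \<le> C1 / real n"
      unfolding pt_def
    proof (intro C1(2))
      fix x :: real
      show "\<epsilon> \<le> cmod (Complex a u - of_real x)" using abs_Im_le_cmod[of "Complex a u - of_real x"] u e by simp
    qed (use N nN a_pos in auto)
    moreover have "Im ?X = Im (Lam n (pt n (Complex a u))) - h u" by (simp add: h_def)
    ultimately show ?thesis using abs_Im_le_cmod[of ?X] by linarith
  qed
  have Vc: "continuous_on {p..q} (V n)" if "p > 0" for p q n
    using that by (intro continuous_at_imp_continuous_on ballI DERIV_isCont[OF V_has_derivative]) auto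
  let ?V' = "\<lambda>n u. - real n * Im (Lam n (pt n (Complex a u)))"
  have V'bd: "\<bar>?V' n u + real n * h u\<bar> \<le> C1" if "n \<ge> N" "u \<ge> \<epsilon>" for n u
  proof -
    have n0: "real n > 0" using that N by simp
    have "\<bar>?V' n u + real n * h u\<bar> = real n * \<bar>Im (Lam n (pt n (Complex a u))) - h u\<bar>"
    proof -
      have "?V' n u + real n * h u = - (real n * (Im (Lam n (pt n (Complex a u))) - h u))"
        by (simp add: algebra_simps)
      then show ?thesis by (simp only: abs_minus_cancel abs_mult abs_of_nat)
    qed
    also have "\<dots> \<le> real n * (C1 / real n)" using appr[OF that] by (intro mult_left_mono) auto
    finally show ?thesis using n0 by simp
  qed
  have inc: "- C1 * (q - p) \<le> V n q - V n p" if "n \<ge> N" "\<epsilon> \<le> p" "p \<le> q" "q \<le> b" for n p q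
  proof (rule increment_bounds(2)[where f' = "?V' n"])
    fix x assume x: "p < x" "x < q"
    show "(V n has_real_derivative ?V' n x) (at x)" using x that e by (intro V_has_derivative) auto
    have "real n * h x \<le> 0" using h_neg[of x] x that e by (intro mult_nonneg_nonpos) auto
    then show "- C1 \<le> ?V' n x" using V'bd[of n x] x that by linarith
  qed (use that e Vc in auto)
  have gap: "real n * g - C1 * b \<le> V n b - V n \<epsilon>" if n: "n \<ge> N" for n
  proof -
    have "(real n * c - C1) * (2*b/3 - b/3) \<le> V n (2*b/3) - V n (b/3)"
    proof (rule increment_bounds(2)[where f' = "?V' n"])
      fix x assume x: "b/3 < x" "x < 2*b/3"
      show "(V n has_real_derivative ?V' n x) (at x)" using x e by (intro V_has_derivative) auto
      have "real n * h x \<le> real n * (- c)" using u0(2)[of x] x by (intro mult_left_mono) (auto simp: c_def)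
      then show "real n * c - C1 \<le> ?V' n x" using V'bd[of n x] x n e by (auto simp: abs_le_iff)
    qed (use b_pos Vc in auto)
    moreover have "(real n * c - C1) * (2*b/3 - b/3) = real n * g - C1 * b / 3" by (simp add: g_def field_simps)
    moreover have "- C1 * (b - 2*b/3) \<le> V n b - V n (2*b/3)" using n e b_pos by (intro inc) auto
    moreover have "- C1 * (b/3 - \<epsilon>) \<le> V n (b/3) - V n \<epsilon>" using n e b_pos by (intro inc) auto
    moreover have "- C1 * (b/3 - \<epsilon>) \<ge> - C1 * b / 3" using C1 e by (simp add: algebra_simps)
    moreover have "- C1 * (b - 2*b/3) = - (C1 * b / 3)" by (simp add: field_simps)
    ultimately show ?thesis by linarith
  qed
  define C where "C = C1 * b + C1 * B + K"
  have bd1: "V n u \<le> V n b + C" if n: "n \<ge> N" and u: "0 < u" "u \<le> \<epsilon>" for n u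
  proof -
    have n0: "real n \<ge> 1" using n N by simp
    have na: "real n * a \<ge> 1" using n N a_pos by (meson mult_right_mono of_nat_le_iff order_trans less_imp_le)
    have "- (real n * K * \<epsilon> + K) * (\<epsilon> - u) \<le> V n \<epsilon> - V n u"
    proof (rule increment_bounds(2)[where f' = "?V' n"])
      fix x assume x: "u < x" "x < \<epsilon>"
      show "(V n has_real_derivative ?V' n x) (at x)" using x u by (intro V_has_derivative) auto
      have "- K * (x + 1 / real n) \<le> - Im (Lam n (pt n (Complex a x)))" using K(2)[OF na, of x] x u by simp
      then have "real n * (- K * (x + 1 / real n)) \<le> real n * (- Im (Lam n (pt n (Complex a x))))" by (intro mult_left_mono) auto
      moreover have "real n * (- K * (x + 1 / real n)) = - (real n * K * x + K)" using n0 by (simp add: field_simps)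
      moreover have "real n * K * x \<le> real n * K * \<epsilon>" using x K by (intro mult_left_mono) auto
      ultimately show "- (real n * K * \<epsilon> + K) \<le> ?V' n x" by simp
    qed (use u Vc in auto)
    moreover have "(real n * K * \<epsilon> + K) * (\<epsilon> - u) \<le> real n * g + K"
    proof -
      have "(real n * K * \<epsilon> + K) * (\<epsilon> - u) \<le> (real n * K * \<epsilon> + K) * 1" using u e K by (intro mult_left_mono) auto
      also have "real n * K * \<epsilon> \<le> real n * K * (g / K)" using e K by (intro mult_left_mono) auto
      finally show ?thesis using K by simp
    qed
    ultimately have "V n u \<le> V n \<epsilon> + real n * g + K" by linarith
    moreover have "C1 * B \<ge> 0" using C1 B by simp
    ultimately show ?thesis using gap[OF n] unfolding C_def by linarith
  qed
  have bd2: "V n u \<le> V n b + C" if n: "n \<ge> N" and u: "\<epsilon> \<le> u" "u \<le> b" for n u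
  proof -
    have "- C1 * (b - u) \<le> V n b - V n u" using n u by (intro inc) auto
    moreover have "C1 * (b - u) \<le> C1 * b" using C1 u e by (intro mult_left_mono) auto
    moreover have "C1 * B \<ge> 0" using C1 B by simp
    ultimately show ?thesis using K by (simp add: C_def)
  qed
  have dec: "V n u - V n b \<le> C1 * (u - b)" if n: "n \<ge> N" and u: "b \<le> u" for n u
  proof (rule increment_bounds(1)[where f' = "?V' n"])
    fix x assume x: "b < x" "x < u"
    show "(V n has_real_derivative ?V' n x) (at x)" using x b_pos by (intro V_has_derivative) auto
    have "real n * h x \<ge> 0" using h_pos[of x] x b_pos by (intro mult_nonneg_nonneg) auto
    then show "?V' n x \<le> C1" using V'bd[of n x] x n e b_pos by (auto simp: abs_le_iff)
  qed (use u b_pos Vc in auto)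
  have bd3: "V n u \<le> V n b + C" if n: "n \<ge> N" and u: "b \<le> u" "u \<le> B" for n u
  proof -
    have "C1 * (u - b) \<le> C1 * B" using C1 u b_pos by (intro mult_left_mono) auto
    moreover have "C1 * b \<ge> 0" using C1 b_pos by simp
    ultimately show ?thesis using dec[OF n u(1)] K by (simp add: C_def)
  qed
  have bd4: "V n u - V n B \<le> -1 * (u - B)" if n: "n \<ge> N" and u: "B \<le> u" for n u
  proof (rule increment_bounds(1)[where f' = "?V' n"])
    fix x assume x: "B < x" "x < u"
    show "(V n has_real_derivative ?V' n x) (at x)" using x B by (intro V_has_derivative) auto
    have "h x \<ge> pi / 4" using h_large[of x] x B by (auto simp: B_def)
    then have "real n * h x \<ge> real n * (pi / 4)" by (intro mult_left_mono) auto
    moreover have "real n * (pi / 4) \<ge> real N * (pi / 4)" using n by (intro mult_right_mono) auto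
    ultimately have "real n * h x \<ge> C1 + 1" using N by linarith
    then show "?V' n x \<le> -1" using V'bd[of n x] x n e B by (auto simp: abs_le_iff)
  qed (use u B Vc in auto)
  show thesis
  proof (rule that[of B N C])
    fix n u assume n: "n \<ge> N" and u: "(u::real) > 0"
    have 1: "V n u \<le> V n b + C"
    proof (cases "u \<le> B")
      case True
      then show ?thesis using bd1[OF n u] bd2[OF n] bd3[OF n] by (cases "u \<le> \<epsilon>"; cases "u \<le> b") auto
    next
      case False
      then show ?thesis using bd4[OF n, of u] bd3[OF n B(1)] by auto
    qed
    show "V n u \<le> V n b + C - (u - B)"
    proof (cases "u \<le> B")
      case True
      then show ?thesis using 1 by simp
    next
      case False
      then show ?thesis using bd4[OF n, of u] bd3[OF n B(1)] by auto
    qed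
  qed (use B in auto)
qed

subsection \<open>The arc of saddle points\<close>

text \<open>The logarithm of n^(M-1) x0; ln x and ln y differ from it by O(1/n).\<close>

definition lnXn :: "nat \<Rightarrow> real" where "lnXn n = (real M - 1) * ln (real n) + lnX \<theta>0"

text \<open>Up to the summand lnXn / 2 this is the logarithm of |Phi(t) / X^t| at t = pt n z, where
  ln X = lnXn. The s-factor of the integrand has the size of exp A and the t-factor that of exp
  (-A), so up to O(1) the saddle point has to maximize \<open>A\<close> on the line and to minimize
  it on the arc.\<close>

definition A :: "nat \<Rightarrow> complex \<Rightarrow> real" where
  "A n z = ln (cmod (Phi n (pt n z))) - real n * Re z * lnXn n"

lemma A_cnj: "A n (cnj z) = A n z"
  by (simp add: A_def Phi_pt_cnj)

lemma A_has_derivative: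
  assumes c: "(c has_vector_derivative c') (at t within S)"
    and "Re (c t) \<ge> 0" "Im (c t) \<noteq> 0 \<or> Re (c t) > 1 \<or> c t = 0"
  shows "((\<lambda>t. A n (c t)) has_real_derivative real n * Re ((Lam n (pt n (c t)) - of_real (lnXn n)) * c')) (at t within S)"
proof -
  have r: "((\<lambda>t. Re (c t)) has_real_derivative Re c') (at t within S)"
    unfolding has_real_derivative_iff_has_vector_derivative
    by (rule bounded_linear.has_vector_derivative[OF bounded_linear_Re c])
  have "((\<lambda>t. ln (cmod (Phi n (pt n (c t)))) - real n * Re (c t) * lnXn n) has_real_derivative
      real n * Re (Lam n (pt n (c t)) * c') - real n * Re c' * lnXn n) (at t within S)"
    by (intro DERIV_diff DERIV_cmult DERIV_cmult_right r ln_Phi_has_derivative assms)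
  then show ?thesis unfolding A_def[abs_def] by (simp add: algebra_simps)
qed

lemma Z_0: "Im (Z 0) = 0" "Re (Z 0) > 1"
proof -
  show "Im (Z 0) = 0" by (simp add: Im_Z)
  have "R 0 > 1" using M2 by (simp add: R_def of_nat_diff divide_simps)
  then show "Re (Z 0) > 1" by (simp add: Re_Z)
qed

lemma Z_off_cut:
  assumes "\<bar>\<theta>\<bar> < \<tau>"
  shows "Im (Z \<theta>) \<noteq> 0 \<or> Re (Z \<theta>) > 1"
proof -
  consider "\<theta> = 0" | "\<theta> > 0" | "- \<theta> > 0" by linarith
  then show ?thesis
  proof cases
    case 2
    then show ?thesis using Im_Z_pos[of \<theta>] assms by simp
  next
    case 3
    then show ?thesis using Im_Z_pos[of "- \<theta>"] assms by (simp add: Z_minus)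
  qed (use Z_0 in simp)
qed

lemma continuous_on_Z: "continuous_on {-\<tau><..<\<tau>} Z"
  by (intro continuous_at_imp_continuous_on ballI has_vector_derivative_continuous[OF Z_has_vector_derivative]) auto

lemma arc_distance:
  assumes "\<theta>1 < \<tau>"
  obtains \<epsilon> where "\<epsilon> > 0" "\<And>\<theta> x. \<bar>\<theta>\<bar> \<le> \<theta>1 \<Longrightarrow> 0 \<le> x \<Longrightarrow> x \<le> 1 \<Longrightarrow> \<epsilon> \<le> cmod (Z \<theta> - of_real x)"
proof -
  let ?S = "Z ` {-\<theta>1..\<theta>1}" and ?T = "complex_of_real ` {0..1}"
  have "continuous_on {-\<theta>1..\<theta>1} Z"
    by (rule continuous_on_subset[OF continuous_on_Z]) (use assms in auto)
  then have "compact ?S" using compact_continuous_image compact_Icc by blast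
  moreover have "compact ?T" by (intro compact_continuous_image continuous_intros compact_Icc)
  moreover have "?S \<inter> ?T = {}"
  proof -
    have "Z \<theta> \<noteq> of_real x" if "\<bar>\<theta>\<bar> < \<tau>" "x \<le> 1" for \<theta> x
      using Z_off_cut[OF that(1)] that(2) by auto
    moreover have "\<bar>\<theta>\<bar> < \<tau>" if "\<theta> \<in> {-\<theta>1..\<theta>1}" for \<theta> using that assms by auto
    ultimately show ?thesis by fastforce
  qed
  ultimately obtain \<epsilon> where e: "\<epsilon> > 0" "\<forall>x\<in>?S. \<forall>y\<in>?T. \<epsilon> \<le> dist x y"
    using separate_compact_closed compact_imp_closed by metis
  show thesis
  proof (rule that[OF e(1)])
    fix \<theta> x :: real assume "\<bar>\<theta>\<bar> \<le> \<theta>1" "0 \<le> x" "x \<le> 1"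
    then have "\<theta> \<in> {-\<theta>1..\<theta>1}" "x \<in> {0..1}" by (auto simp: abs_le_iff)
    then have "\<epsilon> \<le> dist (Z \<theta>) (of_real x)" using e(2) by blast
    then show "\<epsilon> \<le> cmod (Z \<theta> - of_real x)" by (simp add: dist_norm)
  qed
qed

lemma Z'_bounded:
  assumes "\<theta>1 < \<tau>"
  obtains D where "D > 0" "\<And>\<theta>. \<bar>\<theta>\<bar> \<le> \<theta>1 \<Longrightarrow> cmod (Z' \<theta>) \<le> D"
proof -
  have "continuous_on {-\<theta>1..\<theta>1} Z'"
    by (rule continuous_on_subset[OF continuous_on_Z']) (use assms in auto)
  then have "bounded (Z' ` {-\<theta>1..\<theta>1})"
    using compact_continuous_image compact_Icc compact_imp_bounded by blast
  then obtain D where "D > 0" "\<forall>y \<in> Z' ` {-\<theta>1..\<theta>1}. norm y \<le> D" unfolding bounded_pos by blast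
  then show thesis by (intro that[of D]) (auto simp: abs_le_iff)
qed

text \<open>On the arc \<open>Lam\<close> - lnXn is, up to O(1/n), the real number lnX \<theta> -
  lnX \<theta>0 by \<open>Ln_Z\<close>, so the derivative of \<open>A\<close> is n (lnX \<theta> -
  lnX \<theta>0) Re Z' + O(1). As lnX and Re Z both decrease, \<open>A\<close> falls before
  \<theta>0 and rises after it.\<close>

lemma arc_bound:
  assumes t1: "\<theta>0 < \<theta>1" "\<theta>1 < \<tau>"
  obtains C N where "C > 0" "N \<ge> 1"
    "\<And>n \<theta>. n \<ge> N \<Longrightarrow> 0 \<le> \<theta> \<Longrightarrow> \<theta> \<le> \<theta>1 \<Longrightarrow> A n (Z \<theta>0) - C \<le> A n (Z \<theta>)"
    "\<And>\<theta>. 0 \<le> \<theta> \<Longrightarrow> \<theta> \<le> \<theta>1 \<Longrightarrow> \<theta> \<noteq> \<theta>0 \<Longrightarrow> \<exists>c>0. \<forall>n\<ge>N. A n (Z \<theta>0) - C + c * real n \<le> A n (Z \<theta>)"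
    "\<And>n \<theta>. n \<ge> N \<Longrightarrow> \<theta>0 \<le> \<theta> \<Longrightarrow> \<theta> \<le> \<theta>1 \<Longrightarrow> A n (Z \<theta>) \<le> A n (Z \<theta>1) + C"
proof -
  obtain \<epsilon> where e: "\<epsilon> > 0" "\<And>\<theta> x. \<bar>\<theta>\<bar> \<le> \<theta>1 \<Longrightarrow> 0 \<le> x \<Longrightarrow> x \<le> 1 \<Longrightarrow> \<epsilon> \<le> cmod (Z \<theta> - of_real x)"
    using arc_distance[OF t1(2)] by blast
  obtain D where D: "D > 0" "\<And>\<theta>. \<bar>\<theta>\<bar> \<le> \<theta>1 \<Longrightarrow> cmod (Z' \<theta>) \<le> D"
    using Z'_bounded[OF t1(2)] by blast
  obtain C1 where C1: "C1 > 0"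
    "\<And>n z. real n * \<epsilon> \<ge> 1 \<Longrightarrow> Re z > 0 \<Longrightarrow> (\<And>x. 0 \<le> x \<Longrightarrow> x \<le> 1 \<Longrightarrow> \<epsilon> \<le> cmod (z - of_real x)) \<Longrightarrow>
      cmod (Lam n (of_nat n * z - 1/2) -
        (of_real ((real M - 1) * ln (real n)) + (of_real (real M + 1) * Ln z - Ln (z\<^sup>2 - 1)))) \<le> C1 / real n"
    using Lam_approx[OF e(1)] by blast
  obtain N :: nat where N: "N \<ge> 1" "real N * \<epsilon> \<ge> 1"
  proof -
    obtain N :: nat where "real N \<ge> max 1 (1 / \<epsilon>)" using real_arch_simple by blast
    then show thesis using e by (intro that[of N]) (auto simp: field_simps)
  qed
  let ?f = "\<lambda>n \<theta>. A n (Z \<theta>)"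
  let ?f' = "\<lambda>n \<theta>. real n * Re ((Lam n (pt n (Z \<theta>)) - of_real (lnXn n)) * Z' \<theta>)"
  have f': "(?f n has_real_derivative ?f' n \<theta>) (at \<theta>)" if "\<bar>\<theta>\<bar> < \<tau>" for n \<theta>
    using A_has_derivative[OF Z_has_vector_derivative[OF that], of n] Re_Z_pos[OF that] Z_off_cut[OF that] by auto
  have fc: "continuous_on {p..q} (?f n)" if "0 \<le> p" "q \<le> \<theta>1" for n p q
    using that t1 by (intro continuous_at_imp_continuous_on ballI DERIV_isCont[OF f']) auto
  have est: "\<bar>?f' n \<theta> - real n * (lnX \<theta> - lnX \<theta>0) * Re (Z' \<theta>)\<bar> \<le> C1 * D"
    if n: "n \<ge> N" and th: "0 \<le> \<theta>" "\<theta> \<le> \<theta>1" for n \<theta>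
  proof -
    have n0: "real n > 0" using n N by simp
    have tt: "\<bar>\<theta>\<bar> < \<tau>" "\<bar>\<theta>\<bar> \<le> \<theta>1" using th t1 by auto
    have "real n * \<epsilon> \<ge> real N * \<epsilon>" using n e by simp
    then have "cmod (Lam n (pt n (Z \<theta>)) -
        (of_real ((real M - 1) * ln (real n)) + (of_real (real M + 1) * Ln (Z \<theta>) - Ln ((Z \<theta>)\<^sup>2 - 1)))) \<le> C1 / real n"
      unfolding pt_def using N Re_Z_pos[OF tt(1)] e(2)[OF tt(2)] by (intro C1(2)) auto
    then have c: "cmod (Lam n (pt n (Z \<theta>)) - of_real (lnXn n + (lnX \<theta> - lnX \<theta>0))) \<le> C1 / real n"
      unfolding Ln_Z[OF tt(1)] lnXn_def by simp
    let ?Y = "(Lam n (pt n (Z \<theta>)) - of_real (lnXn n + (lnX \<theta> - lnX \<theta>0))) * Z' \<theta>"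
    have "?f' n \<theta> - real n * (lnX \<theta> - lnX \<theta>0) * Re (Z' \<theta>) = real n * Re ?Y"
      by (simp add: algebra_simps)
    also have "\<bar>\<dots>\<bar> \<le> real n * cmod ?Y" unfolding abs_mult using abs_Re_le_cmod[of ?Y] by (simp add: mult_left_mono)
    also have "cmod ?Y \<le> C1 / real n * D" unfolding norm_mult by (intro mult_mono c D(2) tt) (use C1 n0 in auto)
    finally show ?thesis using n0 by (simp add: mult_left_mono)
  qed
  define C where "C = 2 * (C1 * D) * \<tau>"
  have CD: "C1 * D > 0" using C1 D by simp
  have C: "C > 0" using CD tau by (simp add: C_def)
  have small: "C1 * D * (q - p) \<le> C / 2" if "0 \<le> p" "q \<le> \<theta>1" for p q
  proof -
    have "C1 * D * (q - p) \<le> C1 * D * \<tau>" using CD that t1 by (intro mult_left_mono) auto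
    then show ?thesis by (simp add: C_def)
  qed
  \<comment> \<open>To the right of p the number lnX \<theta>0 - lnX \<theta> exceeds k, hence A + n
    k Re Z increases on [p, q] up to O(1). Measuring the growth of \<open>A\<close> by the fall of
    Re Z makes a lower bound for |Z'| unnecessary.\<close>
  have right: "real n * k * (Re (Z p) - Re (Z q)) - C / 2 \<le> ?f n q - ?f n p"
    if n: "n \<ge> N" and pq: "\<theta>0 \<le> p" "p \<le> q" "q \<le> \<theta>1" and k: "k = lnX \<theta>0 - lnX p" for n p q k
  proof -
    have "- (C1 * D) * (q - p) \<le> (?f n q + real n * k * Re (Z q)) - (?f n p + real n * k * Re (Z p))"
    proof (rule increment_bounds(2)[where f' = "\<lambda>\<theta>. ?f' n \<theta> + real n * k * Re (Z' \<theta>)"])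
      fix x assume x: "p < x" "x < q"
      have xx: "\<bar>x\<bar> < \<tau>" "0 < x" "x < \<tau>" using x pq t1 theta0 by auto
      have "((\<lambda>\<theta>. Re (Z \<theta>)) has_real_derivative Re (Z' x)) (at x)"
        unfolding has_real_derivative_iff_has_vector_derivative
        by (rule bounded_linear.has_vector_derivative[OF bounded_linear_Re Z_has_vector_derivative[OF xx(1)]])
      then show "((\<lambda>\<theta>. ?f n \<theta> + real n * k * Re (Z \<theta>)) has_real_derivative ?f' n x + real n * k * Re (Z' x)) (at x)"
        by (intro DERIV_add DERIV_cmult f' xx)
      have "lnX x < lnX p" using x pq theta0 t1 by (intro lnX_strict_antimono) auto
      then have "(lnX x - lnX \<theta>0) + k \<le> 0" using k by simp
      moreover have "Re (Z' x) \<le> 0" using xx by (intro Re_Z'_nonpos) auto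
      ultimately have "0 \<le> real n * (((lnX x - lnX \<theta>0) + k) * Re (Z' x))" by (simp add: mult_nonpos_nonpos)
      then have "0 \<le> real n * (lnX x - lnX \<theta>0) * Re (Z' x) + real n * k * Re (Z' x)" by (simp add: algebra_simps)
      moreover have "\<bar>?f' n x - real n * (lnX x - lnX \<theta>0) * Re (Z' x)\<bar> \<le> C1 * D"
        by (rule est) (use n x pq theta0 in auto)
      ultimately show "- (C1 * D) \<le> ?f' n x + real n * k * Re (Z' x)" by linarith
    next
      have "continuous_on {p..q} Z" by (rule continuous_on_subset[OF continuous_on_Z]) (use pq t1 theta0 in auto)
      then show "continuous_on {p..q} (\<lambda>\<theta>. ?f n \<theta> + real n * k * Re (Z \<theta>))"
        by (intro continuous_intros fc) (use pq theta0 in auto)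
    qed (use pq in auto)
    moreover have "C1 * D * (q - p) \<le> C / 2" by (rule small) (use pq theta0 in auto)
    ultimately show ?thesis by (simp add: algebra_simps)
  qed
  have left: "real n * k * (Re (Z p) - Re (Z q)) - C / 2 \<le> ?f n p - ?f n q"
    if n: "n \<ge> N" and pq: "0 \<le> p" "p \<le> q" "q \<le> \<theta>0" "0 < q" and k: "k = lnX q - lnX \<theta>0" for n p q k
  proof -
    have "(?f n q - real n * k * Re (Z q)) - (?f n p - real n * k * Re (Z p)) \<le> (C1 * D) * (q - p)"
    proof (rule increment_bounds(1)[where f' = "\<lambda>\<theta>. ?f' n \<theta> - real n * k * Re (Z' \<theta>)"])
      fix x assume x: "p < x" "x < q"
      have xx: "\<bar>x\<bar> < \<tau>" "0 < x" "x < \<tau>" using x pq t1 theta0 by auto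
      have "((\<lambda>\<theta>. Re (Z \<theta>)) has_real_derivative Re (Z' x)) (at x)"
        unfolding has_real_derivative_iff_has_vector_derivative
        by (rule bounded_linear.has_vector_derivative[OF bounded_linear_Re Z_has_vector_derivative[OF xx(1)]])
      then show "((\<lambda>\<theta>. ?f n \<theta> - real n * k * Re (Z \<theta>)) has_real_derivative ?f' n x - real n * k * Re (Z' x)) (at x)"
        by (intro DERIV_diff DERIV_cmult f' xx)
      have "lnX q < lnX x" using x pq theta0 t1 by (intro lnX_strict_antimono) auto
      then have "0 \<le> (lnX x - lnX \<theta>0) - k" using k by simp
      moreover have "Re (Z' x) \<le> 0" using xx by (intro Re_Z'_nonpos) auto
      ultimately have "real n * (((lnX x - lnX \<theta>0) - k) * Re (Z' x)) \<le> 0" by (simp add: mult_nonneg_nonpos)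
      then have "real n * (lnX x - lnX \<theta>0) * Re (Z' x) - real n * k * Re (Z' x) \<le> 0" by (simp add: algebra_simps)
      moreover have "\<bar>?f' n x - real n * (lnX x - lnX \<theta>0) * Re (Z' x)\<bar> \<le> C1 * D"
        by (rule est) (use n x pq t1 in auto)
      ultimately show "?f' n x - real n * k * Re (Z' x) \<le> C1 * D" by linarith
    next
      have "continuous_on {p..q} Z" by (rule continuous_on_subset[OF continuous_on_Z]) (use pq t1 theta0 in auto)
      then show "continuous_on {p..q} (\<lambda>\<theta>. ?f n \<theta> - real n * k * Re (Z \<theta>))"
        by (intro continuous_intros fc) (use pq t1 in auto)
    qed (use pq in auto)
    moreover have "C1 * D * (q - p) \<le> C / 2" by (rule small) (use pq t1 in auto)
    ultimately show ?thesis by (simp add: algebra_simps)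
  qed
  show thesis
  proof (rule that[OF C N(1)])
    fix n \<theta> assume n: "n \<ge> N" and th: "0 \<le> \<theta>" "\<theta> \<le> \<theta>1"
    show "?f n \<theta>0 - C \<le> ?f n \<theta>"
      using right[OF n, of \<theta>0 \<theta> 0] left[OF n, of \<theta> \<theta>0 0] th t1 theta0 C by (cases "\<theta> \<le> \<theta>0") auto
  next
    fix n \<theta> assume n: "n \<ge> N" and th: "\<theta>0 \<le> \<theta>" "\<theta> \<le> \<theta>1"
    have "lnX \<theta> \<le> lnX \<theta>0" using lnX_strict_antimono[of \<theta>0 \<theta>] th theta0 t1 by (cases "\<theta> = \<theta>0") auto
    moreover have "Re (Z \<theta>1) \<le> Re (Z \<theta>)" using Re_Z_strict_antimono[of \<theta> \<theta>1] th theta0 t1 by (cases "\<theta> = \<theta>1") auto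
    ultimately have "0 \<le> real n * (lnX \<theta>0 - lnX \<theta>) * (Re (Z \<theta>) - Re (Z \<theta>1))" by simp
    then show "?f n \<theta> \<le> ?f n \<theta>1 + C"
      using right[OF n th(1) th(2) order_refl refl] C by linarith
  next
    fix \<theta> assume th: "0 \<le> \<theta>" "\<theta> \<le> \<theta>1" "\<theta> \<noteq> \<theta>0"
    \<comment> \<open>The factor lnX \<theta> - lnX \<theta>0 vanishes at \<theta>0. The gap of
      order n comes from the half of the interval away from \<theta>0, where the absolute value of
      this factor is at least its value k at the midpoint m. On the other half k = 0 is used; each
      half costs C / 2.\<close>
    define m where "m = (\<theta> + \<theta>0) / 2"
    show "\<exists>c>0. \<forall>n\<ge>N. ?f n \<theta>0 - C + c * real n \<le> ?f n \<theta>"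
    proof (cases "\<theta> < \<theta>0")
      case True
      then have m: "\<theta> < m" "m < \<theta>0" by (auto simp: m_def)
      define k where "k = lnX m - lnX \<theta>0"
      have "k > 0" using lnX_strict_antimono[of m \<theta>0] m th theta0 by (simp add: k_def)
      moreover have "Re (Z \<theta>) - Re (Z m) > 0" using Re_Z_strict_antimono[of \<theta> m] m th theta0 by simp
      ultimately have c: "k * (Re (Z \<theta>) - Re (Z m)) > 0" by simp
      moreover have "?f n \<theta>0 - C + k * (Re (Z \<theta>) - Re (Z m)) * real n \<le> ?f n \<theta>" if n: "n \<ge> N" for n
      proof -
        have "real n * k * (Re (Z \<theta>) - Re (Z m)) - C / 2 \<le> ?f n \<theta> - ?f n m"
          by (rule left[OF n]) (use th m k_def in auto)
        moreover have "real n * 0 * (Re (Z m) - Re (Z \<theta>0)) - C / 2 \<le> ?f n m - ?f n \<theta>0"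
          by (rule left[OF n]) (use th m theta0 in auto)
        ultimately show ?thesis by (simp add: mult_ac)
      qed
      ultimately show ?thesis by blast
    next
      case False
      then have m: "\<theta>0 < m" "m < \<theta>" using th by (auto simp: m_def)
      define k where "k = lnX \<theta>0 - lnX m"
      have "k > 0" using lnX_strict_antimono[of \<theta>0 m] m th theta0 t1 by (simp add: k_def)
      moreover have "Re (Z m) - Re (Z \<theta>) > 0" using Re_Z_strict_antimono[of m \<theta>] m th theta0 t1 by simp
      ultimately have c: "k * (Re (Z m) - Re (Z \<theta>)) > 0" by simp
      moreover have "?f n \<theta>0 - C + k * (Re (Z m) - Re (Z \<theta>)) * real n \<le> ?f n \<theta>" if n: "n \<ge> N" for n
      proof -
        have "real n * k * (Re (Z m) - Re (Z \<theta>)) - C / 2 \<le> ?f n \<theta> - ?f n m"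
          by (rule right[OF n]) (use th m k_def in auto)
        moreover have "real n * 0 * (Re (Z \<theta>0) - Re (Z m)) - C / 2 \<le> ?f n m - ?f n \<theta>0"
          by (rule right[OF n]) (use th m t1 in auto)
        ultimately show ?thesis by (simp add: mult_ac)
      qed
      ultimately show ?thesis by blast
    qed
  qed
qed

subsection \<open>The rays closing the contour at the origin\<close>

text \<open>Near the origin the logarithm of |z + 1| / n is not bounded uniformly in n. The
  inequality ln x \<le> 2 sqrt x trades it for sqrt (n / \<rho>), which is integrable along a ray
  and is also the size of the pole sum; L takes care of large |z + 1|.\<close>

lemma Digamma_log_bound:
  assumes "Re z \<ge> 0" "0 < \<rho>" "\<rho> \<le> real n" "\<rho> \<le> cmod (z + 1)" "cmod (z + 1) \<le> real n * L" "L \<ge> 1"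
  shows "cmod (Digamma (z + 1/2) - of_real (ln (real n))) \<le> (10 + ln L) * sqrt (real n / \<rho>)"
proof -
  define q where "q = sqrt (real n / \<rho>)"
  have n0: "real n > 0" using assms by linarith
  have q1: "q \<ge> 1" using assms by (simp add: q_def)
  have w: "cmod (z + 1) > 0" "z + 1 \<noteq> 0" using assms by auto
  have "cmod (Ln (z + 1) - of_real (ln (real n))) \<le> \<bar>ln (cmod (z + 1)) - ln (real n)\<bar> + pi"
  proof -
    have "cmod (Ln (z + 1) - of_real (ln (real n))) \<le> \<bar>Re (Ln (z + 1) - of_real (ln (real n)))\<bar> + \<bar>Im (Ln (z + 1) - of_real (ln (real n)))\<bar>"
      by (rule cmod_le)
    also have "\<dots> \<le> \<bar>ln (cmod (z + 1)) - ln (real n)\<bar> + pi"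
      using w mpi_less_Im_Ln[OF w(2)] Im_Ln_le_pi[OF w(2)] by (simp add: abs_le_iff)
    finally show ?thesis .
  qed
  moreover have "\<bar>ln (cmod (z + 1)) - ln (real n)\<bar> \<le> ln L + 2 * q"
  proof -
    have "ln (cmod (z + 1)) \<le> ln (real n * L)" using assms w by simp
    then have 1: "ln (cmod (z + 1)) - ln (real n) \<le> ln L" using n0 assms by (simp add: ln_mult)
    have "ln (real n / \<rho>) \<le> 2 * q" unfolding q_def by (rule ln_le_2_sqrt) (use n0 assms in simp)
    moreover have "ln \<rho> \<le> ln (cmod (z + 1))" using assms w by simp
    ultimately have 2: "ln (real n) - ln (cmod (z + 1)) \<le> 2 * q" using n0 assms by (simp add: ln_div)
    have "ln L \<ge> 0" using assms by simp
    then show ?thesis using 1 2 q1 by (simp add: abs_le_iff)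
  qed
  moreover have "cmod (Digamma (z + 1/2) - Ln (z + 1)) \<le> 4" by (rule Digamma_Ln_plus1_bound[OF assms(1)])
  moreover have "cmod (Digamma (z + 1/2) - of_real (ln (real n))) \<le> cmod (Digamma (z + 1/2) - Ln (z + 1)) + cmod (Ln (z + 1) - of_real (ln (real n)))"
    using norm_triangle_ineq[of "Digamma (z + 1/2) - Ln (z + 1)" "Ln (z + 1) - of_real (ln (real n))"] by simp
  moreover have "4 + pi + ln L + 2 * q \<le> (10 + ln L) * q"
  proof -
    have "(8 + ln L) * 1 \<le> (8 + ln L) * q" using q1 assms by (intro mult_left_mono) (auto intro: add_nonneg_nonneg)
    then show ?thesis using pi_less_4 by (simp add: distrib_right)
  qed
  ultimately show ?thesis unfolding q_def[symmetric] by linarith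
qed

text \<open>On a ray of angle at least \<theta>0 the law of cosines gives |w - c|^2 \<ge> 2 \<rho> c
  (1 - cos \<theta>0) for c = i + 1/2, so the pole sum is O(sqrt (n / \<rho>)). The constant K does
  not depend on \<theta>, which allows \<theta>1 to be chosen after K in
  \<open>choose_contour\<close>.\<close>

lemma Lam_ray:
  obtains K where "K > 0"
    "\<And>n \<theta> \<rho>. \<theta>0 \<le> \<theta> \<Longrightarrow> \<theta> < \<tau> \<Longrightarrow> 0 < \<rho> \<Longrightarrow> \<rho> \<le> real n \<Longrightarrow>
      cmod (Lam n (of_real \<rho> * cis \<theta> - 1/2) - of_real (lnXn n)) \<le> K * sqrt (real n / \<rho>)"
proof
  define k where "k = sqrt (2 * (1 - cos \<theta>0))"
  have c0: "cos \<theta>0 < 1" using cos_monotone_0_pi[of 0 \<theta>0] theta0 tau pi_gt_zero by auto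
  then have k: "k > 0" by (simp add: k_def)
  define K where "K = 3 / k + (\<Sum>j=1..M. 10 + ln (2 + real (\<nu> j))) + (10 + ln (2 + real \<kappa>)) + \<bar>lnX \<theta>0\<bar>"
  have lnn: "0 \<le> ln (2 + real i)" for i :: nat by simp
  show "K > 0" unfolding K_def using k lnn
    by (intro add_pos_nonneg add_nonneg_nonneg sum_nonneg) auto
  fix n :: nat and \<theta> \<rho> :: real
  assume th: "\<theta>0 \<le> \<theta>" "\<theta> < \<tau>" and r: "0 < \<rho>" "\<rho> \<le> real n"
  define q where "q = sqrt (real n / \<rho>)"
  have n1: "real n \<ge> 1" using r by (cases n) auto
  have q1: "q \<ge> 1" using r by (simp add: q_def)
  define w where "w = of_real \<rho> * cis \<theta>"
  have ct: "cos \<theta> \<ge> 0" using th theta0 tau by (intro cos_ge_zero) auto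
  have wR: "Re w \<ge> 0" using ct r by (simp add: w_def)
  have wn: "cmod w = \<rho>" using r by (simp add: w_def norm_mult)
  have S: "cmod (\<Sum>i<n. 1 / (w - 1/2 - of_nat i)) \<le> 3 / k * q"
  proof -
    have "cmod (1 / (w - 1/2 - of_nat i)) \<le> 1 / (k * sqrt \<rho>) * (1 / sqrt (real i + 1/2))" for i
    proof -
      let ?c = "real i + 1/2"
      have "(cmod (w - of_real ?c))\<^sup>2 = \<rho>\<^sup>2 + ?c\<^sup>2 - 2 * \<rho> * ?c * cos \<theta>"
      proof -
        have "(cmod (w - of_real ?c))\<^sup>2 = (\<rho> * cos \<theta> - ?c)\<^sup>2 + (\<rho> * sin \<theta>)\<^sup>2"
          unfolding cmod_power2 w_def by simp
        also have "(\<rho> * sin \<theta>)\<^sup>2 = \<rho>\<^sup>2 - (\<rho> * cos \<theta>)\<^sup>2"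
          by (simp add: power_mult_distrib sin_squared_eq right_diff_distrib)
        finally show ?thesis by (simp add: power2_diff algebra_simps)
      qed
      also have "\<dots> \<ge> 2 * \<rho> * ?c * (1 - cos \<theta>)"
        using zero_le_power2[of "\<rho> - ?c"] by (simp add: power2_eq_square algebra_simps)
      finally have 1: "2 * \<rho> * ?c * (1 - cos \<theta>) \<le> (cmod (w - of_real ?c))\<^sup>2" .
      have "cos \<theta> \<le> cos \<theta>0" using cos_monotone_0_pi_le[of \<theta>0 \<theta>] th theta0 tau pi_gt_zero by auto
      then have "2 * \<rho> * ?c * (1 - cos \<theta>0) \<le> 2 * \<rho> * ?c * (1 - cos \<theta>)" using r by (intro mult_left_mono) auto
      then have "2 * \<rho> * ?c * (1 - cos \<theta>0) \<le> (cmod (w - of_real ?c))\<^sup>2" using 1 by linarith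
      moreover have "2 * \<rho> * ?c * (1 - cos \<theta>0) = (k * sqrt \<rho> * sqrt ?c)\<^sup>2"
        using r c0 by (simp add: k_def power_mult_distrib)
      ultimately have "k * sqrt \<rho> * sqrt ?c \<le> cmod (w - of_real ?c)"
        by (metis norm_ge_zero power2_le_imp_le)
      moreover have "w - 1/2 - of_nat i = w - of_real ?c" by simp
      moreover have "0 < k * sqrt \<rho> * sqrt ?c" using k r by simp
      ultimately have "cmod (1 / (w - 1/2 - of_nat i)) \<le> 1 / (k * sqrt \<rho> * sqrt ?c)"
        by (simp only: norm_divide norm_one) (intro frac_le, auto)
      then show ?thesis by simp
    qed
    then have "cmod (\<Sum>i<n. 1 / (w - 1/2 - of_nat i)) \<le> (\<Sum>i<n. 1 / (k * sqrt \<rho>) * (1 / sqrt (real i + 1/2)))"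
      by (rule sum_norm_le)
    also have "\<dots> \<le> 1 / (k * sqrt \<rho>) * (3 * sqrt (real n))"
      unfolding sum_distrib_left[symmetric] using k r by (intro mult_left_mono sum_inverse_sqrt_le) auto
    also have "\<dots> = 3 / k * q" by (simp add: q_def real_sqrt_divide)
    finally show ?thesis .
  qed
  have D: "cmod (Digamma ((w + of_real c) + 1/2) - of_real (ln (real n))) \<le> (10 + ln L) * q"
    if "c \<ge> 0" "L \<ge> 1" "\<rho> + c + 1 \<le> real n * L" for c L
    unfolding q_def
  proof (rule Digamma_log_bound)
    have "cmod w \<le> cmod (w + of_real (c + 1))" by (rule cmod_add_of_real_ge) (use wR that in auto)
    then show "\<rho> \<le> cmod (w + of_real c + 1)" using wn by (simp add: add.assoc)
    have "cmod (w + of_real (c + 1)) \<le> cmod w + cmod (of_real (c + 1))" by (rule norm_triangle_ineq)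
    then have "cmod (w + of_real c + 1) \<le> \<rho> + (c + 1)" using wn that by (simp add: add.assoc)
    then show "cmod (w + of_real c + 1) \<le> real n * L" using that by linarith
  qed (use wR that r in auto)
  have Dj: "cmod (Digamma (w - 1/2 + of_nat m + 1) - of_real (ln (real n))) \<le> (10 + ln (2 + real m)) * q" for m
  proof -
    have "\<rho> + real m + 1 \<le> real n + real m * real n + real n" using r n1
      by (intro add_mono) (auto simp: mult_le_cancel_left1)
    then have "\<rho> + real m + 1 \<le> real n * (2 + real m)" by (simp add: algebra_simps)
    from D[OF _ _ this] have "cmod (Digamma ((w + of_real (real m)) + 1/2) - of_real (ln (real n))) \<le> (10 + ln (2 + real m)) * q" by simp
    moreover have "w - 1/2 + of_nat m + 1 = (w + of_real (real m)) + 1/2" by simp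
    ultimately show ?thesis by (simp only:)
  qed
  have Dk: "cmod (Digamma (w - 1/2 + of_nat n + of_nat \<kappa>) - of_real (ln (real n))) \<le> (10 + ln (2 + real \<kappa>)) * q"
  proof -
    have "real \<kappa> \<le> real n * real \<kappa>" using n1 by (simp add: mult_le_cancel_right1)
    moreover have "real (\<kappa> - 1) = real \<kappa> - 1" using kappa by (simp add: of_nat_diff)
    moreover have "real n * (2 + real \<kappa>) = 2 * real n + real n * real \<kappa>" by (simp add: algebra_simps)
    ultimately have "\<rho> + (real n + real (\<kappa> - 1)) + 1 \<le> real n * (2 + real \<kappa>)" using r by linarith
    from D[OF _ _ this] have "cmod (Digamma ((w + of_real (real n + real (\<kappa> - 1))) + 1/2) - of_real (ln (real n))) \<le> (10 + ln (2 + real \<kappa>)) * q" by simp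
    moreover have "w - 1/2 + of_nat n + of_nat \<kappa> = (w + of_real (real n + real (\<kappa> - 1))) + 1/2"
      using kappa by (simp add: of_nat_diff)
    ultimately show ?thesis by (simp only:)
  qed
  let ?E1 = "\<Sum>i<n. 1 / (w - 1/2 - of_nat i)"
  let ?E2 = "\<Sum>j=1..M. Digamma (w - 1/2 + of_nat (\<nu> j) + 1) - of_real (ln (real n))"
  let ?E3 = "Digamma (w - 1/2 + of_nat n + of_nat \<kappa>) - of_real (ln (real n))"
  have E2: "cmod ?E2 \<le> (\<Sum>j=1..M. 10 + ln (2 + real (\<nu> j))) * q"
    unfolding sum_distrib_right by (intro sum_norm_le Dj)
  have E4: "\<bar>lnX \<theta>0\<bar> \<le> \<bar>lnX \<theta>0\<bar> * q" using q1 by (simp add: mult_le_cancel_left1)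
  have eq: "Lam n (w - 1/2) - of_real (lnXn n) = ?E1 + ?E2 - ?E3 - of_real (lnX \<theta>0)"
    unfolding Lam_def lnXn_def sum_subtractf by (simp add: algebra_simps)
  have le: "cmod (?E1 + ?E2 - ?E3 - of_real (lnX \<theta>0)) \<le> cmod ?E1 + cmod ?E2 + cmod ?E3 + cmod (complex_of_real (lnX \<theta>0))"
    using norm_triangle_ineq4[of "?E1 + ?E2 - ?E3" "of_real (lnX \<theta>0)"] norm_triangle_ineq4[of "?E1 + ?E2" ?E3]
      norm_triangle_ineq[of ?E1 ?E2] by linarith
  have "cmod ?E1 + cmod ?E2 + cmod ?E3 + cmod (complex_of_real (lnX \<theta>0)) \<le> 3 / k * q + (\<Sum>j=1..M. 10 + ln (2 + real (\<nu> j))) * q + (10 + ln (2 + real \<kappa>)) * q + \<bar>lnX \<theta>0\<bar> * q"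
    unfolding norm_of_real by (rule add_mono[OF add_mono[OF add_mono[OF S E2] Dk] E4])
  also have "\<dots> = K * q" by (simp only: K_def distrib_right)
  finally have "cmod (Lam n (w - 1/2) - of_real (lnXn n)) \<le> K * q" using le unfolding eq by (rule order_trans[rotated])
  then show "cmod (Lam n (of_real \<rho> * cis \<theta> - 1/2) - of_real (lnXn n)) \<le> K * sqrt (real n / \<rho>)"
    by (simp only: q_def w_def)
qed

text \<open>The integral of K sqrt (n / \<rho>) along a ray of length n l, where l = |Z \<theta>|,
  is 2 n K sqrt l. Since R tends to 0 at \<tau>, the loss is a small multiple of n for \<theta>
  close to \<tau>.\<close>

lemma ray_bound:
  obtains K where "K > 0"
    "\<And>n \<theta> r. n \<ge> 1 \<Longrightarrow> \<theta>0 \<le> \<theta> \<Longrightarrow> \<theta> < \<tau> \<Longrightarrow> R \<theta> \<le> 1 \<Longrightarrow> 0 \<le> r \<Longrightarrow> r \<le> 1 \<Longrightarrow>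
      A n (Z \<theta>) - real n * (K * sqrt (sqrt (R \<theta>))) \<le> A n (of_real r * Z \<theta>)"
proof -
  obtain K where K: "K > 0"
    "\<And>n \<theta> \<rho>. \<theta>0 \<le> \<theta> \<Longrightarrow> \<theta> < \<tau> \<Longrightarrow> 0 < \<rho> \<Longrightarrow> \<rho> \<le> real n \<Longrightarrow>
      cmod (Lam n (of_real \<rho> * cis \<theta> - 1/2) - of_real (lnXn n)) \<le> K * sqrt (real n / \<rho>)"
    using Lam_ray by blast
  show thesis
  proof (rule that[of "2 * K"])
    fix n :: nat and \<theta> r :: real
    assume n: "n \<ge> 1" and th: "\<theta>0 \<le> \<theta>" "\<theta> < \<tau>" "R \<theta> \<le> 1" and r: "0 \<le> r" "r \<le> 1"
    have tp: "0 < \<theta>" "\<bar>\<theta>\<bar> < \<tau>" using th theta0 by auto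
    define l where "l = sqrt (R \<theta>)"
    have l: "0 < l" "l \<le> 1" using R_pos[OF tp(2)] th by (auto simp: l_def)
    have Zl: "Z \<theta> = of_real l * cis \<theta>" by (simp add: Z_def l_def)
    \<comment> \<open>The derivative of the subtracted term is the bound for \<open>?d\<close>, so
      \<open>?g\<close> does not increase.\<close>
    let ?g = "\<lambda>r. A n (of_real r * Z \<theta>) - 2 * real n * K * sqrt l * sqrt r"
    let ?d = "\<lambda>r. real n * Re ((Lam n (pt n (of_real r * Z \<theta>)) - of_real (lnXn n)) * Z \<theta>)"
    have dA: "((\<lambda>r. A n (of_real r * Z \<theta>)) has_real_derivative ?d x) (at x)" if "x \<ge> 0" for x
    proof (rule A_has_derivative)
      show "((\<lambda>r. of_real r * Z \<theta>) has_vector_derivative Z \<theta>) (at x)"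
        by (auto intro!: derivative_eq_intros)
      show "0 \<le> Re (of_real x * Z \<theta>)" using that Re_Z_pos[OF tp(2)] by simp
      show "Im (of_real x * Z \<theta>) \<noteq> 0 \<or> 1 < Re (of_real x * Z \<theta>) \<or> of_real x * Z \<theta> = 0"
        using Im_Z_pos[OF tp(1) th(2)] by auto
    qed
    have "?g 1 - ?g r \<le> 0 * (1 - r)"
    proof (rule increment_bounds(1)[where f' = "\<lambda>r. ?d r - real n * K * sqrt l / sqrt r"])
      fix x assume x: "r < x" "x < 1"
      then have x0: "x > 0" using r by simp
      have "((\<lambda>r. 2 * real n * K * sqrt l * sqrt r) has_real_derivative real n * K * sqrt l / sqrt x) (at x)"
        by (rule DERIV_cong[OF DERIV_cmult[OF DERIV_real_sqrt[OF x0]]]) (simp add: divide_simps)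
      then show "(?g has_real_derivative ?d x - real n * K * sqrt l / sqrt x) (at x)"
        by (intro DERIV_diff dA) (use x0 in auto)
      have pt: "pt n (of_real x * Z \<theta>) = of_real (real n * (x * l)) * cis \<theta> - 1/2" by (simp add: pt_def Zl)
      have "x * l \<le> 1" using x0 x l by (simp add: mult_le_one)
      then have "cmod (Lam n (pt n (of_real x * Z \<theta>)) - of_real (lnXn n)) \<le> K * sqrt (real n / (real n * (x * l)))"
        unfolding pt using n x0 l th by (intro K(2)) (auto simp: mult_left_le)
      also have "real n / (real n * (x * l)) = 1 / (x * l)" using n by simp
      finally have c: "cmod (Lam n (pt n (of_real x * Z \<theta>)) - of_real (lnXn n)) \<le> K * sqrt (1 / (x * l))" .
      have "?d x \<le> real n * cmod ((Lam n (pt n (of_real x * Z \<theta>)) - of_real (lnXn n)) * Z \<theta>)"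
        by (intro mult_left_mono complex_Re_le_cmod) auto
      also have "\<dots> \<le> real n * (K * sqrt (1 / (x * l)) * l)"
        unfolding norm_mult using c l K(1) x0 by (intro mult_left_mono mult_mono) (auto simp: Zl norm_mult)
      also have "sqrt (1 / (x * l)) * l = sqrt l / sqrt x"
      proof -
        have "l = sqrt l * sqrt l" using l by simp
        then show ?thesis using x0 l by (simp add: real_sqrt_divide real_sqrt_mult field_simps)
      qed
      then have "real n * (K * sqrt (1 / (x * l)) * l) = real n * K * sqrt l / sqrt x" by (simp add: mult.assoc)
      finally show "?d x - real n * K * sqrt l / sqrt x \<le> 0" by simp
    next
      have "continuous_on {r..1} (\<lambda>r. A n (of_real r * Z \<theta>))"
        using r by (intro continuous_at_imp_continuous_on ballI DERIV_isCont[OF dA]) auto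
      then show "continuous_on {r..1} ?g" by (intro continuous_intros)
    qed (use r in auto)
    then have "A n (Z \<theta>) - 2 * real n * K * sqrt l \<le> A n (of_real r * Z \<theta>) - 2 * real n * K * sqrt l * sqrt r" by simp
    moreover have "2 * real n * K * sqrt l * sqrt r \<ge> 0" using K l r by simp
    ultimately show "A n (Z \<theta>) - real n * (2 * K * sqrt (sqrt (R \<theta>))) \<le> A n (of_real r * Z \<theta>)"
      by (simp add: l_def mult_ac)
  qed (use K in simp)
qed

end

text \<open>Both p and e are at most a multiple of d, hence so is their geometric mean. This splits
  the singularity of 1 / d into factors that depend on separate variables.\<close>

lemma inverse_le_split_sqrt:
  fixes d p e K :: real
  assumes "d \<ge> p" "d \<ge> e - K * p" "p > 0" "e > 0" "K \<ge> 0"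
  shows "1 / d \<le> sqrt (1 + K) / (sqrt e * sqrt p)"
proof -
  have d: "d > 0" using assms by linarith
  have "e \<le> d + K * p" using assms by simp
  also have "\<dots> \<le> d + K * d" using assms by (intro add_mono mult_left_mono) auto
  finally have e: "e \<le> (1 + K) * d" by (simp add: algebra_simps)
  have "e * p \<le> ((1 + K) * d) * d" using e assms d by (intro mult_mono) auto
  then have "sqrt (e * p) \<le> sqrt ((1 + K) * d\<^sup>2)" by (simp add: power2_eq_square mult.assoc)
  then have "sqrt e * sqrt p \<le> sqrt (1 + K) * d" using d by (simp add: real_sqrt_mult)
  then show ?thesis using d assms by (simp add: field_simps)
qed

context kernel_setting
begin

subsection \<open>Closing the contour\<close>

definition sarc :: "nat \<Rightarrow> real \<Rightarrow> real \<Rightarrow> complex" where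
  "sarc n \<theta>1 x = pt n (Z (\<theta>1 * (2 * x - 1)))"

definition gam :: "nat \<Rightarrow> real \<Rightarrow> real \<Rightarrow> complex" where
  "gam n \<theta>1 = linepath (-1/2) (pt n (cnj (Z \<theta>1))) +++ (sarc n \<theta>1 +++ linepath (pt n (Z \<theta>1)) (-1/2))"

lemma abs_arc_angle: "0 \<le> (\<theta>1::real) \<Longrightarrow> 0 \<le> x \<Longrightarrow> x \<le> 1 \<Longrightarrow> \<bar>\<theta>1 * (2 * x - 1)\<bar> \<le> \<theta>1"
proof -
  assume h: "0 \<le> \<theta>1" "0 \<le> x" "x \<le> 1"
  then have "\<bar>2 * x - 1\<bar> \<le> 1" by linarith
  then show ?thesis using h by (simp add: abs_mult mult_left_le)
qed

lemma arc_has_vector_derivative: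
  assumes "0 < \<theta>1" "\<theta>1 < \<tau>" "x \<in> {0..1}"
  shows "(sarc n \<theta>1 has_vector_derivative of_real (real n * (2 * \<theta>1)) * Z' (\<theta>1 * (2 * x - 1))) (at x)"
proof -
  have ab: "\<bar>\<theta>1 * (2 * x - 1)\<bar> < \<tau>" using abs_arc_angle[of \<theta>1 x] assms by auto
  have "((\<lambda>x. \<theta>1 * (2 * x - 1)) has_vector_derivative 2 * \<theta>1) (at x)"
    unfolding has_real_derivative_iff_has_vector_derivative[symmetric] by (auto intro!: derivative_eq_intros)
  then have "((Z \<circ> (\<lambda>x. \<theta>1 * (2 * x - 1))) has_vector_derivative (2 * \<theta>1) *\<^sub>R Z' (\<theta>1 * (2 * x - 1))) (at x)"
    by (rule vector_diff_chain_at) (rule Z_has_vector_derivative[OF ab])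
  then have "((\<lambda>x. of_nat n * Z (\<theta>1 * (2 * x - 1))) has_vector_derivative of_nat n * ((2 * \<theta>1) *\<^sub>R Z' (\<theta>1 * (2 * x - 1)))) (at x)"
    unfolding o_def by (rule has_vector_derivative_mult_right)
  then have "((\<lambda>x. of_nat n * Z (\<theta>1 * (2 * x - 1)) - 1/2) has_vector_derivative of_nat n * ((2 * \<theta>1) *\<^sub>R Z' (\<theta>1 * (2 * x - 1))) - 0) (at x)"
    by (rule has_vector_derivative_diff) (rule has_vector_derivative_const)
  then show ?thesis unfolding sarc_def[abs_def] pt_def by (simp add: scaleR_conv_of_real mult_ac)
qed

lemma valid_path_arc:
  assumes "0 < \<theta>1" "\<theta>1 < \<tau>"
  shows "valid_path (sarc n \<theta>1)"
proof -
  have "continuous_on {0..1} (\<lambda>x. Z' (\<theta>1 * (2 * x - 1)))"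
  proof (rule continuous_on_compose2[OF continuous_on_Z'])
    show "continuous_on {0..1} (\<lambda>x. \<theta>1 * (2 * x - 1))" by (intro continuous_intros)
    show "(\<lambda>x. \<theta>1 * (2 * x - 1)) ` {0..1} \<subseteq> {-\<tau><..<\<tau>}"
    proof (rule image_subsetI)
      fix x :: real assume "x \<in> {0..1}"
      then have "\<bar>\<theta>1 * (2 * x - 1)\<bar> < \<tau>" using abs_arc_angle[of \<theta>1 x] assms by auto
      then show "\<theta>1 * (2 * x - 1) \<in> {-\<tau><..<\<tau>}" unfolding greaterThanLessThan_iff by linarith
    qed
  qed
  then have "continuous_on {0..1} (\<lambda>x. of_real (real n * (2 * \<theta>1)) * Z' (\<theta>1 * (2 * x - 1)))"
    by (intro continuous_intros)
  then have "sarc n \<theta>1 C1_differentiable_on {0..1}"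
    unfolding C1_differentiable_on_def using arc_has_vector_derivative[OF assms]
    by (intro exI[of _ "\<lambda>x. of_real (real n * (2 * \<theta>1)) * Z' (\<theta>1 * (2 * x - 1))"]) simp
  then show ?thesis unfolding valid_path_def by (rule C1_differentiable_imp_piecewise)
qed

lemma arc_ends: "pathstart (sarc n \<theta>1) = pt n (cnj (Z \<theta>1))" "pathfinish (sarc n \<theta>1) = pt n (Z \<theta>1)"
  using Z_minus[of \<theta>1] by (simp_all add: sarc_def pathstart_def pathfinish_def)

lemma valid_path_gam: "0 < \<theta>1 \<Longrightarrow> \<theta>1 < \<tau> \<Longrightarrow> valid_path (gam n \<theta>1)"
  unfolding gam_def by (intro valid_path_join valid_path_arc valid_path_linepath) (auto simp: arc_ends)

lemma gam_loop: "pathfinish (gam n \<theta>1) = pathstart (gam n \<theta>1)"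
  by (simp add: gam_def)

lemma segment_pt:
  assumes "t \<in> closed_segment (-1/2) (pt n w)"
  obtains r where "0 \<le> r" "r \<le> 1" "t = pt n (of_real r * w)"
proof -
  obtain r where r: "0 \<le> r" "r \<le> 1" "t = (1 - r) *\<^sub>R (-1/2) + r *\<^sub>R pt n w"
    using assms unfolding closed_segment_def by blast
  have "t = pt n (of_real r * w)" unfolding r(3) pt_def by (simp add: scaleR_conv_of_real field_simps)
  then show thesis using that r by blast
qed

lemma path_image_arc:
  assumes "0 < \<theta>1" "t \<in> path_image (sarc n \<theta>1)"
  obtains \<theta> where "\<bar>\<theta>\<bar> \<le> \<theta>1" "t = pt n (Z \<theta>)"
proof -
  obtain x where "x \<in> {0..1}" "t = sarc n \<theta>1 x" using assms(2) unfolding path_image_def by blast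
  then show thesis using that[of "\<theta>1 * (2 * x - 1)"] abs_arc_angle[of \<theta>1 x] assms(1) by (auto simp: sarc_def)
qed

lemma path_image_gam:
  assumes "0 < \<theta>1"
  shows "path_image (gam n \<theta>1) = closed_segment (-1/2) (pt n (cnj (Z \<theta>1))) \<union> path_image (sarc n \<theta>1) \<union> closed_segment (-1/2) (pt n (Z \<theta>1))"
  unfolding gam_def by (subst path_image_join, simp add: arc_ends, subst path_image_join)
    (auto simp: arc_ends closed_segment_commute)

lemma path_image_gamE:
  assumes "0 < \<theta>1" "t \<in> path_image (gam n \<theta>1)"
  obtains \<zeta> where "t = pt n \<zeta>" "(\<exists>\<theta>. \<bar>\<theta>\<bar> \<le> \<theta>1 \<and> \<zeta> = Z \<theta>) \<or> (\<exists>r. 0 \<le> r \<and> r \<le> 1 \<and> (\<zeta> = of_real r * Z \<theta>1 \<or> \<zeta> = of_real r * cnj (Z \<theta>1)))"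
  using assms(2) unfolding path_image_gam[OF assms(1)]
proof (elim UnE)
  assume "t \<in> closed_segment (-1/2) (pt n (cnj (Z \<theta>1)))"
  then show thesis by (rule segment_pt) (use that in blast)
next
  assume "t \<in> path_image (sarc n \<theta>1)"
  then show thesis by (rule path_image_arc[OF assms(1)]) (use that in blast)
next
  assume "t \<in> closed_segment (-1/2) (pt n (Z \<theta>1))"
  then show thesis by (rule segment_pt) (use that in blast)
qed

lemma Re_Z_less_a:
  assumes "\<theta>0 < \<bar>\<theta>\<bar>" "\<bar>\<theta>\<bar> < \<tau>" shows "Re (Z \<theta>) < a"
proof -
  have "Re (Z \<theta>) = Re (Z \<bar>\<theta>\<bar>)" by (cases "\<theta> \<ge> 0") (auto simp: Re_Z)
  then show ?thesis using Re_Z_strict_antimono[of \<theta>0 "\<bar>\<theta>\<bar>"] assms theta0 by (simp add: a_def)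
qed

lemma Re_Z_greater_a:
  assumes "\<bar>\<theta>\<bar> < \<theta>0" shows "a < Re (Z \<theta>)"
proof -
  have "Re (Z \<theta>) = Re (Z \<bar>\<theta>\<bar>)" by (cases "\<theta> \<ge> 0") (auto simp: Re_Z)
  then show ?thesis using Re_Z_strict_antimono[of "\<bar>\<theta>\<bar>" \<theta>0] assms theta0 by (simp add: a_def)
qed

lemma Z_on_line:
  assumes "\<bar>\<theta>\<bar> < \<tau>" "Z \<theta> = Complex a u" shows "\<bar>u\<bar> = b"
proof -
  have "Re (Z \<theta>) = a" using assms by simp
  then have "\<bar>\<theta>\<bar> = \<theta>0" using Re_Z_less_a[of \<theta>] Re_Z_greater_a[of \<theta>] assms(1) by linarith
  then have "\<theta> = \<theta>0 \<or> \<theta> = - \<theta>0" by linarith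
  moreover have "u = Im (Z \<theta>)" using assms by simp
  ultimately show ?thesis using b_pos by (auto simp: b_def Z_minus)
qed

text \<open>The closing segments stay to the left of Re z = a, and by the strict monotonicity of Re
  Z the arc meets this line only at the two saddle points. On the real axis the arc has only the
  point Z 0, the segments only 0.\<close>

lemma gam_avoids:
  assumes t1: "\<theta>0 < \<theta>1" "\<theta>1 < \<tau>" and n: "n \<ge> 1"
  shows "\<bar>u\<bar> \<noteq> b \<Longrightarrow> pt n (Complex a u) \<notin> path_image (gam n \<theta>1)"
    and "0 < x \<Longrightarrow> x < Re (Z 0) \<Longrightarrow> pt n (of_real x) \<notin> path_image (gam n \<theta>1)"
proof -
  have t0: "0 < \<theta>1" using t1 theta0 by simp
  have inj: "pt n z = pt n w \<longleftrightarrow> z = w" for z w using n by (simp add: pt_def)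
  have Ra: "Re (of_real r * Z \<theta>1) < a" "Re (of_real r * cnj (Z \<theta>1)) < a" if "0 \<le> r" "r \<le> 1" for r
  proof -
    have "0 < Re (Z \<theta>1)" "Re (Z \<theta>1) < a" using Re_Z_pos[of \<theta>1] Re_Z_less_a[of \<theta>1] t1 theta0 by auto
    moreover have "r * Re (Z \<theta>1) \<le> Re (Z \<theta>1)" using that calculation by (intro mult_left_le_one_le) auto
    ultimately have "r * Re (Z \<theta>1) < a" by linarith
    then show "Re (of_real r * Z \<theta>1) < a" "Re (of_real r * cnj (Z \<theta>1)) < a" by auto
  qed
  show "pt n (Complex a u) \<notin> path_image (gam n \<theta>1)" if "\<bar>u\<bar> \<noteq> b"
  proof
    assume "pt n (Complex a u) \<in> path_image (gam n \<theta>1)"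
    then obtain \<zeta> where z: "pt n (Complex a u) = pt n \<zeta>"
      "(\<exists>\<theta>. \<bar>\<theta>\<bar> \<le> \<theta>1 \<and> \<zeta> = Z \<theta>) \<or> (\<exists>r. 0 \<le> r \<and> r \<le> 1 \<and> (\<zeta> = of_real r * Z \<theta>1 \<or> \<zeta> = of_real r * cnj (Z \<theta>1)))"
      by (rule path_image_gamE[OF t0]) blast
    have zz: "\<zeta> = Complex a u" using z(1) inj by simp
    have "Re \<zeta> = a" using zz by simp
    then obtain \<theta> where "\<bar>\<theta>\<bar> \<le> \<theta>1" "\<zeta> = Z \<theta>" using z(2) Ra by (metis less_irrefl)
    then show False using Z_on_line[of \<theta> u] zz t1 that by auto
  qed
  show "pt n (of_real x) \<notin> path_image (gam n \<theta>1)" if x: "0 < x" "x < Re (Z 0)"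
  proof
    assume "pt n (of_real x) \<in> path_image (gam n \<theta>1)"
    then obtain \<zeta> where z: "pt n (of_real x) = pt n \<zeta>"
      "(\<exists>\<theta>. \<bar>\<theta>\<bar> \<le> \<theta>1 \<and> \<zeta> = Z \<theta>) \<or> (\<exists>r. 0 \<le> r \<and> r \<le> 1 \<and> (\<zeta> = of_real r * Z \<theta>1 \<or> \<zeta> = of_real r * cnj (Z \<theta>1)))"
      by (rule path_image_gamE[OF t0]) blast
    have zz: "\<zeta> = of_real x" using z(1) inj by simp
    have I1: "Im (Z \<theta>1) > 0" using Im_Z_pos t0 t1 by simp
    from z(2) show False
    proof (elim disjE exE conjE)
      fix \<theta> assume th: "\<bar>\<theta>\<bar> \<le> \<theta>1" "\<zeta> = Z \<theta>"
      have "\<theta> = 0"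
      proof (rule ccontr)
        assume "\<theta> \<noteq> 0"
        then have "Im (Z \<theta>) \<noteq> 0" using Im_Z_pos[of \<theta>] Im_Z_pos[of "- \<theta>"] th t1 by (cases "\<theta> > 0") (auto simp: Z_minus)
        then show False using zz th by simp
      qed
      then show False using x zz th by simp
    next
      fix r assume "0 \<le> r" "r \<le> 1" "\<zeta> = of_real r * Z \<theta>1"
      then have "Im \<zeta> = r * Im (Z \<theta>1)" "Re \<zeta> = r * Re (Z \<theta>1)" by auto
      then show False using zz I1 x by auto
    next
      fix r assume "0 \<le> r" "r \<le> 1" "\<zeta> = of_real r * cnj (Z \<theta>1)"
      then have "Im \<zeta> = - r * Im (Z \<theta>1)" "Re \<zeta> = r * Re (Z \<theta>1)" by auto
      then show False using zz I1 x by auto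
    qed
  qed
qed

lemma a_less_Re_Z_0: "a < Re (Z 0)"
  using Re_Z_greater_a[of 0] theta0 by simp

text \<open>On the segments \<open>Ln (p - t)\<close> and on the arc \<open>Ln (t - p)\<close> is a
  primitive of 1 / (t - p), because each piece stays off the corresponding cut. At the two junctions
  the logarithms differ by \<i>pi with opposite signs, and together these jumps make 2 pi
  \<i>.\<close>

lemma winding_number_gam_a:
  assumes t1: "\<theta>0 < \<theta>1" "\<theta>1 < \<tau>" and n: "n \<ge> 1"
  shows "winding_number (gam n \<theta>1) (pt n (of_real a)) = 1"
proof -
  define p where "p = pt n (of_real a)"
  have t0: "0 < \<theta>1" using t1 theta0 by simp
  have pn: "p \<notin> path_image (gam n \<theta>1)"
    unfolding p_def by (rule gam_avoids(2)[OF t1 n a_pos a_less_Re_Z_0])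
  define w where "w = pt n (Z \<theta>1) - p"
  have wI: "Im w > 0" using Im_Z_pos[OF t0 t1(2)] n by (simp add: w_def p_def)
  have wc: "pt n (cnj (Z \<theta>1)) - p = cnj w" by (simp add: w_def p_def pt_def)
  have R1: "0 < Re (Z \<theta>1)" "Re (Z \<theta>1) < a" using Re_Z_pos[of \<theta>1] Re_Z_less_a[of \<theta>1] t1 theta0 by auto
  have seg: "p - t \<notin> \<real>\<^sub>\<le>\<^sub>0"
    if t: "t \<in> closed_segment (-1/2) (pt n v)" and v: "Re v = Re (Z \<theta>1)" for t v
  proof -
    obtain r where r: "0 \<le> r" "r \<le> 1" "t = pt n (of_real r * v)" using segment_pt[OF t] by blast
    have "r * Re (Z \<theta>1) \<le> Re (Z \<theta>1)" using r R1 by (intro mult_left_le_one_le) auto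
    then have "r * Re (Z \<theta>1) < a" using R1 by linarith
    then have "Re (p - t) > 0" using n r v by (simp add: p_def)
    then show ?thesis by (auto simp: complex_nonpos_Reals_iff)
  qed
  have prim: "((\<lambda>t. 1 / (t - p)) has_contour_integral (Ln (p - pathfinish g) - Ln (p - pathstart g))) g"
    if "valid_path g" "\<And>t. t \<in> path_image g \<Longrightarrow> p - t \<notin> \<real>\<^sub>\<le>\<^sub>0" for g
  proof (rule contour_integral_primitive[where S = "path_image g"])
    show "((\<lambda>t. Ln (p - t)) has_field_derivative 1 / (t - p)) (at t within path_image g)" if "t \<in> path_image g" for t
    proof (rule has_field_derivative_at_within)
      have "p - t \<noteq> 0" using \<open>\<And>t. t \<in> path_image g \<Longrightarrow> p - t \<notin> \<real>\<^sub>\<le>\<^sub>0\<close>[OF that] by auto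
      then show "((\<lambda>t. Ln (p - t)) has_field_derivative 1 / (t - p)) (at t)"
        using \<open>\<And>t. t \<in> path_image g \<Longrightarrow> p - t \<notin> \<real>\<^sub>\<le>\<^sub>0\<close>[OF that]
        by (auto intro!: derivative_eq_intros simp: field_simps)
    qed
  qed (use that in auto)
  have c1: "contour_integral (linepath (-1/2) (pt n (cnj (Z \<theta>1)))) (\<lambda>t. 1 / (t - p)) = Ln (- cnj w) - Ln (p + 1/2)"
  proof -
    have "p - pt n (cnj (Z \<theta>1)) = - cnj w" using wc by (simp add: algebra_simps)
    then show ?thesis
      using contour_integral_unique[OF prim[OF valid_path_linepath[of "-1/2" "pt n (cnj (Z \<theta>1))"]]] seg[of _ "cnj (Z \<theta>1)"] by simp
  qed
  have c3: "contour_integral (linepath (pt n (Z \<theta>1)) (-1/2)) (\<lambda>t. 1 / (t - p)) = Ln (p + 1/2) - Ln (- w)"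
  proof -
    have "p - pt n (Z \<theta>1) = - w" by (simp add: w_def)
    then show ?thesis
      using contour_integral_unique[OF prim[OF valid_path_linepath[of "pt n (Z \<theta>1)" "-1/2"]]] seg[of _ "Z \<theta>1"]
      by (simp add: closed_segment_commute)
  qed
  have c2: "contour_integral (sarc n \<theta>1) (\<lambda>t. 1 / (t - p)) = Ln w - Ln (cnj w)"
  proof -
    have "((\<lambda>t. 1 / (t - p)) has_contour_integral (Ln (pathfinish (sarc n \<theta>1) - p) - Ln (pathstart (sarc n \<theta>1) - p))) (sarc n \<theta>1)"
    proof (rule contour_integral_primitive[where S = "path_image (sarc n \<theta>1)"])
      fix t assume "t \<in> path_image (sarc n \<theta>1)"
      then obtain \<theta> where th: "\<bar>\<theta>\<bar> \<le> \<theta>1" "t = pt n (Z \<theta>)" using path_image_arc[OF t0] by blast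
      have np: "t - p \<notin> \<real>\<^sub>\<le>\<^sub>0"
      proof (cases "\<theta> = 0")
        case True
        then have "Re (t - p) > 0" using a_less_Re_Z_0 n th by (simp add: p_def)
        then show ?thesis by (auto simp: complex_nonpos_Reals_iff)
      next
        case False
        then have "Im (Z \<theta>) \<noteq> 0" using Im_Z_pos[of \<theta>] Im_Z_pos[of "- \<theta>"] th t1 by (cases "\<theta> > 0") (auto simp: Z_minus)
        then have "Im (t - p) \<noteq> 0" using n th by (simp add: p_def)
        then show ?thesis by (auto simp: complex_nonpos_Reals_iff)
      qed
      then have "((\<lambda>t. Ln (t - p)) has_field_derivative 1 / (t - p)) (at t)"
        by (auto intro!: derivative_eq_intros simp: divide_inverse)
      then show "((\<lambda>t. Ln (t - p)) has_field_derivative 1 / (t - p)) (at t within path_image (sarc n \<theta>1))"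
        by (rule has_field_derivative_at_within)
    qed (use valid_path_arc[OF t0 t1(2)] in auto)
    then show ?thesis using contour_integral_unique wc by (simp add: arc_ends w_def)
  qed
  have pi: "p \<notin> path_image (linepath (-1/2) (pt n (cnj (Z \<theta>1))))" "p \<notin> path_image (sarc n \<theta>1)"
    "p \<notin> path_image (linepath (pt n (Z \<theta>1)) (-1/2))" "p \<notin> path_image (sarc n \<theta>1 +++ linepath (pt n (Z \<theta>1)) (-1/2))"
    using pn unfolding path_image_gam[OF t0] by (auto simp: path_image_join arc_ends closed_segment_commute)
  have "winding_number (gam n \<theta>1) p
      = winding_number (linepath (-1/2) (pt n (cnj (Z \<theta>1)))) p + (winding_number (sarc n \<theta>1) p + winding_number (linepath (pt n (Z \<theta>1)) (-1/2)) p)"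
    unfolding gam_def using pi valid_path_imp_path[OF valid_path_arc[OF t0 t1(2)]]
    by (subst winding_number_join, auto simp: arc_ends, subst winding_number_join, auto simp: arc_ends)
  also have "\<dots> = 1 / (2 * pi * \<i>) * ((Ln (- cnj w) - Ln (p + 1/2)) + ((Ln w - Ln (cnj w)) + (Ln (p + 1/2) - Ln (- w))))"
    by (simp only: winding_number_valid_path[OF valid_path_linepath pi(1)] winding_number_valid_path[OF valid_path_arc[OF t0 t1(2)] pi(2)]
        winding_number_valid_path[OF valid_path_linepath pi(3)] c1 c2 c3 distrib_left)
  also have "(Ln (- cnj w) - Ln (p + 1/2)) + ((Ln w - Ln (cnj w)) + (Ln (p + 1/2) - Ln (- w))) = 2 * pi * \<i>"
  proof -
    have nz: "w \<noteq> 0" "cnj w \<noteq> 0" using wI by auto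
    have "Ln (- w) = Ln w - \<i> * pi" using Ln_minus[OF nz(1)] wI by simp
    moreover have "Ln (- cnj w) = Ln (cnj w) + \<i> * pi" using Ln_minus[OF nz(2)] wI by simp
    ultimately show ?thesis by simp
  qed
  finally show ?thesis by (simp add: p_def)
qed

text \<open>The winding number is constant on connected sets off the contour: along the real axis
  from a to (k + 1/2) / n, which is below 1 < Z 0; along the line for |u| < b; and along each half
  line |u| > b, which is unbounded, so that the value there is 0.\<close>

lemma winding_number_gam:
  assumes t1: "\<theta>0 < \<theta>1" "\<theta>1 < \<tau>" and n: "n \<ge> 1"
  shows "k < n \<Longrightarrow> winding_number (gam n \<theta>1) (of_nat k) = 1"
    and "\<bar>u\<bar> < b \<Longrightarrow> winding_number (gam n \<theta>1) (pt n (Complex a u)) = 1"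
    and "\<bar>u\<bar> > b \<Longrightarrow> winding_number (gam n \<theta>1) (pt n (Complex a u)) = 0"
proof -
  have t0: "0 < \<theta>1" using t1 theta0 by simp
  have pg: "path (gam n \<theta>1)" using valid_path_gam[OF t0 t1(2)] valid_path_imp_path by blast
  have real: "winding_number (gam n \<theta>1) (pt n (of_real x)) = 1" if x: "0 < x" "x < Re (Z 0)" for x
  proof -
    have "winding_number (gam n \<theta>1) (pt n (of_real x)) = winding_number (gam n \<theta>1) (pt n (of_real a))"
    proof (rule winding_number_eq[OF pg gam_loop])
      let ?S = "(\<lambda>x. pt n (of_real x)) ` {0<..<Re (Z 0)}"
      show "connected ?S" unfolding pt_def by (intro connected_continuous_image continuous_intros connected_Ioo)
      show "?S \<inter> path_image (gam n \<theta>1) = {}" using gam_avoids(2)[OF t1 n] by auto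
      show "pt n (of_real x) \<in> ?S" "pt n (of_real a) \<in> ?S" using x a_pos a_less_Re_Z_0 by auto
    qed
    then show ?thesis using winding_number_gam_a[OF t1 n] by simp
  qed
  show "winding_number (gam n \<theta>1) (of_nat k) = 1" if k: "k < n"
  proof -
    have "of_nat k = pt n (of_real ((real k + 1/2) / real n))" using n by (simp add: pt_def)
    moreover have "(real k + 1/2) / real n < Re (Z 0)"
    proof -
      have "(real k + 1/2) / real n < 1" using k by simp
      then show ?thesis using Z_0(2) by linarith
    qed
    moreover have "0 < (real k + 1/2) / real n" using n by simp
    ultimately show ?thesis using real by metis
  qed
  show "winding_number (gam n \<theta>1) (pt n (Complex a u)) = 1" if u: "\<bar>u\<bar> < b"
  proof -
    have "winding_number (gam n \<theta>1) (pt n (Complex a u)) = winding_number (gam n \<theta>1) (pt n (Complex a 0))"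
    proof (rule winding_number_eq[OF pg gam_loop])
      let ?S = "(\<lambda>u. pt n (Complex a u)) ` {-b<..<b}"
      show "connected ?S" unfolding pt_def by (intro connected_continuous_image continuous_intros connected_Ioo)
      show "?S \<inter> path_image (gam n \<theta>1) = {}" using gam_avoids(1)[OF t1 n] by fastforce
      have "u \<in> {-b<..<b}" "0 \<in> {-b<..<b}" using u b_pos by (simp_all add: abs_less_iff minus_less_iff)
      then show "pt n (Complex a u) \<in> ?S" "pt n (Complex a 0) \<in> ?S" by blast+
    qed
    then show ?thesis using winding_number_gam_a[OF t1 n] by (simp add: complex_of_real_def)
  qed
  have out: "winding_number (gam n \<theta>1) (pt n (Complex a u)) = 0" if u: "u \<in> S" and S: "connected S" "\<And>v. v \<in> S \<Longrightarrow> \<bar>v\<bar> \<noteq> b"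
    "\<And>B. \<exists>v\<in>S. B \<le> \<bar>v\<bar>" for u S
  proof -
    obtain B where B: "\<And>z. B \<le> norm z \<Longrightarrow> winding_number (gam n \<theta>1) z = 0"
      using winding_number_zero_at_infinity[OF pg gam_loop] by blast
    obtain v where v: "v \<in> S" "B \<le> \<bar>v\<bar>" using S(3) by blast
    have "\<bar>v\<bar> \<le> real n * \<bar>v\<bar>" using n by (simp add: mult_le_cancel_right1)
    also have "\<dots> = \<bar>Im (pt n (Complex a v))\<bar>" by (simp add: abs_mult)
    also have "\<dots> \<le> cmod (pt n (Complex a v))" by (rule abs_Im_le_cmod)
    finally have "winding_number (gam n \<theta>1) (pt n (Complex a v)) = 0" using B v by auto
    moreover have "winding_number (gam n \<theta>1) (pt n (Complex a u)) = winding_number (gam n \<theta>1) (pt n (Complex a v))"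
    proof (rule winding_number_eq[OF pg gam_loop])
      let ?S = "(\<lambda>u. pt n (Complex a u)) ` S"
      show "connected ?S" unfolding pt_def by (intro connected_continuous_image continuous_intros S)
      show "?S \<inter> path_image (gam n \<theta>1) = {}" using gam_avoids(1)[OF t1 n] S(2) by auto
    qed (use u v in auto)
    ultimately show ?thesis by simp
  qed
  show "winding_number (gam n \<theta>1) (pt n (Complex a u)) = 0" if u: "\<bar>u\<bar> > b"
  proof (cases "u > 0")
    case True
    show ?thesis
    proof (rule out[of u "{b<..}"])
      show "\<exists>v\<in>{b<..}. B \<le> \<bar>v\<bar>" for B by (rule bexI[of _ "max B (b + 1)"]) auto
    qed (use True u b_pos in \<open>auto simp: connected_Ioi\<close>)
  next
    case False
    show ?thesis
    proof (rule out[of u "{..<-b}"])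
      show "\<exists>v\<in>{..<-b}. B \<le> \<bar>v\<bar>" for B by (rule bexI[of _ "- max B (b + 1)"]) (use b_pos in auto)
    qed (use False u b_pos in \<open>auto simp: connected_Iio\<close>)
  qed
qed

text \<open>By \<open>Re_Z_diff\<close> the difference is at least sqrt (R \<theta>0) times the
  difference of the cosines. The product formula splits the latter into a sine that is at least sin
  (\<theta>0 / 2) and the sine of half the angle difference, for which sin x \<ge> x / 2
  suffices.\<close>

lemma Re_Z_minus_a_ge:
  obtains c where "c > 0" "\<And>\<theta>. \<bar>\<theta>\<bar> < \<tau> \<Longrightarrow> c * \<bar>\<bar>\<theta>\<bar> - \<theta>0\<bar> \<le> \<bar>Re (Z \<theta>) - a\<bar>"
proof
  let ?s = "sqrt (R \<theta>0)"
  define c where "c = ?s * (2 * sin (\<theta>0 / 2) * (1 / 4))"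
  have s: "?s > 0" using R_pos[of \<theta>0] theta0 by simp
  have sn: "sin (\<theta>0 / 2) > 0" using theta0 tau pi_gt_zero by (intro sin_gt_zero) auto
  show "c > 0" using s sn by (simp add: c_def)
  fix \<theta> assume th: "\<bar>\<theta>\<bar> < \<tau>"
  define t where "t = \<bar>\<theta>\<bar>"
  have t: "0 \<le> t" "t < \<tau>" using th by (auto simp: t_def)
  have RZ: "Re (Z \<theta>) = Re (Z t)" unfolding t_def by (cases "\<theta> \<ge> 0") (auto simp: Re_Z)
  have 1: "\<bar>Re (Z t) - a\<bar> \<ge> ?s * \<bar>cos t - cos \<theta>0\<bar>"
  proof (cases "t \<le> \<theta>0")
    case True
    have "cos \<theta>0 \<le> cos t" using True t theta0 tau pi_gt_zero by (intro cos_monotone_0_pi_le) auto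
    then show ?thesis using Re_Z_diff(2)[of t \<theta>0] True t theta0 by (simp add: a_def)
  next
    case False
    have "cos t \<le> cos \<theta>0" using False t theta0 tau pi_gt_zero by (intro cos_monotone_0_pi_le) auto
    then show ?thesis using Re_Z_diff(1)[of \<theta>0 t] False t theta0 by (simp add: a_def)
  qed
  have "\<bar>cos t - cos \<theta>0\<bar> = 2 * \<bar>sin ((t + \<theta>0) / 2)\<bar> * \<bar>sin ((\<theta>0 - t) / 2)\<bar>"
    unfolding cos_diff_cos by (simp add: abs_mult)
  also have "\<dots> \<ge> 2 * sin (\<theta>0 / 2) * (\<bar>t - \<theta>0\<bar> / 4)"
  proof (rule mult_mono)
    have "sin (\<theta>0 / 2) \<le> sin ((t + \<theta>0) / 2)"
      using t theta0 tau by (intro sin_monotone_2pi_le) auto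
    then show "2 * sin (\<theta>0 / 2) \<le> 2 * \<bar>sin ((t + \<theta>0) / 2)\<bar>" by linarith
    have J: "x / 2 \<le> sin x" if x: "0 \<le> x" "x \<le> pi / 3" for x
    proof -
      have "1 / 2 * (x - 0) \<le> sin x - sin 0"
      proof (rule increment_bounds(2)[where f' = cos])
        fix y assume y: "0 < y" "y < x"
        have "cos (pi / 3) \<le> cos y" using x y pi_gt_zero by (intro cos_monotone_0_pi_le) auto
        then show "1 / 2 \<le> cos y" by (simp add: cos_60)
      qed (use x in \<open>auto intro!: continuous_intros\<close>)
      then show ?thesis by simp
    qed
    have "\<bar>t - \<theta>0\<bar> \<le> \<tau>" using t theta0 by (auto simp: abs_le_iff)
    then have "\<bar>t - \<theta>0\<bar> / 2 \<le> \<tau> / 2" by (rule divide_right_mono) simp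
    also have "\<tau> / 2 \<le> \<tau>" using tau(1) by simp
    finally have "\<bar>t - \<theta>0\<bar> / 2 \<le> pi / 3" using tau(2) by (rule order_trans)
    then have "\<bar>t - \<theta>0\<bar> / 4 \<le> sin (\<bar>t - \<theta>0\<bar> / 2)" using J[of "\<bar>t - \<theta>0\<bar> / 2"] by simp
    also have "\<dots> \<le> \<bar>sin ((\<theta>0 - t) / 2)\<bar>"
    proof (cases "t \<le> \<theta>0")
      case False
      then have "\<bar>t - \<theta>0\<bar> / 2 = - ((\<theta>0 - t) / 2)" by (simp add: field_simps)
      then have "sin (\<bar>t - \<theta>0\<bar> / 2) = - sin ((\<theta>0 - t) / 2)" by (simp only: sin_minus)
      then show ?thesis by simp
    qed simp
    finally show "\<bar>t - \<theta>0\<bar> / 4 \<le> \<bar>sin ((\<theta>0 - t) / 2)\<bar>" .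
  qed (use sn in auto)
  finally have "?s * (2 * sin (\<theta>0 / 2) * (\<bar>t - \<theta>0\<bar> / 4)) \<le> ?s * \<bar>cos t - cos \<theta>0\<bar>" using s by (intro mult_left_mono) auto
  then have "c * \<bar>t - \<theta>0\<bar> \<le> ?s * \<bar>cos t - cos \<theta>0\<bar>" by (simp add: c_def mult_ac)
  then show "c * \<bar>\<bar>\<theta>\<bar> - \<theta>0\<bar> \<le> \<bar>Re (Z \<theta>) - a\<bar>" using 1 RZ by (simp add: t_def)
qed

text \<open>The horizontal distance is at least a multiple of the angle difference; the vertical one
  is at least the difference of |u| and b minus a Lipschitz term of the same order.
  \<open>inverse_le_split_sqrt\<close> combines them. On the segments the horizontal distance is at
  least a - Re (Z \<theta>1); the square root is kept there so that all pieces share one weight in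
  u.\<close>

lemma line_arc_distance:
  assumes t1: "\<theta>0 < \<theta>1" "\<theta>1 < \<tau>"
  obtains C where "C > 0"
    "\<And>u \<theta>. \<bar>u\<bar> \<noteq> b \<Longrightarrow> \<bar>\<theta>\<bar> \<le> \<theta>1 \<Longrightarrow> \<bar>\<theta>\<bar> \<noteq> \<theta>0 \<Longrightarrow>
      1 / cmod (Complex a u - Z \<theta>) \<le> C / (sqrt \<bar>\<bar>u\<bar> - b\<bar> * sqrt \<bar>\<bar>\<theta>\<bar> - \<theta>0\<bar>)"
    "\<And>u r. \<bar>u\<bar> \<noteq> b \<Longrightarrow> 0 \<le> r \<Longrightarrow> r \<le> 1 \<Longrightarrow>
      1 / cmod (Complex a u - of_real r * Z \<theta>1) \<le> C / sqrt \<bar>\<bar>u\<bar> - b\<bar>"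
proof -
  obtain c where c: "c > 0" "\<And>\<theta>. \<bar>\<theta>\<bar> < \<tau> \<Longrightarrow> c * \<bar>\<bar>\<theta>\<bar> - \<theta>0\<bar> \<le> \<bar>Re (Z \<theta>) - a\<bar>"
    using Re_Z_minus_a_ge by blast
  obtain D where D: "D > 0" "\<And>\<theta>. \<bar>\<theta>\<bar> \<le> \<theta>1 \<Longrightarrow> cmod (Z' \<theta>) \<le> D" using Z'_bounded[OF t1(2)] by blast
  have t0: "0 < \<theta>1" using t1 theta0 by simp
  have lip: "cmod (Z x - Z y) \<le> D * \<bar>x - y\<bar>" if "x \<in> {-\<theta>1..\<theta>1}" "y \<in> {-\<theta>1..\<theta>1}" for x y
  proof -
    have "norm (Z x - Z y) \<le> D * norm (x - y)"
    proof (rule differentiable_bound[where S = "{-\<theta>1..\<theta>1}" and f' = "\<lambda>x h. h *\<^sub>R Z' x"])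
      fix z assume z: "z \<in> {-\<theta>1..\<theta>1}"
      then have zz: "\<bar>z\<bar> \<le> \<theta>1" by (auto simp: abs_le_iff)
      have "(Z has_vector_derivative Z' z) (at z within {-\<theta>1..\<theta>1})"
        by (rule has_vector_derivative_at_within[OF Z_has_vector_derivative]) (use zz t1 in auto)
      then show "(Z has_derivative (\<lambda>h. h *\<^sub>R Z' z)) (at z within {-\<theta>1..\<theta>1})" by (simp add: has_vector_derivative_def)
      show "onorm (\<lambda>h. h *\<^sub>R Z' z) \<le> D"
      proof (rule onorm_le)
        show "norm (h *\<^sub>R Z' z) \<le> D * norm h" for h
          using mult_right_mono[OF D(2)[OF zz] abs_ge_zero[of h]] by (simp add: mult.commute)
      qed
    qed (use that in auto)
    then show ?thesis by simp
  qed
  have ZI: "\<bar>Im (Z \<theta>)\<bar> = Im (Z \<bar>\<theta>\<bar>)" if "\<bar>\<theta>\<bar> < \<tau>" for \<theta>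
  proof -
    have "Im (Z \<bar>\<theta>\<bar>) \<ge> 0" using Im_Z_pos[of "\<bar>\<theta>\<bar>"] Z_0 that by (cases "\<theta> = 0") auto
    then show ?thesis by (cases "\<theta> \<ge> 0") (auto simp: Im_Z)
  qed
  define K where "K = D / c"
  define C1 where "C1 = sqrt (1 + K) / sqrt c"
  have K: "K \<ge> 0" using c D by (simp add: K_def)
  define p1 where "p1 = a - Re (Z \<theta>1)"
  have p1: "p1 > 0" "0 < Re (Z \<theta>1)" using Re_Z_less_a[of \<theta>1] Re_Z_pos[of \<theta>1] t1 theta0 by (auto simp: p1_def)
  define K2 where "K2 = (Im (Z \<theta>1) + b) / p1"
  have K2: "K2 \<ge> 0" using p1 b_pos Im_Z_pos[OF t0 t1(2)] by (simp add: K2_def)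
  define C2 where "C2 = sqrt (1 + K2) / sqrt p1"
  have C: "C1 > 0" "C2 > 0" using K K2 c p1 by (auto simp: C1_def C2_def)
  show thesis
  proof (rule that[of "C1 + C2"])
    fix u \<theta> :: real assume u: "\<bar>u\<bar> \<noteq> b" and th: "\<bar>\<theta>\<bar> \<le> \<theta>1" "\<bar>\<theta>\<bar> \<noteq> \<theta>0"
    let ?d = "cmod (Complex a u - Z \<theta>)"
    let ?v = "\<bar>\<bar>\<theta>\<bar> - \<theta>0\<bar>"
    have tt: "\<bar>\<theta>\<bar> < \<tau>" using th t1 by simp
    have d1: "c * ?v \<le> ?d" using c(2)[OF tt] abs_Re_le_cmod[of "Complex a u - Z \<theta>"] by simp
    have "\<bar>\<bar>Im (Z \<theta>)\<bar> - b\<bar> \<le> D * ?v"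
    proof -
      have "\<bar>Im (Z \<bar>\<theta>\<bar>) - Im (Z \<theta>0)\<bar> \<le> cmod (Z \<bar>\<theta>\<bar> - Z \<theta>0)" using abs_Im_le_cmod[of "Z \<bar>\<theta>\<bar> - Z \<theta>0"] by simp
      also have "\<dots> \<le> D * ?v" by (rule lip) (use th t1 theta0 in auto)
      finally show ?thesis using ZI[OF tt] by (simp add: b_def)
    qed
    moreover have "\<bar>u - Im (Z \<theta>)\<bar> \<le> ?d" using abs_Im_le_cmod[of "Complex a u - Z \<theta>"] by simp
    ultimately have "\<bar>\<bar>u\<bar> - b\<bar> - D * ?v \<le> ?d" by linarith
    then have d2: "\<bar>\<bar>u\<bar> - b\<bar> - K * (c * ?v) \<le> ?d" using c by (simp add: K_def)
    have "1 / ?d \<le> sqrt (1 + K) / (sqrt \<bar>\<bar>u\<bar> - b\<bar> * sqrt (c * ?v))"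
      by (rule inverse_le_split_sqrt[OF d1 d2]) (use c K u th in auto)
    also have "\<dots> = C1 / (sqrt \<bar>\<bar>u\<bar> - b\<bar> * sqrt ?v)" by (simp add: C1_def real_sqrt_mult)
    also have "\<dots> \<le> (C1 + C2) / (sqrt \<bar>\<bar>u\<bar> - b\<bar> * sqrt ?v)" using C by (intro divide_right_mono) auto
    finally show "1 / ?d \<le> (C1 + C2) / (sqrt \<bar>\<bar>u\<bar> - b\<bar> * sqrt ?v)" .
  next
    fix u r :: real assume u: "\<bar>u\<bar> \<noteq> b" and r: "0 \<le> r" "r \<le> 1"
    let ?d = "cmod (Complex a u - of_real r * Z \<theta>1)"
    have "r * Re (Z \<theta>1) \<le> Re (Z \<theta>1)" using r p1 by (simp add: mult_left_le_one_le)
    then have d1: "p1 \<le> ?d" using abs_Re_le_cmod[of "Complex a u - of_real r * Z \<theta>1"] by (simp add: p1_def)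
    have I: "0 \<le> r * Im (Z \<theta>1)" "r * Im (Z \<theta>1) \<le> Im (Z \<theta>1)" using r Im_Z_pos[OF t0 t1(2)] by (auto simp: mult_left_le_one_le)
    have "\<bar>u - r * Im (Z \<theta>1)\<bar> \<le> ?d" using abs_Im_le_cmod[of "Complex a u - of_real r * Z \<theta>1"] by simp
    then have "\<bar>\<bar>u\<bar> - b\<bar> - (Im (Z \<theta>1) + b) \<le> ?d" using I b_pos by linarith
    then have d2: "\<bar>\<bar>u\<bar> - b\<bar> - K2 * p1 \<le> ?d" using p1 by (simp add: K2_def)
    have "1 / ?d \<le> sqrt (1 + K2) / (sqrt \<bar>\<bar>u\<bar> - b\<bar> * sqrt p1)"
      by (rule inverse_le_split_sqrt[OF d1 d2]) (use p1 K2 u in auto)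
    also have "\<dots> = C2 / sqrt \<bar>\<bar>u\<bar> - b\<bar>" by (simp add: C2_def)
    also have "\<dots> \<le> (C1 + C2) / sqrt \<bar>\<bar>u\<bar> - b\<bar>" using C by (intro divide_right_mono) auto
    finally show "1 / ?d \<le> (C1 + C2) / sqrt \<bar>\<bar>u\<bar> - b\<bar>" .
  qed (use C in auto)
qed

end

lemma Gamma_quotient_falling:
  fixes z :: complex
  assumes "z - of_nat n + 1 \<notin> \<int>\<^sub>\<le>\<^sub>0"
  shows "Gamma (z + 1) / Gamma (z - of_nat n + 1) = (\<Prod>i<n. z - of_nat i)"
proof -
  have "Gamma (z + 1) / Gamma (z - of_nat n + 1) = pochhammer (z - of_nat n + 1) n"
    using pochhammer_Gamma[OF assms, of n] by simp
  also have "\<dots> = (\<Prod>i<n. z - of_nat n + 1 + of_nat i)"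
    by (simp add: pochhammer_prod atLeast0LessThan)
  also have "\<dots> = (\<Prod>i<n. z - of_nat n + 1 + of_nat (n - Suc i))"
    by (rule prod.nat_diff_reindex[symmetric])
  also have "\<dots> = (\<Prod>i<n. z - of_nat i)"
    by (rule prod.cong) (auto simp: of_nat_diff)
  finally show ?thesis .
qed

context kernel_setting
begin

subsection \<open>Residues and the shifted line\<close>

text \<open>
  \<open>Psi\<close> and \<open>G\<close> collect the \<open>s\<close>- and \<open>t\<close>-factors of the integrand without the falling products.
  In \<open>What\<close>, the \<open>t\<close>-integral evaluated by residues, the product over \<open>{..<n}\<close> has been multiplied into
  the sum, so that the terms \<open>1 / (s - k)\<close> leave no poles.
\<close>

definition G :: "nat \<Rightarrow> real \<Rightarrow> complex \<Rightarrow> complex" where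
  "G n x t = of_real x powr t * (\<Prod>j=1..M. rGamma (t + of_nat (\<nu> j) + 1)) * Gamma (t + of_nat n + of_nat \<kappa>)"

definition Psi :: "nat \<Rightarrow> real \<Rightarrow> complex \<Rightarrow> complex" where
  "Psi n y s = (\<Prod>j=1..M. Gamma (s + of_nat (\<nu> j) + 1)) * rGamma (s + of_nat n + of_nat \<kappa>) * of_real y powr (- s - 1)"

definition res :: "nat \<Rightarrow> real \<Rightarrow> nat \<Rightarrow> complex" where
  "res n x k = G n x (of_nat k) / (\<Prod>i\<in>{..<n}-{k}. of_nat k - of_nat i)"

definition What :: "nat \<Rightarrow> real \<Rightarrow> real \<Rightarrow> complex \<Rightarrow> complex" where
  "What n x y s = Psi n y s * (\<Sum>k<n. res n x k * (\<Prod>i\<in>{..<n}-{k}. s - of_nat i))"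

lemma holomorphic_G: "x > 0 \<Longrightarrow> G n x holomorphic_on {z. Re z > -1}"
  unfolding G_def[abs_def]
proof (intro holomorphic_on_mult)
  assume "x > 0"
  then show "(\<lambda>t. of_real x powr t) holomorphic_on {z. Re z > -1}" by (intro holomorphic_intros) auto
  show "(\<lambda>t. \<Prod>j=1..M. rGamma (t + of_nat (\<nu> j) + 1)) holomorphic_on {z. Re z > -1}"
    by (intro holomorphic_on_prod holomorphic_rGamma' holomorphic_intros)
  show "(\<lambda>t. Gamma (t + of_nat n + of_nat \<kappa>)) holomorphic_on {z. Re z > -1}"
  proof (rule holomorphic_Gamma')
    show "t + of_nat n + of_nat \<kappa> \<notin> \<int>\<^sub>\<le>\<^sub>0" if "t \<in> {z. Re z > -1}" for t
      using not_nonpos_Ints[of "t + of_nat n + of_nat \<kappa>"] that kappa by auto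
  qed (intro holomorphic_intros)
qed

lemma holomorphic_Psi: "y > 0 \<Longrightarrow> Psi n y holomorphic_on {z. Re z > -1}"
  unfolding Psi_def[abs_def]
proof (intro holomorphic_on_mult)
  assume "y > 0"
  then show "(\<lambda>s. of_real y powr (- s - 1)) holomorphic_on {z. Re z > -1}" by (intro holomorphic_intros) auto
  show "(\<lambda>s. rGamma (s + of_nat n + of_nat \<kappa>)) holomorphic_on {z. Re z > -1}"
    by (intro holomorphic_rGamma' holomorphic_intros)
  show "(\<lambda>s. \<Prod>j=1..M. Gamma (s + of_nat (\<nu> j) + 1)) holomorphic_on {z. Re z > -1}"
  proof (intro holomorphic_on_prod holomorphic_Gamma')
    show "s + of_nat (\<nu> j) + 1 \<notin> \<int>\<^sub>\<le>\<^sub>0" if "s \<in> {z. Re z > -1}" for s j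
      using not_nonpos_Ints[of "s + of_nat (\<nu> j) + 1"] that by auto
  qed (intro holomorphic_intros)
qed

lemma holomorphic_What: "y > 0 \<Longrightarrow> What n x y holomorphic_on {z. Re z > -1}"
  unfolding What_def[abs_def] by (intro holomorphic_on_mult holomorphic_Psi holomorphic_intros)

lemma What_eq:
  assumes "s \<notin> of_nat ` {..<n}"
  shows "What n x y s = (\<Prod>i<n. s - of_nat i) * Psi n y s * (\<Sum>k<n. res n x k / (s - of_nat k))"
proof -
  have "res n x k * (\<Prod>i\<in>{..<n}-{k}. s - of_nat i) = (\<Prod>i<n. s - of_nat i) * (res n x k / (s - of_nat k))" if "k < n" for k
  proof -
    have "(\<Prod>i<n. s - of_nat i) = (s - of_nat k) * (\<Prod>i\<in>{..<n}-{k}. s - of_nat i)"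
      using that by (simp add: prod.remove)
    moreover have "s - of_nat k \<noteq> 0" using assms that by auto
    ultimately show ?thesis by simp
  qed
  then have "(\<Sum>k<n. res n x k * (\<Prod>i\<in>{..<n}-{k}. s - of_nat i)) = (\<Prod>i<n. s - of_nat i) * (\<Sum>k<n. res n x k / (s - of_nat k))"
    unfolding sum_distrib_left by (intro sum.cong) auto
  then show ?thesis by (simp add: What_def)
qed

lemma Phi_G:
  assumes "Re s > -1" "s \<notin> of_nat ` {..<n}"
  shows "G n x s / (\<Prod>i<n. s - of_nat i) = of_real x powr s / Phi n s"
proof -
  have "(\<Prod>j=1..M. rGamma (s + of_nat (\<nu> j) + 1)) = 1 / (\<Prod>j=1..M. Gamma (s + of_nat (\<nu> j) + 1))"
    unfolding rGamma_inverse_Gamma inverse_eq_divide prod_dividef by simp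
  moreover have "Gamma (s + of_nat n + of_nat \<kappa>) = 1 / rGamma (s + of_nat n + of_nat \<kappa>)"
    by (simp add: Gamma_def inverse_eq_divide)
  ultimately show ?thesis unfolding G_def Phi_def by simp
qed

lemma kernel_integrand_eq:
  assumes s: "Re s = - (1/2)" and t: "Re t > - (1/2)" "t \<notin> of_nat ` {..<n}" and nu0: "\<nu> 0 = 0"
  shows "kernel_integrand M \<nu> \<kappa> n x y s t
    = (((\<Prod>i<n. s - of_nat i) * Psi n y s) * G n x t) / (\<Prod>i<n. t - of_nat i) / (s - t)"
proof -
  \<comment> \<open>\<open>Gamma\<close> has the value 0 at its poles, so the arguments must be
    shown to avoid them. As Re s = -1/2, a pole here would make 1 an even number.\<close>
  have sn: "s - of_nat n + 1 \<notin> \<int>\<^sub>\<le>\<^sub>0"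
  proof
    assume "s - of_nat n + 1 \<in> \<int>\<^sub>\<le>\<^sub>0"
    then obtain m where "s - of_nat n + 1 = - of_nat m" by (auto elim!: nonpos_Ints_cases')
    then have "Re (s - of_nat n + 1) = - real m" by simp
    then have "real_of_int (2 * (int n - int m)) = 1" using s by simp
    then have "2 * (int n - int m) = 1" by (simp only: of_int_eq_1_iff)
    then show False by presburger
  qed
  \<comment> \<open>A pole here would make t an integer below n, and Re t > -1/2 leaves only the
    excluded points 0, ..., n - 1.\<close>
  have tn: "t - of_nat n + 1 \<notin> \<int>\<^sub>\<le>\<^sub>0"
  proof
    assume "t - of_nat n + 1 \<in> \<int>\<^sub>\<le>\<^sub>0"
    then obtain m where m: "t - of_nat n + 1 = - of_nat m" by (auto elim!: nonpos_Ints_cases')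
    then have tt: "t = of_int (int n - int m - 1)" by (simp add: algebra_simps)
    then have "int n - int m - 1 > - 1" using t(1) by (simp add: complex_eq_iff)
    then have "t = of_nat (n - m - 1)" "n - m - 1 < n" using tt by (auto simp: of_nat_diff)
    then show False using t(2) by auto
  qed
  have nz: "Gamma (s - of_nat n + 1) \<noteq> 0" "Gamma (t - of_nat n + 1) \<noteq> 0"
    using sn tn by (auto simp: Gamma_eq_zero_iff)
  have A: "(\<Prod>j=0..M. Gamma (s + of_nat (\<nu> j) + 1) / Gamma (t + of_nat (\<nu> j) + 1))
     = Gamma (s + 1) / Gamma (t + 1) * ((\<Prod>j=1..M. Gamma (s + of_nat (\<nu> j) + 1)) * (\<Prod>j=1..M. rGamma (t + of_nat (\<nu> j) + 1)))"
    using nu0 prod.atLeast_Suc_atMost[of 0 M "\<lambda>j. Gamma (s + of_nat (\<nu> j) + 1) / Gamma (t + of_nat (\<nu> j) + 1)"]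
    by (simp add: rGamma_inverse_Gamma divide_inverse prod.distrib)
  have B: "Gamma (s + 1) = (\<Prod>i<n. s - of_nat i) * Gamma (s - of_nat n + 1)"
    using Gamma_quotient_falling[OF sn] nz by (simp add: divide_eq_eq)
  have C: "Gamma (t + 1) = (\<Prod>i<n. t - of_nat i) * Gamma (t - of_nat n + 1)"
    using Gamma_quotient_falling[OF tn] nz by (simp add: divide_eq_eq)
  have E: "1 / Gamma (s + of_nat n + of_nat \<kappa>) = rGamma (s + of_nat n + of_nat \<kappa>)"
    by (simp add: rGamma_inverse_Gamma inverse_eq_divide)
  have p: "(\<Prod>i<n. t - of_nat i) \<noteq> 0" using t(2) by auto
  have "Gamma (s + 1) / Gamma (t + 1) * (Gamma (t - of_nat n + 1) / Gamma (s - of_nat n + 1))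
      = (\<Prod>i<n. s - of_nat i) / (\<Prod>i<n. t - of_nat i)"
    unfolding B C using nz p by simp
  moreover have "X * (A * B) * Y * (T / S) * (xt * ys / d) = P * (A * (1 / S) * ys) * (xt * B * T) / Q / d"
    if "X * Y = P / Q" for X A B Y T S xt ys d P Q :: complex
  proof -
    have "X * (A * B) * Y * (T / S) * (xt * ys / d) = (X * Y) * (A * B * (T / S) * (xt * ys / d))"
      by (simp only: mult_ac)
    then show ?thesis using that by (simp add: mult_ac)
  qed
  ultimately show ?thesis
    unfolding kernel_integrand_def A G_def Psi_def E[symmetric] by blast
qed

text \<open>The contour lies in the half plane Re t > -1/2 and s on its boundary, so s has winding
  number 0 and only the residues at 0, ..., n - 1 count.\<close>

lemma contour_integral_kernel:
  assumes s: "Re s = - (1/2)" and n: "encircling_contour n \<Sigma>" and x: "x > 0" and nu0: "\<nu> 0 = 0"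
  shows "contour_integral \<Sigma> (kernel_integrand M \<nu> \<kappa> n x y s) = 2 * pi * \<i> * What n x y s"
proof -
  note e = n[unfolded encircling_contour_def]
  let ?c = "(\<Prod>i<n. s - of_nat i) * Psi n y s"
  have H: "path_image \<Sigma> \<subseteq> {z. Re z > - (1/2)}" using e by auto
  have sn: "s \<notin> of_nat ` {..<n}" using s by auto
  have "contour_integral \<Sigma> (kernel_integrand M \<nu> \<kappa> n x y s)
      = contour_integral \<Sigma> (\<lambda>t. (?c * G n x t) / (\<Prod>i<n. t - of_nat i) / (s - t))"
    by (rule contour_integral_eq) (use e kernel_integrand_eq[OF s _ _ nu0] in auto)
  also have "\<dots> = 2 * pi * \<i> * ((\<Sum>k<n. (?c * G n x (of_nat k)) / (\<Prod>i\<in>{..<n}-{k}. of_nat k - of_nat i) / (s - of_nat k))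
       - winding_number \<Sigma> s * ((?c * G n x s) / (\<Prod>i<n. s - of_nat i)))"
  proof (rule contour_integral_simple_poles)
    show "(\<lambda>t. ?c * G n x t) holomorphic_on {z. Re z > -1}" by (intro holomorphic_intros holomorphic_G x)
    show "path_image \<Sigma> \<subseteq> {z. Re z > -1} - insert s (of_nat ` {..<n})" using e s by fastforce
  qed (use e s sn in auto)
  also have "winding_number \<Sigma> s = 0"
    by (rule winding_number_zero_outside[OF _ convex_halfspace_Re_gt _ _ H]) (use e s in \<open>auto simp: valid_path_imp_path\<close>)
  also have "(\<Sum>k<n. (?c * G n x (of_nat k)) / (\<Prod>i\<in>{..<n}-{k}. of_nat k - of_nat i) / (s - of_nat k)) = What n x y s"
    unfolding What_eq[OF sn] sum_distrib_left res_def by (intro sum.cong) auto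
  finally show ?thesis by simp
qed

lemma corr_kernel_eq_What:
  assumes "encircling_contour n \<Sigma>" "x > 0" "\<nu> 0 = 0"
  shows "corr_kernel M \<nu> \<kappa> n \<Sigma> x y = 1 / (2 * pi) * (LBINT u. What n x y (Complex (- (1/2)) u))"
proof -
  have "contour_integral \<Sigma> (kernel_integrand M \<nu> \<kappa> n x y (Complex (- (1/2)) u)) = 2 * pi * \<i> * What n x y (Complex (- (1/2)) u)" for u
    by (rule contour_integral_kernel) (use assms in auto)
  then have "corr_kernel M \<nu> \<kappa> n \<Sigma> x y = 1 / (2 * complex_of_real pi * \<i>)\<^sup>2 *
     (LBINT u. (\<i> * (2 * pi * \<i>)) * What n x y (Complex (- (1 / 2)) u))"
    unfolding corr_kernel_def by (simp add: mult.assoc)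
  also have "\<dots> = 1 / (2 * complex_of_real pi * \<i>)\<^sup>2 * (\<i> * (2 * pi * \<i>)) * (LBINT u. What n x y (Complex (- (1 / 2)) u))"
    by (subst integral_mult_right_zero) simp
  also have "1 / (2 * complex_of_real pi * \<i>)\<^sup>2 * (\<i> * (2 * pi * \<i>)) = 1 / (2 * pi)"
    by (simp add: power2_eq_square field_simps)
  finally show ?thesis .
qed

lemma Gamma_prod_decay:
  fixes \<alpha> \<beta> :: real and I :: "nat set"
  assumes "\<alpha> > -1" "finite I"
  obtains C where "C > 0" "\<And>s. \<alpha> \<le> Re s \<Longrightarrow> Re s \<le> \<beta> \<Longrightarrow> cmod (\<Prod>j\<in>I. Gamma (s + of_nat (\<nu> j) + 1)) \<le> C"
proof -
  have "\<exists>C>0. \<forall>s. \<alpha> \<le> Re s \<longrightarrow> Re s \<le> \<beta> \<longrightarrow> cmod (\<Prod>j\<in>I. Gamma (s + of_nat (\<nu> j) + 1)) \<le> C"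
    using assms(2)
  proof (induction I rule: finite_induct)
    case empty
    then show ?case by (intro exI[of _ 1]) simp
  next
    case (insert j I)
    obtain C where C: "C > 0" "\<forall>s. \<alpha> \<le> Re s \<longrightarrow> Re s \<le> \<beta> \<longrightarrow> cmod (\<Prod>j\<in>I. Gamma (s + of_nat (\<nu> j) + 1)) \<le> C"
      using insert.IH by blast
    have "0 < \<alpha> + real (\<nu> j) + 1" using assms(1) of_nat_0_le_iff[of "\<nu> j"] by linarith
    then obtain B where B: "B > 0" "\<And>s. \<alpha> + real (\<nu> j) + 1 \<le> Re s \<Longrightarrow> Re s \<le> \<beta> + real (\<nu> j) + 1 \<Longrightarrow> cmod (Gamma s) \<le> B"
      using Gamma_strip_bounded[of "\<alpha> + real (\<nu> j) + 1" "\<beta> + real (\<nu> j) + 1"] by blast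
    have "cmod (\<Prod>j\<in>insert j I. Gamma (s + of_nat (\<nu> j) + 1)) \<le> B * C" if "\<alpha> \<le> Re s" "Re s \<le> \<beta>" for s
      using insert.hyps B C that by (simp add: norm_mult mult_mono)
    then show ?case using B(1) C(1) by (intro exI[of _ "B * C"]) auto
  qed
  then show thesis using that by blast
qed

text \<open>The quotient of Gamma(s + \<open>\<nu> 1\<close> + 1) and Gamma(s + n + \<kappa>) is one
  over a polynomial of degree m = n + \<kappa> - \<open>\<nu> 1\<close> - 1. As \<kappa> >
  \<open>\<nu> 1\<close>, this is at least n and exceeds the degree n - 1 of the products in the
  sum. The decay in Im s is then supplied by Gamma(s + \<open>\<nu> 2\<close> + 1), which is present
  because M \<ge> 2.\<close>

lemma What_decay:
  assumes n: "n \<ge> 1" and y: "y > 0" and \<alpha>: "\<alpha> > -1"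
  obtains D where "\<And>s. \<alpha> \<le> Re s \<Longrightarrow> Re s \<le> \<beta> \<Longrightarrow> cmod (What n x y s) \<le> D / (1 + (Im s)\<^sup>2)"
proof -
  define \<delta> where "\<delta> = min (\<alpha> + 1) 1"
  have d: "0 < \<delta>" "\<delta> \<le> \<alpha> + 1" "\<delta> \<le> 1" using \<alpha> by (auto simp: \<delta>_def)
  define m where "m = n + \<kappa> - \<nu> 1 - 1"
  have m: "of_nat m = (of_nat n + of_nat \<kappa> - of_nat (\<nu> 1) - 1 :: complex)" "m \<ge> n"
    using n kappa by (auto simp: m_def of_nat_diff)
  define E where "E = \<bar>\<alpha>\<bar> + \<bar>\<beta>\<bar> + real n"
  define c where "c = E / \<delta> + 1"
  have c1: "c \<ge> 1" using d by (simp add: c_def E_def)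
  have rat: "cmod (\<Prod>i\<in>{..<n}-{k}. s - of_nat i) / cmod (pochhammer (s + of_nat (\<nu> 1) + 1) m) \<le> c ^ (n - 1) * (1 / \<delta>) ^ (m - (n - 1))"
    if s: "\<alpha> \<le> Re s" "Re s \<le> \<beta>" and k: "k < n" for s k
  proof -
    \<comment> \<open>One scale for small and large Im s: each factor of the numerator is at most c
      q, each factor of the denominator at least q.\<close>
    define q where "q = max \<delta> \<bar>Im s\<bar>"
    have q: "q > 0" "q \<ge> \<delta>" "\<bar>Im s\<bar> \<le> q" using d by (auto simp: q_def)
    have num: "cmod (s - of_nat i) \<le> c * q" if "i < n" for i
    proof -
      have "cmod (s - of_nat i) \<le> \<bar>Re (s - of_nat i)\<bar> + \<bar>Im (s - of_nat i)\<bar>" by (rule cmod_le)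
      also have "\<dots> \<le> E + \<bar>Im s\<bar>" using s that by (auto simp: E_def)
      also have "\<dots> \<le> E / \<delta> * q + q"
      proof (intro add_mono q)
        have "E = E / \<delta> * \<delta>" using d by simp
        also have "\<dots> \<le> E / \<delta> * q" using q d by (intro mult_left_mono) (auto simp: E_def)
        finally show "E \<le> E / \<delta> * q" .
      qed
      also have "\<dots> = c * q" by (simp add: c_def algebra_simps)
      finally show ?thesis .
    qed
    have den: "q \<le> cmod (s + of_nat (\<nu> 1) + 1 + of_nat i)" for i
    proof -
      let ?z = "s + of_nat (\<nu> 1) + 1 + of_nat i"
      have "\<delta> \<le> Re ?z" using s d by simp
      then have "\<delta> \<le> cmod ?z" using abs_Re_le_cmod[of ?z] by linarith
      moreover have "\<bar>Im s\<bar> \<le> cmod ?z" using abs_Im_le_cmod[of ?z] by simp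
      ultimately show ?thesis by (simp add: q_def)
    qed
    have "cmod (\<Prod>i\<in>{..<n}-{k}. s - of_nat i) \<le> (\<Prod>i\<in>{..<n}-{k}. c * q)"
      unfolding prod_norm[symmetric] by (intro prod_mono) (use num in auto)
    also have "\<dots> = (c * q) ^ (n - 1)" using k by simp
    finally have N: "cmod (\<Prod>i\<in>{..<n}-{k}. s - of_nat i) \<le> (c * q) ^ (n - 1)" .
    have "q ^ m = (\<Prod>i=0..<m. q)" by simp
    also have "\<dots> \<le> cmod (pochhammer (s + of_nat (\<nu> 1) + 1) m)"
      unfolding pochhammer_prod prod_norm[symmetric] by (intro prod_mono) (use den q in auto)
    finally have De: "q ^ m \<le> cmod (pochhammer (s + of_nat (\<nu> 1) + 1) m)" .
    have "cmod (\<Prod>i\<in>{..<n}-{k}. s - of_nat i) / cmod (pochhammer (s + of_nat (\<nu> 1) + 1) m) \<le> (c * q) ^ (n - 1) / q ^ m"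
      using N De q c1 by (intro frac_le) auto
    also have "\<dots> = c ^ (n - 1) * (1 / q) ^ (m - (n - 1))"
    proof -
      have "q ^ m = q ^ (n - 1) * q ^ (m - (n - 1))" using m(2) by (simp add: power_add[symmetric])
      then show ?thesis using q by (simp add: power_mult_distrib power_divide)
    qed
    also have "\<dots> \<le> c ^ (n - 1) * (1 / \<delta>) ^ (m - (n - 1))"
      using q d c1 by (intro mult_left_mono power_mono divide_left_mono) auto
    finally show ?thesis .
  qed
  obtain C1 where C1: "C1 > 0" "\<And>s. \<alpha> + real (\<nu> 2) + 1 \<le> Re s \<Longrightarrow> Re s \<le> \<beta> + real (\<nu> 2) + 1 \<Longrightarrow> cmod (Gamma s) \<le> C1 / (1 + (Im s)\<^sup>2)"
  proof -
    have "0 < \<alpha> + real (\<nu> 2) + 1" using \<alpha> of_nat_0_le_iff[of "\<nu> 2"] by linarith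
    then show thesis using Gamma_strip_decay[of "\<alpha> + real (\<nu> 2) + 1" "\<beta> + real (\<nu> 2) + 1"] that by blast
  qed
  obtain C2 where C2: "C2 > 0" "\<And>s. \<alpha> \<le> Re s \<Longrightarrow> Re s \<le> \<beta> \<Longrightarrow> cmod (\<Prod>j\<in>{3..M}. Gamma (s + of_nat (\<nu> j) + 1)) \<le> C2"
    using Gamma_prod_decay[OF \<alpha>, of "{3..M}"] by blast
  define Y where "Y = max (y powr (- \<alpha> - 1)) (y powr (- \<beta> - 1))"
  have Y: "y powr (- Re s - 1) \<le> Y" if "\<alpha> \<le> Re s" "Re s \<le> \<beta>" for s
  proof (cases "y \<ge> 1")
    case True
    then have "y powr (- Re s - 1) \<le> y powr (- \<alpha> - 1)" using that by (intro powr_mono) auto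
    then show ?thesis by (simp add: Y_def)
  next
    case False
    then have "y powr (- Re s - 1) \<le> y powr (- \<beta> - 1)" using that y by (intro powr_mono') auto
    then show ?thesis by (simp add: Y_def)
  qed
  define F where "F = (\<Sum>k<n. cmod (res n x k)) * (c ^ (n - 1) * (1 / \<delta>) ^ (m - (n - 1)))"
  have F: "F \<ge> 0" using c1 d by (simp add: F_def sum_nonneg)
  have "cmod (What n x y s) \<le> F * C1 * C2 * Y / (1 + (Im s)\<^sup>2)" if s: "\<alpha> \<le> Re s" "Re s \<le> \<beta>" for s
  proof -
    let ?z = "s + of_nat (\<nu> 1) + 1"
    have zR: "Re ?z > 0" using s \<alpha> by simp
    have "rGamma ?z = pochhammer ?z m * rGamma (s + of_nat n + of_nat \<kappa>)"
      using pochhammer_rGamma[of ?z m] m(1) by (simp add: add.assoc)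
    moreover have "rGamma ?z \<noteq> 0" using not_nonpos_Ints[OF zR] by (simp add: rGamma_eq_zero_iff)
    moreover have "Gamma ?z * rGamma ?z = 1" using not_nonpos_Ints[OF zR] by (simp add: rGamma_inverse_Gamma Gamma_eq_zero_iff)
    ultimately have gp: "Gamma ?z * rGamma (s + of_nat n + of_nat \<kappa>) = 1 / pochhammer ?z m"
      by (auto simp: field_simps)
    have split: "(\<Prod>j=1..M. Gamma (s + of_nat (\<nu> j) + 1))
        = Gamma ?z * (Gamma (s + of_nat (\<nu> 2) + 1) * (\<Prod>j\<in>{3..M}. Gamma (s + of_nat (\<nu> j) + 1)))"
      using M2 by (simp add: prod.atLeast_Suc_atMost numeral_2_eq_2 numeral_3_eq_3)
    have "What n x y s = (Gamma ?z * rGamma (s + of_nat n + of_nat \<kappa>)) * (Gamma (s + of_nat (\<nu> 2) + 1) *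
        ((\<Prod>j\<in>{3..M}. Gamma (s + of_nat (\<nu> j) + 1)) * (of_real y powr (- s - 1) *
        (\<Sum>k<n. res n x k * (\<Prod>i\<in>{..<n}-{k}. s - of_nat i)))))"
      unfolding What_def Psi_def split by (simp only: mult_ac)
    also have "\<dots> = (Gamma (s + of_nat (\<nu> 2) + 1) * ((\<Prod>j\<in>{3..M}. Gamma (s + of_nat (\<nu> j) + 1)) * of_real y powr (- s - 1))) *
        (\<Sum>k<n. res n x k * (\<Prod>i\<in>{..<n}-{k}. s - of_nat i) / pochhammer ?z m)"
      unfolding gp by (simp add: sum_divide_distrib[symmetric] mult_ac)
    finally have W: "cmod (What n x y s) = (cmod (Gamma (s + of_nat (\<nu> 2) + 1)) * (cmod (\<Prod>j\<in>{3..M}. Gamma (s + of_nat (\<nu> j) + 1)) * cmod (of_real y powr (- s - 1)))) *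
        cmod (\<Sum>k<n. res n x k * (\<Prod>i\<in>{..<n}-{k}. s - of_nat i) / pochhammer ?z m)" by (simp only: norm_mult)
    have S: "cmod (\<Sum>k<n. res n x k * (\<Prod>i\<in>{..<n}-{k}. s - of_nat i) / pochhammer ?z m) \<le> F"
      unfolding F_def sum_distrib_right
    proof (rule sum_norm_le)
      fix k assume "k \<in> {..<n}"
      then show "cmod (res n x k * (\<Prod>i\<in>{..<n}-{k}. s - of_nat i) / pochhammer ?z m) \<le> cmod (res n x k) * (c ^ (n - 1) * (1 / \<delta>) ^ (m - (n - 1)))"
        using mult_left_mono[OF rat[OF s, of k], of "cmod (res n x k)"] by (simp add: norm_mult norm_divide)
    qed
    have yp: "cmod (of_real y powr (- s - 1)) \<le> Y" using Y[OF s] y by (simp add: norm_powr_real_powr)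
    have g2: "cmod (Gamma (s + of_nat (\<nu> 2) + 1)) \<le> C1 / (1 + (Im s)\<^sup>2)" using C1(2)[of "s + of_nat (\<nu> 2) + 1"] s by simp
    have q: "0 \<le> C1 / (1 + (Im s)\<^sup>2)" using C1(1) by simp
    have Y0: "0 \<le> Y" by (simp add: Y_def le_max_iff_disj)
    have "cmod (What n x y s) \<le> (C1 / (1 + (Im s)\<^sup>2) * (C2 * Y)) * F"
      unfolding W by (intro mult_mono g2 C2(2) s yp S mult_nonneg_nonneg q Y0 norm_ge_zero) (use C2 in auto)
    then show ?thesis by (simp add: mult_ac)
  qed
  then show thesis by (rule that)
qed

lemma corr_kernel_shifted:
  assumes n: "n \<ge> 1" and e: "encircling_contour n \<Sigma>" and x: "x > 0" and y: "y > 0" and nu0: "\<nu> 0 = 0"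
  shows "integrable lborel (\<lambda>u. What n x y (pt n (Complex a u)))"
    and "corr_kernel M \<nu> \<kappa> n \<Sigma> x y = of_real (real n / (2 * pi)) * (LBINT u. What n x y (pt n (Complex a u)))"
proof -
  let ?\<beta> = "real n * a - 1/2"
  have \<beta>: "- (1/2) \<le> ?\<beta>" using a_pos by simp
  obtain D where D: "\<And>s. - (1/2) \<le> Re s \<Longrightarrow> Re s \<le> ?\<beta> \<Longrightarrow> cmod (What n x y s) \<le> D / (1 + (Im s)\<^sup>2)"
    by (rule What_decay[OF n y, of "- (1/2)" ?\<beta> x]) auto
  have sub: "{z. - (1/2) \<le> Re z \<and> Re z \<le> ?\<beta>} \<subseteq> {z. Re z > -1}" by auto
  note sh = vertical_line_shift[OF \<beta> open_halfspace_Re_gt convex_halfspace_Re_gt holomorphic_What[OF y] sub D]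
  have pt: "pt n (Complex a u) = Complex ?\<beta> (0 + real n * u)" for u by (simp add: complex_eq_iff)
  have n0: "real n \<noteq> 0" using n by simp
  show "integrable lborel (\<lambda>u. What n x y (pt n (Complex a u)))"
    unfolding pt by (rule lborel_integrable_real_affine[OF sh(1) n0])
  have line: "(LBINT u. What n x y (Complex ?\<beta> u)) = real n *\<^sub>R (LBINT u. What n x y (pt n (Complex a u)))"
    unfolding pt using lborel_integral_real_affine[OF n0, of "\<lambda>u. What n x y (Complex ?\<beta> u)" 0] by simp
  show "corr_kernel M \<nu> \<kappa> n \<Sigma> x y = of_real (real n / (2 * pi)) * (LBINT u. What n x y (pt n (Complex a u)))"
    using corr_kernel_eq_What[OF e x nu0, of y] trans[OF sh(2) line] by (simp add: scaleR_conv_of_real)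
qed

end

lemma exp_minus_abs_le: "exp (- \<bar>u\<bar>) \<le> 4 / (1 + (u::real)\<^sup>2)"
proof -
  have "(1 + \<bar>u\<bar> / 2)\<^sup>2 \<le> (exp (\<bar>u\<bar> / 2))\<^sup>2"
    by (rule power_mono) (use exp_ge_add_one_self[of "\<bar>u\<bar> / 2"] in auto)
  also have "\<dots> = exp \<bar>u\<bar>" by (simp add: exp_double[symmetric])
  finally have "(1 + \<bar>u\<bar> / 2)\<^sup>2 \<le> exp \<bar>u\<bar>" .
  moreover have "1 + u\<^sup>2 \<le> 4 * (1 + \<bar>u\<bar> / 2)\<^sup>2" by (simp add: power2_eq_square algebra_simps)
  ultimately have "1 + u\<^sup>2 \<le> 4 * exp \<bar>u\<bar>" by linarith
  moreover have "1 + u\<^sup>2 > 0" by (simp add: add_pos_nonneg)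
  ultimately show ?thesis by (simp add: exp_minus field_simps)
qed

context kernel_setting
begin

subsection \<open>The remainder\<close>

definition main :: "nat \<Rightarrow> real \<Rightarrow> real \<Rightarrow> real \<Rightarrow> complex" where
  "main n x y u = of_real y powr (- pt n (Complex a u) - 1) * of_real x powr pt n (Complex a u)"

lemma gam_subset:
  assumes t1: "\<theta>0 < \<theta>1" "\<theta>1 < \<tau>" and t: "t \<in> path_image (gam n \<theta>1)"
  shows "Re t > -1" "t \<notin> of_nat ` {..<n}"
proof -
  have t0: "0 < \<theta>1" using t1 theta0 by simp
  obtain \<zeta> where z: "t = pt n \<zeta>"
    "(\<exists>\<theta>. \<bar>\<theta>\<bar> \<le> \<theta>1 \<and> \<zeta> = Z \<theta>) \<or> (\<exists>r. 0 \<le> r \<and> r \<le> 1 \<and> (\<zeta> = of_real r * Z \<theta>1 \<or> \<zeta> = of_real r * cnj (Z \<theta>1)))"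
    using t by (rule path_image_gamE[OF t0]) blast
  have "Re \<zeta> \<ge> 0 \<and> (Im \<zeta> \<noteq> 0 \<or> Re \<zeta> > 1 \<or> \<zeta> = 0)"
    using z(2)
  proof (elim disjE exE conjE)
    fix \<theta> assume "\<bar>\<theta>\<bar> \<le> \<theta>1" "\<zeta> = Z \<theta>"
    then show ?thesis using Z_off_cut[of \<theta>] Re_Z_pos[of \<theta>] t1 by auto
  next
    fix r assume "0 \<le> r" "r \<le> 1" "\<zeta> = of_real r * Z \<theta>1"
    then show ?thesis using Im_Z_pos[OF t0 t1(2)] Re_Z_pos[of \<theta>1] t0 t1 by auto
  next
    fix r assume "0 \<le> r" "r \<le> 1" "\<zeta> = of_real r * cnj (Z \<theta>1)"
    then show ?thesis using Im_Z_pos[OF t0 t1(2)] Re_Z_pos[of \<theta>1] t0 t1 by auto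
  qed
  then show "Re t > -1" "t \<notin> of_nat ` {..<n}" using pt_not_pole[of \<zeta> n] z(1) by auto
qed

text \<open>The residue theorem on \<open>gam\<close> expresses the sum of the residues at 0, ..., n
  - 1 by the contour integral plus x^s / Phi(s) times the winding number of s. Multiplied by Phi(s)
  y^(-s-1), the second term becomes \<open>main\<close>.\<close>

lemma What_split:
  assumes t1: "\<theta>0 < \<theta>1" "\<theta>1 < \<tau>" and n: "n \<ge> 1" and x: "x > 0" and u: "u \<noteq> 0" "\<bar>u\<bar> \<noteq> b"
  defines "s \<equiv> pt n (Complex a u)"
  shows "What n x y s - (if \<bar>u\<bar> < b then main n x y u else 0)
    = Phi n s * of_real y powr (- s - 1) * (1 / (2 * pi * \<i>) * contour_integral (gam n \<theta>1) (\<lambda>t. of_real x powr t / Phi n t / (s - t)))"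
proof -
  have t0: "0 < \<theta>1" using t1 theta0 by simp
  have s1: "Re s > -1" "s \<notin> of_nat ` {..<n}"
    unfolding s_def using pt_not_pole[of "Complex a u" n] a_pos u by auto
  have ps: "s \<notin> path_image (gam n \<theta>1)" unfolding s_def by (rule gam_avoids(1)[OF t1 n u(2)])
  define w where "w = winding_number (gam n \<theta>1) s"
  have w: "w = (if \<bar>u\<bar> < b then 1 else 0)"
    unfolding w_def s_def using winding_number_gam(2,3)[OF t1 n, of u] u(2) by auto
  define I where "I = contour_integral (gam n \<theta>1) (\<lambda>t. of_real x powr t / Phi n t / (s - t))"
  have "I = contour_integral (gam n \<theta>1) (\<lambda>t. G n x t / (\<Prod>i<n. t - of_nat i) / (s - t))"
    unfolding I_def by (rule contour_integral_eq) (use Phi_G gam_subset[OF t1] in auto)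
  also have "\<dots> = 2 * pi * \<i> * ((\<Sum>k<n. G n x (of_nat k) / (\<Prod>i\<in>{..<n}-{k}. of_nat k - of_nat i) / (s - of_nat k))
       - winding_number (gam n \<theta>1) s * (G n x s / (\<Prod>i<n. s - of_nat i)))"
  proof (rule contour_integral_simple_poles[OF holomorphic_G[OF x] s1 valid_path_gam[OF t0 t1(2)] gam_loop])
    show "path_image (gam n \<theta>1) \<subseteq> {z. - 1 < Re z} - insert s (of_nat ` {..<n})"
    proof
      fix z assume z: "z \<in> path_image (gam n \<theta>1)"
      then show "z \<in> {z. - 1 < Re z} - insert s (of_nat ` {..<n})"
        using gam_subset(1)[OF t1 z] gam_subset(2)[OF t1 z] ps by blast
    qed
  qed (rule winding_number_gam(1)[OF t1 n])
  also have "\<dots> = 2 * pi * \<i> * ((\<Sum>k<n. res n x k / (s - of_nat k)) - w * (of_real x powr s / Phi n s))"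
    unfolding Phi_G[OF s1] w_def res_def ..
  finally have I: "1 / (2 * pi * \<i>) * I = (\<Sum>k<n. res n x k / (s - of_nat k)) - w * (of_real x powr s / Phi n s)"
    by simp
  have PP: "(\<Prod>i<n. s - of_nat i) * Psi n y s = Phi n s * of_real y powr (- s - 1)"
    by (simp add: Phi_def Psi_def mult_ac)
  have nz: "Phi n s \<noteq> 0" by (rule Phi_nonzero[OF s1])
  have "Phi n s * of_real y powr (- s - 1) * (1 / (2 * pi * \<i>) * I)
      = What n x y s - w * (of_real y powr (- s - 1) * of_real x powr s)"
    unfolding I What_eq[OF s1(2)] PP using nz by (simp add: right_diff_distrib)
  then show ?thesis unfolding I_def w main_def s_def by auto
qed

lemma cmod_of_real_powr:
  assumes "x > 0" shows "cmod (of_real x powr s) = exp (Re s * ln x)"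
  using assms by (simp add: norm_powr_real_powr powr_def)

lemma Phi_eq_exp_A:
  assumes "Re \<zeta> \<ge> 0" "Im \<zeta> \<noteq> 0 \<or> Re \<zeta> > 1 \<or> \<zeta> = 0"
  shows "cmod (Phi n (pt n \<zeta>)) = exp (A n \<zeta> + real n * Re \<zeta> * lnXn n)"
  using Phi_nonzero[OF pt_not_pole[OF assms]] by (simp add: A_def)

text \<open>|Re t| is at most (r + 1) n, so replacing ln x by lnXn, with error e / n, changes |x^t|
  by a bounded factor only. The -1/2 in t accounts for exp (- lnXn / 2); the s-factor in
  \<open>Phi_y_powr_bound\<close> supplies the same power once more.\<close>

lemma x_powr_div_Phi_bound:
  assumes "Re \<zeta> \<ge> 0" "Im \<zeta> \<noteq> 0 \<or> Re \<zeta> > 1 \<or> \<zeta> = 0" and r: "Re \<zeta> \<le> r" and n: "n \<ge> 1"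
    and x: "x > 0" "\<bar>ln x - lnXn n\<bar> \<le> e / real n"
  shows "cmod (of_real x powr pt n \<zeta> / Phi n (pt n \<zeta>)) \<le> exp ((r + 1) * e - lnXn n / 2) * exp (- A n \<zeta>)"
proof -
  define d where "d = ln x - lnXn n"
  have "cmod (of_real x powr pt n \<zeta> / Phi n (pt n \<zeta>)) = exp ((real n * Re \<zeta> - 1/2) * ln x - (A n \<zeta> + real n * Re \<zeta> * lnXn n))"
    using cmod_of_real_powr[OF x(1)] Phi_eq_exp_A[OF assms(1,2)] by (simp add: norm_divide exp_diff)
  also have "(real n * Re \<zeta> - 1/2) * ln x - (A n \<zeta> + real n * Re \<zeta> * lnXn n) = (real n * Re \<zeta> - 1/2) * d - lnXn n / 2 - A n \<zeta>"
    by (simp add: d_def algebra_simps)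
  also have "\<dots> \<le> (r + 1) * e - lnXn n / 2 - A n \<zeta>"
  proof -
    have n0: "real n \<ge> 1" using n by simp
    have "real n * Re \<zeta> \<ge> 0" using assms(1) by simp
    then have "\<bar>real n * Re \<zeta> - 1/2\<bar> \<le> real n * Re \<zeta> + real n" using n0 by linarith
    also have "\<dots> \<le> (r + 1) * real n" using r n0 by (simp add: algebra_simps)
    finally have "\<bar>real n * Re \<zeta> - 1/2\<bar> * \<bar>d\<bar> \<le> ((r + 1) * real n) * (e / real n)"
      using x(2) assms(1) r by (intro mult_mono) (auto simp: d_def)
    also have "\<dots> = (r + 1) * e" using n0 by simp
    finally show ?thesis using abs_ge_self[of "(real n * Re \<zeta> - 1/2) * d"] by (simp add: abs_mult)
  qed
  finally have "cmod (of_real x powr pt n \<zeta> / Phi n (pt n \<zeta>)) \<le> exp ((r + 1) * e - lnXn n / 2 + - A n \<zeta>)"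
    by simp
  then show ?thesis by (simp only: exp_add)
qed

lemma Phi_y_powr_bound:
  assumes n: "n \<ge> 1" and u: "u \<noteq> 0" and y: "y > 0" "\<bar>ln y - lnXn n\<bar> \<le> e / real n"
  shows "cmod (Phi n (pt n (Complex a u)) * of_real y powr (- pt n (Complex a u) - 1))
    \<le> exp ((a + 1) * e - lnXn n / 2) * exp (A n (Complex a u))"
proof -
  define d where "d = ln y - lnXn n"
  have n0: "real n \<ge> 1" using n by simp
  have "cmod (Phi n (pt n (Complex a u)) * of_real y powr (- pt n (Complex a u) - 1))
     = exp (A n (Complex a u) + real n * a * lnXn n + (- (real n * a) - 1/2) * ln y)"
    using cmod_of_real_powr[OF y(1), of "- pt n (Complex a u) - 1"] Phi_eq_exp_A[of "Complex a u" n] a_pos u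
    by (simp add: norm_mult exp_add)
  also have "A n (Complex a u) + real n * a * lnXn n + (- (real n * a) - 1/2) * ln y
      = A n (Complex a u) - (real n * a + 1/2) * d - lnXn n / 2"
    by (simp add: d_def algebra_simps)
  also have "\<dots> \<le> A n (Complex a u) + (a + 1) * e - lnXn n / 2"
  proof -
    have "real n * a + 1/2 \<le> (a + 1) * real n" using n0 by (simp add: algebra_simps)
    then have "(real n * a + 1/2) * \<bar>d\<bar> \<le> ((a + 1) * real n) * (e / real n)"
      using y(2) a_pos by (intro mult_mono) (auto simp: d_def)
    also have "\<dots> = (a + 1) * e" using n0 by simp
    finally have "\<bar>(real n * a + 1/2) * d\<bar> \<le> (a + 1) * e" using a_pos by (simp add: abs_mult)
    then show ?thesis by (simp add: abs_le_iff)
  qed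
  finally show ?thesis by (simp add: exp_add[symmetric] exp_diff exp_minus field_simps)
qed

lemma Z_theta0: "Z \<theta>0 = Complex a b"
  by (simp add: complex_eq_iff a_def b_def)

lemma A_line_bound:
  obtains C N where "C > 0"
    "\<And>n u. n \<ge> N \<Longrightarrow> u \<noteq> 0 \<Longrightarrow> exp (A n (Complex a u)) \<le> C * exp (A n (Z \<theta>0)) * (1 / (1 + u\<^sup>2))"
proof -
  obtain C B N where CB: "B > 0"
    "\<And>n u. n \<ge> N \<Longrightarrow> u > 0 \<Longrightarrow> V n u \<le> V n b + C - (u - B)"
    using vertical_bound by metis
  show thesis
  proof (rule that[of "exp (C + B) * 4" N])
    fix n u assume n: "n \<ge> N" and u: "(u::real) \<noteq> 0"
    have "A n (Complex a u) = A n (Complex a \<bar>u\<bar>)"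
    proof (cases "u \<ge> 0")
      case False
      then have "Complex a u = cnj (Complex a \<bar>u\<bar>)" by (simp add: complex_eq_iff)
      then show ?thesis by (simp only: A_cnj)
    qed simp
    also have "\<dots> \<le> A n (Z \<theta>0) + C + B - \<bar>u\<bar>"
      using CB(2)[OF n, of "\<bar>u\<bar>"] u by (simp add: A_def V_def Z_theta0)
    finally have "exp (A n (Complex a u)) \<le> exp (A n (Z \<theta>0) + C + B - \<bar>u\<bar>)" by simp
    also have "\<dots> = exp (C + B) * exp (A n (Z \<theta>0)) * exp (- \<bar>u\<bar>)" by (simp add: exp_add[symmetric])
    also have "\<dots> \<le> exp (C + B) * exp (A n (Z \<theta>0)) * (4 / (1 + u\<^sup>2))"
      by (intro mult_left_mono exp_minus_abs_le) auto
    finally show "exp (A n (Complex a u)) \<le> exp (C + B) * 4 * exp (A n (Z \<theta>0)) * (1 / (1 + u\<^sup>2))" by (simp add: mult_ac)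
  qed simp
qed

text \<open>The order of the choices matters. First \<theta>2 provides a gain c2 n on the arc. Then
  \<theta>1 is taken so close to \<tau> that the closing segments, whose constant K is independent
  of the angle, lose at most half of it. From \<theta>2 to \<theta>1 the function \<open>A\<close>
  falls by at most a constant, so the gain is still there at \<theta>1.\<close>

lemma choose_contour:
  obtains \<theta>1 C c N where "\<theta>0 < \<theta>1" "\<theta>1 < \<tau>" "c > 0" "N \<ge> 1"
    "\<And>n \<theta>. n \<ge> N \<Longrightarrow> 0 \<le> \<theta> \<Longrightarrow> \<theta> \<le> \<theta>1 \<Longrightarrow> A n (Z \<theta>0) - C \<le> A n (Z \<theta>)"
    "\<And>\<theta>. 0 \<le> \<theta> \<Longrightarrow> \<theta> \<le> \<theta>1 \<Longrightarrow> \<theta> \<noteq> \<theta>0 \<Longrightarrow> \<exists>c>0. \<forall>n\<ge>N. A n (Z \<theta>0) - C + c * real n \<le> A n (Z \<theta>)"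
    "\<And>n r. n \<ge> N \<Longrightarrow> 0 \<le> r \<Longrightarrow> r \<le> 1 \<Longrightarrow> A n (Z \<theta>0) - C + c * real n \<le> A n (of_real r * Z \<theta>1)"
proof -
  define \<theta>2 where "\<theta>2 = (\<theta>0 + \<tau>) / 2"
  have t2: "\<theta>0 < \<theta>2" "\<theta>2 < \<tau>" using theta0 by (auto simp: \<theta>2_def)
  obtain C2 N2 where A2: "N2 \<ge> 1" "\<And>\<theta>. 0 \<le> \<theta> \<Longrightarrow> \<theta> \<le> \<theta>2 \<Longrightarrow> \<theta> \<noteq> \<theta>0 \<Longrightarrow> \<exists>c>0. \<forall>n\<ge>N2. A n (Z \<theta>0) - C2 + c * real n \<le> A n (Z \<theta>)"
    by (rule arc_bound[OF t2]) blast
  obtain c2 where c2: "c2 > 0" "\<And>n. n \<ge> N2 \<Longrightarrow> A n (Z \<theta>0) - C2 + c2 * real n \<le> A n (Z \<theta>2)"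
    using A2(2)[of \<theta>2] t2 theta0 by auto
  obtain K where K: "K > 0"
    "\<And>n \<theta> r. n \<ge> 1 \<Longrightarrow> \<theta>0 \<le> \<theta> \<Longrightarrow> \<theta> < \<tau> \<Longrightarrow> R \<theta> \<le> 1 \<Longrightarrow> 0 \<le> r \<Longrightarrow> r \<le> 1 \<Longrightarrow>
      A n (Z \<theta>) - real n * (K * sqrt (sqrt (R \<theta>))) \<le> A n (of_real r * Z \<theta>)"
    by (rule ray_bound) blast
  have "isCont R \<tau>" using R_has_derivative[of \<tau>] tau by (intro DERIV_isCont) auto
  then have R0: "(R \<longlongrightarrow> 0) (at_left \<tau>)"
    unfolding isCont_def R_at_tau by (rule filterlim_mono) (auto simp: at_le)
  then have lim: "((\<lambda>\<theta>. K * sqrt (sqrt (R \<theta>))) \<longlongrightarrow> K * sqrt (sqrt 0)) (at_left \<tau>)"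
    by (intro tendsto_intros)
  have "eventually (\<lambda>\<theta>. K * sqrt (sqrt (R \<theta>)) < c2 / 2) (at_left \<tau>)"
    using order_tendstoD(2)[OF lim, of "c2 / 2"] c2 by simp
  moreover have "eventually (\<lambda>\<theta>. R \<theta> < 1) (at_left \<tau>)" using order_tendstoD(2)[OF R0, of 1] by simp
  moreover have "eventually (\<lambda>\<theta>. \<theta> \<in> {\<theta>2<..<\<tau>}) (at_left \<tau>)" using t2 eventually_at_left_real by blast
  ultimately have "eventually (\<lambda>\<theta>. K * sqrt (sqrt (R \<theta>)) < c2 / 2 \<and> R \<theta> < 1 \<and> \<theta> \<in> {\<theta>2<..<\<tau>}) (at_left \<tau>)"
    by (intro eventually_conj)
  then obtain \<theta>1 where t1: "K * sqrt (sqrt (R \<theta>1)) < c2 / 2" "R \<theta>1 < 1" "\<theta>2 < \<theta>1" "\<theta>1 < \<tau>"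
    using eventually_happens[of _ "at_left \<tau>"] trivial_limit_at_left_real by fastforce
  have t1': "\<theta>0 < \<theta>1" using t1 t2 by simp
  obtain C1 N1 where A1: "C1 > 0" "N1 \<ge> 1"
    "\<And>n \<theta>. n \<ge> N1 \<Longrightarrow> 0 \<le> \<theta> \<Longrightarrow> \<theta> \<le> \<theta>1 \<Longrightarrow> A n (Z \<theta>0) - C1 \<le> A n (Z \<theta>)"
    "\<And>\<theta>. 0 \<le> \<theta> \<Longrightarrow> \<theta> \<le> \<theta>1 \<Longrightarrow> \<theta> \<noteq> \<theta>0 \<Longrightarrow> \<exists>c>0. \<forall>n\<ge>N1. A n (Z \<theta>0) - C1 + c * real n \<le> A n (Z \<theta>)"
    "\<And>n \<theta>. n \<ge> N1 \<Longrightarrow> \<theta>0 \<le> \<theta> \<Longrightarrow> \<theta> \<le> \<theta>1 \<Longrightarrow> A n (Z \<theta>) \<le> A n (Z \<theta>1) + C1"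
    by (rule arc_bound[OF t1' t1(4)]) blast
  show thesis
  proof (rule that[of \<theta>1 "c2 / 2" "max N1 N2" "C1 + \<bar>C2\<bar>"])
    fix n \<theta> assume "n \<ge> max N1 N2" "0 \<le> \<theta>" "\<theta> \<le> \<theta>1"
    then show "A n (Z \<theta>0) - (C1 + \<bar>C2\<bar>) \<le> A n (Z \<theta>)" using A1(3)[of n \<theta>] by simp
  next
    fix \<theta> assume "0 \<le> \<theta>" "\<theta> \<le> \<theta>1" "\<theta> \<noteq> \<theta>0"
    then obtain c where c: "c > 0" "\<And>n. n \<ge> N1 \<Longrightarrow> A n (Z \<theta>0) - C1 + c * real n \<le> A n (Z \<theta>)" using A1(4) by blast
    have "A n (Z \<theta>0) - (C1 + \<bar>C2\<bar>) + c * real n \<le> A n (Z \<theta>)" if "n \<ge> max N1 N2" for n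
      using c(2)[of n] that by simp
    then show "\<exists>c>0. \<forall>n\<ge>max N1 N2. A n (Z \<theta>0) - (C1 + \<bar>C2\<bar>) + c * real n \<le> A n (Z \<theta>)" using c(1) by blast
  next
    fix n and r :: real assume n: "n \<ge> max N1 N2" and r: "0 \<le> r" "r \<le> 1"
    have "A n (Z \<theta>1) - real n * (K * sqrt (sqrt (R \<theta>1))) \<le> A n (of_real r * Z \<theta>1)"
      using n A1(2) t1 t1' r by (intro K(2)) auto
    moreover have "real n * (K * sqrt (sqrt (R \<theta>1))) \<le> real n * (c2 / 2)" using t1 by (intro mult_left_mono) auto
    moreover have "A n (Z \<theta>2) \<le> A n (Z \<theta>1) + C1" using n t1 t2 by (intro A1(5)) auto
    moreover have "A n (Z \<theta>0) - C2 + c2 * real n \<le> A n (Z \<theta>2)" using n by (intro c2(2)) auto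
    moreover have "real n * (c2 / 2) = c2 * real n / 2" "c2 / 2 * real n = c2 * real n / 2" by simp_all
    ultimately show "A n (Z \<theta>0) - (C1 + \<bar>C2\<bar>) + c2 / 2 * real n \<le> A n (of_real r * Z \<theta>1)" by linarith
  qed (use t1 t1' c2 A1 in auto)
qed

text \<open>The factor of 1 / |s - t| that is singular along the arc, in the parameter of
  \<open>sarc\<close>. At the saddle points its value is 0, by division by zero.\<close>

definition wgt :: "real \<Rightarrow> real \<Rightarrow> real" where
  "wgt \<theta>1 x = indicator {0..1} x / sqrt \<bar>\<bar>\<theta>1 * (2 * x - 1)\<bar> - \<theta>0\<bar>"

lemma integrable_wgt:
  assumes "\<theta>1 > 0" shows "integrable lborel (wgt \<theta>1)"
proof -
  have "integrable lborel (\<lambda>t. indicator {-\<theta>1..\<theta>1} t :: real)" by (rule integrable_real_indicator) (auto simp: emeasure_lborel_Icc_eq)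
  then have "integrable lborel (\<lambda>t. indicator {-\<theta>1..\<theta>1} t / sqrt \<bar>\<bar>t\<bar> - \<theta>0\<bar>)"
    by (rule integrable_mult_inverse_sqrt) (use theta0 in \<open>auto simp: indicator_def\<close>)
  then have "integrable lborel (\<lambda>x. indicator {-\<theta>1..\<theta>1} (- \<theta>1 + (2 * \<theta>1) * x) / sqrt \<bar>\<bar>- \<theta>1 + (2 * \<theta>1) * x\<bar> - \<theta>0\<bar>)"
    using assms lborel_integrable_real_affine[of "\<lambda>t. indicator {-\<theta>1..\<theta>1} t / sqrt \<bar>\<bar>t\<bar> - \<theta>0\<bar>" "2 * \<theta>1" "- \<theta>1"] by simp
  moreover have "indicator {-\<theta>1..\<theta>1} (- \<theta>1 + (2 * \<theta>1) * x) / sqrt \<bar>\<bar>- \<theta>1 + (2 * \<theta>1) * x\<bar> - \<theta>0\<bar> = wgt \<theta>1 x" for x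
  proof -
    have "- \<theta>1 + (2 * \<theta>1) * x \<in> {-\<theta>1..\<theta>1} \<longleftrightarrow> x \<in> {0..1}" using assms by (auto simp: mult_le_cancel_left_pos zero_le_mult_iff)
    moreover have "- \<theta>1 + (2 * \<theta>1) * x = \<theta>1 * (2 * x - 1)" by (simp add: algebra_simps)
    ultimately show ?thesis by (auto simp: wgt_def indicator_def)
  qed
  ultimately show ?thesis by simp
qed

lemma arc_mass_tendsto_0:
  assumes t1: "\<theta>0 < \<theta>1" "\<theta>1 < \<tau>" and N: "N \<ge> 1"
    and lower: "\<And>n \<theta>. n \<ge> N \<Longrightarrow> 0 \<le> \<theta> \<Longrightarrow> \<theta> \<le> \<theta>1 \<Longrightarrow> A n (Z \<theta>0) - C \<le> A n (Z \<theta>)"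
    and gap: "\<And>\<theta>. 0 \<le> \<theta> \<Longrightarrow> \<theta> \<le> \<theta>1 \<Longrightarrow> \<theta> \<noteq> \<theta>0 \<Longrightarrow> \<exists>c>0. \<forall>n\<ge>N. A n (Z \<theta>0) - C + c * real n \<le> A n (Z \<theta>)"
  defines "m \<equiv> \<lambda>n x. exp (A n (Z \<theta>0) - A n (Z (\<theta>1 * (2 * x - 1))))"
  shows "\<And>n. n \<ge> N \<Longrightarrow> set_integrable lborel {0..1} (\<lambda>x. m n x * wgt \<theta>1 x)"
    and "(\<lambda>n. LINT x:{0..1}|lborel. m n x * wgt \<theta>1 x) \<longlonglongrightarrow> 0"
proof -
  have t0: "0 < \<theta>1" using t1 theta0 by simp
  have Aabs: "A n (Z \<theta>) = A n (Z \<bar>\<theta>\<bar>)" for n \<theta>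
    by (cases "\<theta> \<ge> 0") (auto simp: Z_minus A_cnj)
  have ang: "0 \<le> \<bar>\<theta>1 * (2 * x - 1)\<bar>" "\<bar>\<theta>1 * (2 * x - 1)\<bar> \<le> \<theta>1" if "x \<in> {0..1}" for x
    using abs_arc_angle[of \<theta>1 x] that t0 by auto
  have mb: "m n x \<le> exp C" if "n \<ge> N" "x \<in> {0..1}" for n x
    using lower[OF that(1) ang[OF that(2)]] Aabs[of n "\<theta>1 * (2 * x - 1)"] by (simp add: m_def)
  have mc: "continuous_on {0..1} (m n)" for n
  proof -
    have "continuous_on {0..1} (\<lambda>x. A n (Z (\<theta>1 * (2 * x - 1))))"
    proof (intro continuous_at_imp_continuous_on ballI)
      fix x :: real assume x: "x \<in> {0..1}"
      have tt: "\<bar>\<theta>1 * (2 * x - 1)\<bar> < \<tau>" using ang[OF x] t1 by simp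
      have "isCont (\<lambda>\<theta>. A n (Z \<theta>)) (\<theta>1 * (2 * x - 1))"
        by (rule DERIV_isCont[OF A_has_derivative[OF Z_has_vector_derivative[OF tt]]])
          (use Re_Z_pos[OF tt] Z_off_cut[OF tt] in auto)
      then show "isCont (\<lambda>x. A n (Z (\<theta>1 * (2 * x - 1)))) x"
        by (rule isCont_o2[rotated]) (intro continuous_intros)
    qed
    then show ?thesis unfolding m_def by (intro continuous_intros)
  qed
  have meas: "(\<lambda>x. indicator {0..1} x *\<^sub>R (m n x * wgt \<theta>1 x)) \<in> borel_measurable lborel" for n
  proof -
    have "(\<lambda>x. indicator {0..1} x *\<^sub>R m n x) \<in> borel_measurable borel"
      by (rule borel_measurable_continuous_on_indicator[OF _ mc]) auto
    moreover have "wgt \<theta>1 \<in> borel_measurable borel" using integrable_wgt[OF t0] by auto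
    ultimately have "(\<lambda>x. (indicator {0..1} x *\<^sub>R m n x) * wgt \<theta>1 x) \<in> borel_measurable borel" by simp
    then show ?thesis by (simp add: mult.assoc)
  qed
  have w0: "wgt \<theta>1 x \<ge> 0" for x by (simp add: wgt_def)
  have dom: "norm (indicator {0..1} x *\<^sub>R (m n x * wgt \<theta>1 x)) \<le> exp C * wgt \<theta>1 x" if "n \<ge> N" for n x
    using mb[OF that, of x] w0[of x] by (auto simp: indicator_def m_def mult_right_mono)
  have dint: "integrable lborel (\<lambda>x. exp C * wgt \<theta>1 x)" using integrable_wgt[OF t0] by simp
  show "set_integrable lborel {0..1} (\<lambda>x. m n x * wgt \<theta>1 x)" if n: "n \<ge> N" for n
    unfolding set_integrable_def
    by (rule Bochner_Integration.integrable_bound[OF dint meas]) (use dom[OF n] w0 in \<open>auto intro!: AE_I2 simp: abs_mult\<close>)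
  \<comment> \<open>The bounds hold from N on, hence the shift of the sequence.\<close>
  have "(\<lambda>n. LINT x|lborel. indicator {0..1} x *\<^sub>R (m (n + N) x * wgt \<theta>1 x)) \<longlonglongrightarrow> (LINT x::real|lborel. (0::real))"
  proof (rule integral_dominated_convergence[where w = "\<lambda>x. exp C * wgt \<theta>1 x"])
    show "(\<lambda>x. indicator {0..1} x *\<^sub>R (m (n + N) x * wgt \<theta>1 x)) \<in> borel_measurable lborel" for n by (rule meas)
    show "integrable lborel (\<lambda>x. exp C * wgt \<theta>1 x)" by (rule dint)
    show "AE x in lborel. (\<lambda>n. indicator {0..1} x *\<^sub>R (m (n + N) x * wgt \<theta>1 x)) \<longlonglongrightarrow> 0"
    proof (rule AE_I2)
      fix x :: real
      show "(\<lambda>n. indicator {0..1} x *\<^sub>R (m (n + N) x * wgt \<theta>1 x)) \<longlonglongrightarrow> 0"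
      proof (cases "x \<in> {0..1} \<and> \<bar>\<theta>1 * (2 * x - 1)\<bar> \<noteq> \<theta>0")
        case True
        then obtain c where c: "c > 0" "\<And>n. n \<ge> N \<Longrightarrow> A n (Z \<theta>0) - C + c * real n \<le> A n (Z \<bar>\<theta>1 * (2 * x - 1)\<bar>)"
          using gap[of "\<bar>\<theta>1 * (2 * x - 1)\<bar>"] ang[of x] by blast
        have "(\<lambda>n. m (n + N) x) \<longlonglongrightarrow> 0"
        proof (rule Lim_null_comparison)
          have "norm (m (n + N) x) \<le> exp (C - c * real (n + N))" for n
            using c(2)[of "n + N"] Aabs[of "n + N" "\<theta>1 * (2 * x - 1)"] by (simp add: m_def)
          then show "eventually (\<lambda>n. norm (m (n + N) x) \<le> exp (C - c * real (n + N))) sequentially" by simp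
          show "(\<lambda>n. exp (C - c * real (n + N))) \<longlonglongrightarrow> 0" using c(1) by real_asymp
        qed
        then have "(\<lambda>n. m (n + N) x * wgt \<theta>1 x) \<longlonglongrightarrow> 0" by (rule tendsto_mult_left_zero)
        then show ?thesis using True by simp
      next
        case False
        \<comment> \<open>At the saddle points \<open>wgt\<close> is 0, so convergence holds at
          every x and no null set has to be removed.\<close>
        then have "indicat_real {0..1} x = 0 \<or> wgt \<theta>1 x = 0" by (auto simp: wgt_def)
        then have "indicat_real {0..1} x *\<^sub>R (m (n + N) x * wgt \<theta>1 x) = 0" for n by auto
        then show ?thesis by (simp only: tendsto_const)
      qed
    qed
    show "AE x in lborel. norm (indicator {0..1} x *\<^sub>R (m (n + N) x * wgt \<theta>1 x)) \<le> exp C * wgt \<theta>1 x" for n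
      using dom[of "n + N"] by simp
  qed simp
  then have "(\<lambda>n. LINT x:{0..1}|lborel. m (n + N) x * wgt \<theta>1 x) \<longlonglongrightarrow> 0"
    by (simp add: set_lebesgue_integral_def)
  then show "(\<lambda>n. LINT x:{0..1}|lborel. m n x * wgt \<theta>1 x) \<longlonglongrightarrow> 0" by (rule LIMSEQ_offset)
qed

text \<open>The s-factor contributes exp (A n (Z \<theta>0)) and the t-factor its reciprocal, so
  only the two factors exp (- lnXn n / 2) remain. T n is the mass on the contour and W the weight on
  the line; neither depends on x or y, which gives uniformity for ln x and ln y within e / n of
  lnXn.\<close>

lemma error_bound:
  assumes e: "e \<ge> 0"
  obtains W T N where "integrable lborel W" "T \<longlonglongrightarrow> 0" "N \<ge> 1"
    "\<And>n x y u. n \<ge> N \<Longrightarrow> x > 0 \<Longrightarrow> y > 0 \<Longrightarrow> \<bar>ln x - lnXn n\<bar> \<le> e / real n \<Longrightarrow> \<bar>ln y - lnXn n\<bar> \<le> e / real n \<Longrightarrow>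
      u \<noteq> 0 \<Longrightarrow> \<bar>u\<bar> \<noteq> b \<Longrightarrow>
      cmod (What n x y (pt n (Complex a u)) - (if \<bar>u\<bar> < b then main n x y u else 0)) \<le> exp (- lnXn n) * T n * W u"
proof -
  obtain \<theta>1 C c N1 where cc: "\<theta>0 < \<theta>1" "\<theta>1 < \<tau>" "c > 0" "N1 \<ge> 1"
    "\<And>n \<theta>. n \<ge> N1 \<Longrightarrow> 0 \<le> \<theta> \<Longrightarrow> \<theta> \<le> \<theta>1 \<Longrightarrow> A n (Z \<theta>0) - C \<le> A n (Z \<theta>)"
    "\<And>\<theta>. 0 \<le> \<theta> \<Longrightarrow> \<theta> \<le> \<theta>1 \<Longrightarrow> \<theta> \<noteq> \<theta>0 \<Longrightarrow> \<exists>c>0. \<forall>n\<ge>N1. A n (Z \<theta>0) - C + c * real n \<le> A n (Z \<theta>)"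
    "\<And>n r. n \<ge> N1 \<Longrightarrow> 0 \<le> r \<Longrightarrow> r \<le> 1 \<Longrightarrow> A n (Z \<theta>0) - C + c * real n \<le> A n (of_real r * Z \<theta>1)"
    by (rule choose_contour) blast
  note t1 = cc(1,2)
  have t0: "0 < \<theta>1" using t1 theta0 by simp
  have ab1: "\<bar>\<theta>1\<bar> < \<tau>" using t0 t1 by simp
  obtain L N2 where L: "L > 0" "\<And>n u. n \<ge> N2 \<Longrightarrow> u \<noteq> 0 \<Longrightarrow> exp (A n (Complex a u)) \<le> L * exp (A n (Z \<theta>0)) * (1 / (1 + u\<^sup>2))"
    using A_line_bound by metis
  obtain D where D: "D > 0" "\<And>\<theta>. \<bar>\<theta>\<bar> \<le> \<theta>1 \<Longrightarrow> cmod (Z' \<theta>) \<le> D" using Z'_bounded[OF t1(2)] by blast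
  obtain Q where Q: "Q > 0"
    "\<And>u \<theta>. \<bar>u\<bar> \<noteq> b \<Longrightarrow> \<bar>\<theta>\<bar> \<le> \<theta>1 \<Longrightarrow> \<bar>\<theta>\<bar> \<noteq> \<theta>0 \<Longrightarrow>
      1 / cmod (Complex a u - Z \<theta>) \<le> Q / (sqrt \<bar>\<bar>u\<bar> - b\<bar> * sqrt \<bar>\<bar>\<theta>\<bar> - \<theta>0\<bar>)"
    "\<And>u r. \<bar>u\<bar> \<noteq> b \<Longrightarrow> 0 \<le> r \<Longrightarrow> r \<le> 1 \<Longrightarrow>
      1 / cmod (Complex a u - of_real r * Z \<theta>1) \<le> Q / sqrt \<bar>\<bar>u\<bar> - b\<bar>"
    by (rule line_arc_distance[OF t1]) blast
  define m where "m = (\<lambda>n x. exp (A n (Z \<theta>0) - A n (Z (\<theta>1 * (2 * x - 1)))))"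
  define T1 where "T1 = (\<lambda>n. LINT x:{0..1}|lborel. m n x * wgt \<theta>1 x)"
  have mi: "set_integrable lborel {0..1} (\<lambda>x. m n x * wgt \<theta>1 x)" if "n \<ge> N1" for n
    unfolding m_def by (rule arc_mass_tendsto_0(1)[OF t1 cc(4,5,6) that])
  have T1: "T1 \<longlonglongrightarrow> 0"
    unfolding T1_def m_def by (rule arc_mass_tendsto_0(2)[OF t1 cc(4,5,6)])
  define r0 where "r0 = Re (Z 0)"
  define E where "E = (r0 + 1) * e"
  define F where "F = (a + 1) * e"
  define l where "l = cmod (Z \<theta>1)"
  \<comment> \<open>A closing segment has length n l, and 1 / |s - t| contributes 1 / n. In T there
    are two segments and the arc, traversed with speed at most 2 \<theta>1 D n.\<close>
  define T2 where "T2 = (\<lambda>n. exp (C - c * real n) * l)"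
  define K where "K = exp (E + F) * L * Q"
  define T where "T = (\<lambda>n. K * (2 * T2 n + 2 * \<theta>1 * D * T1 n))"
  define W where "W = (\<lambda>u. 1 / (1 + u\<^sup>2) / sqrt \<bar>\<bar>u\<bar> - b\<bar>)"
  have W: "integrable lborel W" unfolding W_def
    by (rule integrable_mult_inverse_sqrt[OF integrable_inverse_1_plus_sq]) (use b_pos in \<open>auto simp: add_pos_nonneg divide_le_eq\<close>)
  have T2: "T2 \<longlonglongrightarrow> 0" unfolding T2_def using cc(3) by real_asymp
  have "T \<longlonglongrightarrow> K * (2 * 0 + 2 * \<theta>1 * D * 0)" unfolding T_def by (intro tendsto_intros T1 T2)
  then have T: "T \<longlonglongrightarrow> 0" by simp
  show thesis
  proof (rule that[of W T "max N1 N2"])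
    fix n x y u
    assume n: "n \<ge> max N1 N2" and x: "x > 0" "\<bar>ln x - lnXn n\<bar> \<le> e / real n" and y: "y > 0" "\<bar>ln y - lnXn n\<bar> \<le> e / real n"
      and u: "u \<noteq> 0" "\<bar>u\<bar> \<noteq> b"
    have n1: "n \<ge> 1" and n0: "real n > 0" using n cc(4) by auto
    define s where "s = pt n (Complex a u)"
    define f where "f = (\<lambda>t. of_real x powr t / Phi n t / (s - t))"
    define X where "X = exp (E - lnXn n / 2) * exp (- A n (Z \<theta>0))"
    define v where "v = sqrt \<bar>\<bar>u\<bar> - b\<bar>"
    have v: "v > 0" using u by (simp add: v_def)
    have spt: "cmod (s - pt n \<zeta>) = real n * cmod (Complex a u - \<zeta>)" for \<zeta>
    proof -
      have "s - pt n \<zeta> = of_nat n * (Complex a u - \<zeta>)" by (simp add: s_def pt_def algebra_simps)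
      then show ?thesis by (simp add: norm_mult)
    qed
    have ReZ: "Re (Z \<theta>) \<le> r0" if "\<bar>\<theta>\<bar> < \<tau>" for \<theta>
    proof -
      have "Re (Z \<theta>) = Re (Z \<bar>\<theta>\<bar>)" by (cases "\<theta> \<ge> 0") (auto simp: Re_Z)
      then show ?thesis using Re_Z_strict_antimono[of 0 "\<bar>\<theta>\<bar>"] that unfolding r0_def by (cases "\<theta> = 0") auto
    qed
    have fb: "cmod (f (pt n \<zeta>)) \<le> X * exp (A n (Z \<theta>0) - A n \<zeta>) * (1 / real n) * (1 / cmod (Complex a u - \<zeta>))"
      if z: "Re \<zeta> \<ge> 0" "Im \<zeta> \<noteq> 0 \<or> Re \<zeta> > 1 \<or> \<zeta> = 0" "Re \<zeta> \<le> r0" for \<zeta>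
    proof -
      have "cmod (f (pt n \<zeta>)) = cmod (of_real x powr pt n \<zeta> / Phi n (pt n \<zeta>)) * (1 / (real n * cmod (Complex a u - \<zeta>)))"
        unfolding f_def norm_divide[of _ "s - _"] spt by simp
      also have "\<dots> \<le> (exp ((r0 + 1) * e - lnXn n / 2) * exp (- A n \<zeta>)) * (1 / (real n * cmod (Complex a u - \<zeta>)))"
        by (intro mult_right_mono x_powr_div_Phi_bound[OF z n1 x]) auto
      also have "exp ((r0 + 1) * e - lnXn n / 2) * exp (- A n \<zeta>) = X * exp (A n (Z \<theta>0) - A n \<zeta>)"
        by (simp add: X_def E_def exp_add[symmetric] mult.assoc)
      finally show ?thesis by simp
    qed
    have ray: "cmod (f (pt n \<zeta>)) \<le> X * Q / v * exp (C - c * real n) * (1 / real n)"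
      if r: "0 \<le> r" "r \<le> 1" and z: "\<zeta> = of_real r * Z \<theta>1 \<or> \<zeta> = of_real r * cnj (Z \<theta>1)" for \<zeta> r
    proof -
      have I1: "Im (Z \<theta>1) > 0" "Re (Z \<theta>1) > 0" using Im_Z_pos[OF t0 t1(2)] Re_Z_pos[OF ab1] by auto
      have "r * Re (Z \<theta>1) \<le> Re (Z \<theta>1)" using r I1 by (intro mult_left_le_one_le) auto
      then have z3: "Re \<zeta> \<le> r0" using ReZ[OF ab1] z by auto
      have z12: "Re \<zeta> \<ge> 0" "Im \<zeta> \<noteq> 0 \<or> Re \<zeta> > 1 \<or> \<zeta> = 0" using z r I1 by auto
      have AA: "A n \<zeta> = A n (of_real r * Z \<theta>1)" using z A_cnj[of n "of_real r * Z \<theta>1"] by auto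
      have a1: "exp (A n (Z \<theta>0) - A n \<zeta>) \<le> exp (C - c * real n)"
        unfolding AA using cc(7)[of n r] n r by simp
      have d1: "1 / cmod (Complex a u - \<zeta>) \<le> Q / v"
        using z
      proof
        assume "\<zeta> = of_real r * Z \<theta>1"
        then show ?thesis using Q(3)[OF u(2) r] by (simp add: v_def)
      next
        \<comment> \<open>The lower segment is reflected into the upper one; u becomes -u, which
          leaves |u| unchanged.\<close>
        assume zz: "\<zeta> = of_real r * cnj (Z \<theta>1)"
        have "Complex a u - \<zeta> = cnj (Complex a (- u) - of_real r * Z \<theta>1)" unfolding zz by (simp add: complex_eq_iff)
        then have "cmod (Complex a u - \<zeta>) = cmod (Complex a (- u) - of_real r * Z \<theta>1)" by (simp only: complex_mod_cnj)
        then show ?thesis using Q(3)[of "- u" r] u(2) r by (simp add: v_def)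
      qed
      have "cmod (f (pt n \<zeta>)) \<le> X * exp (A n (Z \<theta>0) - A n \<zeta>) * (1 / real n) * (1 / cmod (Complex a u - \<zeta>))"
        by (rule fb[OF z12 z3])
      also have "\<dots> \<le> X * exp (C - c * real n) * (1 / real n) * (Q / v)"
        by (intro mult_mono a1 d1 order_refl) (auto simp: X_def)
      finally show ?thesis by (simp add: mult_ac)
    qed
    have ps: "s \<notin> path_image (gam n \<theta>1)" unfolding s_def by (rule gam_avoids(1)[OF t1 n1 u(2)])
    have ints: "f contour_integrable_on g" if "valid_path g" "path_image g \<subseteq> path_image (gam n \<theta>1)" for g
    proof (rule contour_integrable_holomorphic_simple[where S = "{z. Re z > -1} - insert s (of_nat ` {..<n})"])
      show "open ({z. Re z > -1} - insert s (of_nat ` {..<n}))"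
        by (intro open_Diff open_halfspace_Re_gt finite_imp_closed) auto
      have "(Phi n) field_differentiable at t" if "Re t > -1" "t \<notin> of_nat ` {..<n}" for t
        using Phi_has_derivative[OF that] field_differentiable_def by blast
      then have "Phi n holomorphic_on {z. Re z > -1} - insert s (of_nat ` {..<n})"
        by (auto simp: holomorphic_on_def intro: field_differentiable_at_within)
      then show "f holomorphic_on {z. Re z > -1} - insert s (of_nat ` {..<n})"
        unfolding f_def using x(1) Phi_nonzero by (intro holomorphic_intros) auto
      show "path_image g \<subseteq> {z. Re z > -1} - insert s (of_nat ` {..<n})"
        using that(2) gam_subset[OF t1] ps by blast
    qed (use that in auto)
    let ?l1 = "linepath (-1/2) (pt n (cnj (Z \<theta>1)))" and ?l2 = "linepath (pt n (Z \<theta>1)) (-1/2)"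
    have sub: "path_image ?l1 \<subseteq> path_image (gam n \<theta>1)" "path_image (sarc n \<theta>1) \<subseteq> path_image (gam n \<theta>1)"
      "path_image ?l2 \<subseteq> path_image (gam n \<theta>1)"
      unfolding path_image_gam[OF t0] by (auto simp: closed_segment_commute)
    have i1: "f contour_integrable_on ?l1" and i2: "f contour_integrable_on sarc n \<theta>1" and i3: "f contour_integrable_on ?l2"
      by (rule ints, simp, rule sub) (rule ints[OF valid_path_arc[OF t0 t1(2)] sub(2)], rule ints, simp, rule sub)
    have split: "contour_integral (gam n \<theta>1) f = contour_integral ?l1 f + (contour_integral (sarc n \<theta>1) f + contour_integral ?l2 f)"
    proof -
      note va = valid_path_arc[OF t0 t1(2), of n]
      have ij: "f contour_integrable_on (sarc n \<theta>1 +++ ?l2)"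
        by (rule contour_integrable_joinI[OF i2 i3 va valid_path_linepath])
      have vj: "valid_path (sarc n \<theta>1 +++ ?l2)"
        by (rule valid_path_join[OF va valid_path_linepath]) (simp add: arc_ends)
      show ?thesis unfolding gam_def contour_integral_join[OF i1 ij valid_path_linepath vj]
        contour_integral_join[OF i2 i3 va valid_path_linepath] ..
    qed
    define B where "B = X * Q / v * exp (C - c * real n) * (1 / real n)"
    have B0: "B \<ge> 0" using Q(1) v by (simp add: B_def X_def)
    have len: "cmod (pt n w - (-1/2)) = real n * cmod w" "cmod ((-1/2) - pt n w) = real n * cmod w" for w
    proof -
      have "pt n w - (-1/2) = of_nat n * w" by (simp add: pt_def)
      then show "cmod (pt n w - (-1/2)) = real n * cmod w" by (simp add: norm_mult)
      then show "cmod ((-1/2) - pt n w) = real n * cmod w" by (simp only: norm_minus_commute)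
    qed
    have Bl: "B * (real n * l) = X * Q / v * T2 n" using n0 by (simp add: B_def T2_def)
    have b1: "cmod (contour_integral ?l1 f) \<le> X * Q / v * T2 n"
    proof -
      have "cmod (contour_integral ?l1 f) \<le> B * cmod (pt n (cnj (Z \<theta>1)) - (-1/2))"
      proof (rule contour_integral_bound_linepath[OF i1 B0])
        fix t assume "t \<in> closed_segment (-1/2) (pt n (cnj (Z \<theta>1)))"
        then obtain r where "0 \<le> r" "r \<le> 1" "t = pt n (of_real r * cnj (Z \<theta>1))" using segment_pt by blast
        then show "cmod (f t) \<le> B" unfolding B_def using ray[of r "of_real r * cnj (Z \<theta>1)"] by simp
      qed
      then show ?thesis unfolding len using Bl by (simp add: l_def)
    qed
    have b3: "cmod (contour_integral ?l2 f) \<le> X * Q / v * T2 n"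
    proof -
      have "cmod (contour_integral ?l2 f) \<le> B * cmod ((-1/2) - pt n (Z \<theta>1))"
      proof (rule contour_integral_bound_linepath[OF i3 B0])
        fix t assume "t \<in> closed_segment (pt n (Z \<theta>1)) (-1/2)"
        then have "t \<in> closed_segment (-1/2) (pt n (Z \<theta>1))" by (simp only: closed_segment_commute)
        then obtain r where "0 \<le> r" "r \<le> 1" "t = pt n (of_real r * Z \<theta>1)" using segment_pt by blast
        then show "cmod (f t) \<le> B" unfolding B_def using ray[of r "of_real r * Z \<theta>1"] by simp
      qed
      then show ?thesis unfolding len using Bl by (simp add: l_def)
    qed
    have b2: "cmod (contour_integral (sarc n \<theta>1) f) \<le> X * Q / v * (2 * \<theta>1 * D * T1 n)"
    proof -
      let ?th = "\<lambda>x. \<theta>1 * (2 * x - 1)"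
      let ?g = "\<lambda>x. f (sarc n \<theta>1 x) * (of_real (real n * (2 * \<theta>1)) * Z' (?th x))"
      let ?S = "{x. \<bar>?th x\<bar> = \<theta>0}"
      have fin: "finite ?S"
      proof (rule finite_subset)
        show "?S \<subseteq> {(\<theta>0 / \<theta>1 + 1) / 2, (- \<theta>0 / \<theta>1 + 1) / 2}"
        proof
          fix x assume "x \<in> ?S"
          then have "\<theta>1 * (2 * x - 1) = \<theta>0 \<or> \<theta>1 * (2 * x - 1) = - \<theta>0" by auto
          then have "2 * x - 1 = \<theta>0 / \<theta>1 \<or> 2 * x - 1 = - \<theta>0 / \<theta>1" using t0 by (auto simp: field_simps)
          then show "x \<in> {(\<theta>0 / \<theta>1 + 1) / 2, (- \<theta>0 / \<theta>1 + 1) / 2}" by auto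
        qed
      qed simp
      have "(f has_contour_integral contour_integral (sarc n \<theta>1) f) (sarc n \<theta>1)"
        by (rule has_contour_integral_integral[OF i2])
      then have "((\<lambda>x. f (sarc n \<theta>1 x) * vector_derivative (sarc n \<theta>1) (at x)) has_integral contour_integral (sarc n \<theta>1) f) {0..1}"
        by (simp add: has_contour_integral)
      then have hg: "((\<lambda>x. if x \<in> ?S then 0 else ?g x) has_integral contour_integral (sarc n \<theta>1) f) {0..1}"
        by (rule has_integral_spike_finite[OF fin, rotated])
          (use vector_derivative_at[OF arc_has_vector_derivative[OF t0 t1(2)]] in auto)
      have hT: "(\<lambda>x. m n x * wgt \<theta>1 x) integrable_on {0..1}" "integral {0..1} (\<lambda>x. m n x * wgt \<theta>1 x) = T1 n"
        using set_borel_integral_eq_integral[OF mi[of n]] n by (auto simp: T1_def)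
      have "norm (integral {0..1} (\<lambda>x. if x \<in> ?S then 0 else ?g x))
          \<le> integral {0..1} (\<lambda>x. X * Q / v * (2 * \<theta>1 * D) * (m n x * wgt \<theta>1 x))"
      proof (rule integral_norm_bound_integral)
        show "(\<lambda>x. if x \<in> ?S then 0 else ?g x) integrable_on {0..1}" using hg by blast
        show "(\<lambda>x. X * Q / v * (2 * \<theta>1 * D) * (m n x * wgt \<theta>1 x)) integrable_on {0..1}"
          by (rule integrable_on_cmult_left[OF hT(1), unfolded of_real_eq_id id_def])
        fix x :: real assume x01: "x \<in> {0..1}"
        have th: "\<bar>?th x\<bar> \<le> \<theta>1" "\<bar>?th x\<bar> < \<tau>" using abs_arc_angle[of \<theta>1 x] x01 t0 t1 by auto
        have X0: "X \<ge> 0" by (simp add: X_def)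
        show "norm (if x \<in> ?S then 0 else ?g x) \<le> X * Q / v * (2 * \<theta>1 * D) * (m n x * wgt \<theta>1 x)"
        proof (cases "x \<in> ?S")
          case True
          then show ?thesis using X0 Q(1) v t0 D(1) by (simp add: m_def wgt_def)
        next
          case False
          have "cmod (f (sarc n \<theta>1 x)) \<le> X * m n x * (1 / real n) * (1 / cmod (Complex a u - Z (?th x)))"
            unfolding sarc_def m_def
            by (rule fb) (use Re_Z_pos[OF th(2)] Z_off_cut[OF th(2)] ReZ[OF th(2)] in auto)
          also have "\<dots> \<le> X * m n x * (1 / real n) * (Q / (v * sqrt \<bar>\<bar>?th x\<bar> - \<theta>0\<bar>))"
            using Q(2)[OF u(2) th(1)] False X0 by (intro mult_left_mono) (auto simp: v_def m_def)
          finally have 1: "cmod (f (sarc n \<theta>1 x)) \<le> X * m n x * (1 / real n) * (Q / (v * sqrt \<bar>\<bar>?th x\<bar> - \<theta>0\<bar>))" .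
          have "norm (?g x) = cmod (f (sarc n \<theta>1 x)) * (real n * (2 * \<theta>1) * cmod (Z' (?th x)))"
            using t0 by (simp add: norm_mult)
          also have "\<dots> \<le> (X * m n x * (1 / real n) * (Q / (v * sqrt \<bar>\<bar>?th x\<bar> - \<theta>0\<bar>))) * (real n * (2 * \<theta>1) * D)"
            using 1 D(2)[OF th(1)] t0 X0 Q(1) v by (intro mult_mono mult_left_mono) (auto simp: m_def)
          also have "\<dots> = X * Q / v * (2 * \<theta>1 * D) * (m n x * wgt \<theta>1 x)"
            using n0 x01 by (simp add: wgt_def)
          finally show ?thesis using False by simp
        qed
      qed
      also have "\<dots> = X * Q / v * (2 * \<theta>1 * D) * T1 n" using hT(2) by simp
      finally show ?thesis using integral_unique[OF hg] by (simp add: mult.assoc)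
    qed
    have tot: "cmod (contour_integral (gam n \<theta>1) f) \<le> X * Q / v * (2 * T2 n + 2 * \<theta>1 * D * T1 n)"
    proof -
      have "cmod (contour_integral (gam n \<theta>1) f) \<le> cmod (contour_integral ?l1 f) + (cmod (contour_integral (sarc n \<theta>1) f) + cmod (contour_integral ?l2 f))"
        unfolding split using norm_triangle_le norm_triangle_ineq add_left_mono order_trans by blast
      also have "\<dots> \<le> X * Q / v * T2 n + (X * Q / v * (2 * \<theta>1 * D * T1 n) + X * Q / v * T2 n)"
        by (intro add_mono b1 b2 b3)
      also have "\<dots> = X * Q / v * (2 * T2 n + 2 * \<theta>1 * D * T1 n)" 
      proof -
        have "k * p + (k * q + k * p) = k * (2 * p + q)" for k p q :: real by (simp add: algebra_simps)
        then show ?thesis by blast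
      qed
      finally show ?thesis .
    qed
    have pre: "cmod (Phi n s * of_real y powr (- s - 1)) \<le> exp (F - lnXn n / 2) * (L * exp (A n (Z \<theta>0)) * (1 / (1 + u\<^sup>2)))"
    proof -
      have "cmod (Phi n s * of_real y powr (- s - 1)) \<le> exp (F - lnXn n / 2) * exp (A n (Complex a u))"
        unfolding s_def F_def by (rule Phi_y_powr_bound[OF n1 u(1) y])
      also have "\<dots> \<le> exp (F - lnXn n / 2) * (L * exp (A n (Z \<theta>0)) * (1 / (1 + u\<^sup>2)))"
        using L(2)[of n u] n u(1) by (intro mult_left_mono) auto
      finally show ?thesis .
    qed
    have tp: "cmod (1 / (2 * pi * \<i>) * contour_integral (gam n \<theta>1) f) \<le> X * Q / v * (2 * T2 n + 2 * \<theta>1 * D * T1 n)"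
    proof -
      have "cmod (1 / (2 * pi * \<i>)) \<le> 1" using pi_ge_two by (simp add: norm_divide norm_mult)
      then have "cmod (1 / (2 * pi * \<i>) * contour_integral (gam n \<theta>1) f) \<le> 1 * cmod (contour_integral (gam n \<theta>1) f)"
        unfolding norm_mult by (intro mult_right_mono) auto
      then show ?thesis using tot by simp
    qed
    have "cmod (What n x y s - (if \<bar>u\<bar> < b then main n x y u else 0))
      = cmod (Phi n s * of_real y powr (- s - 1)) * cmod (1 / (2 * pi * \<i>) * contour_integral (gam n \<theta>1) f)"
      unfolding What_split[OF t1 n1 x(1) u, folded s_def] f_def norm_mult ..
    also have "\<dots> \<le> (exp (F - lnXn n / 2) * (L * exp (A n (Z \<theta>0)) * (1 / (1 + u\<^sup>2)))) * (X * Q / v * (2 * T2 n + 2 * \<theta>1 * D * T1 n))"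
      using L(1) by (intro mult_mono pre tp) auto
    also have "\<dots> = exp (- lnXn n) * T n * W u"
    proof -
      have "exp (F - lnXn n / 2) * exp (A n (Z \<theta>0)) * X = exp (- lnXn n) * exp (E + F)"
        by (simp add: X_def exp_add[symmetric])
      moreover have "p * (L * q * g) * (X * Q / v * z) = (p * q * X) * (L * Q * z) * (g / v)" for p q g z :: real
        by (simp add: mult_ac)
      ultimately show ?thesis unfolding T_def W_def K_def v_def[symmetric] by (simp add: mult_ac)
    qed
    finally show "cmod (What n x y (pt n (Complex a u)) - (if \<bar>u\<bar> < b then main n x y u else 0)) \<le> exp (- lnXn n) * T n * W u"
      by (simp add: s_def)
  qed (use W T cc(4) in auto)
qed

end

subsection \<open>The limit\<close>

definition sincard :: "real \<Rightarrow> real" where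
  "sincard x = (if x = 0 then 1 else sin x / x)"

lemma continuous_on_sincard [continuous_intros]:
  assumes "continuous_on S f" shows "continuous_on S (\<lambda>x. sincard (f x))"
proof -
  have "continuous_on UNIV sincard"
    unfolding continuous_on_eq_continuous_at[OF open_UNIV] using isCont_sinc by (simp add: sincard_def[abs_def])
  then show ?thesis by (rule continuous_on_compose2[OF _ assms]) simp
qed

context kernel_setting
begin

lemma main_eq:
  assumes "x > 0" "y > 0"
  shows "main n x y u = of_real (exp ((real n * a - 1/2) * (ln x - ln y)) / y) * exp (\<i> * of_real (u * (real n * (ln x - ln y))))"
proof -
  have p: "of_real t powr s = exp (s * of_real (ln t))" if "t > 0" for t :: real and s :: complex
    using that by (simp add: powr_def Ln_of_real)
  have s: "pt n (Complex a u) = of_real (real n * a - 1/2) + \<i> * of_real (real n * u)"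
    by (simp add: complex_eq_iff)
  have "main n x y u = exp ((- pt n (Complex a u) - 1) * of_real (ln y) + pt n (Complex a u) * of_real (ln x))"
    unfolding main_def p[OF assms(1)] p[OF assms(2)] by (simp add: exp_add)
  also have "(- pt n (Complex a u) - 1) * of_real (ln y) + pt n (Complex a u) * of_real (ln x)
      = of_real ((real n * a - 1/2) * (ln x - ln y) - ln y) + \<i> * of_real (u * (real n * (ln x - ln y)))"
    unfolding s by (simp add: field_simps)
  also have "exp \<dots> = of_real (exp ((real n * a - 1/2) * (ln x - ln y) - ln y)) * exp (\<i> * of_real (u * (real n * (ln x - ln y))))"
    unfolding exp_add exp_of_real ..
  also have "exp ((real n * a - 1/2) * (ln x - ln y) - ln y) = exp ((real n * a - 1/2) * (ln x - ln y)) / y"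
    using assms by (simp add: exp_diff)
  finally show ?thesis .
qed

lemma integral_exp_segment:
  shows "integrable lborel (\<lambda>u. indicator {-b..b} u *\<^sub>R exp (\<i> * of_real (u * L)))"
    and "(LBINT u. indicator {-b..b} u *\<^sub>R exp (\<i> * of_real (u * L))) = of_real (2 * b * sincard (b * L))"
proof -
  have c: "continuous_on {-b..b} (\<lambda>u. exp (\<i> * of_real (u * L)))" by (intro continuous_intros)
  show "integrable lborel (\<lambda>u. indicator {-b..b} u *\<^sub>R exp (\<i> * of_real (u * L)))"
    using borel_integrable_compact[OF compact_Icc c] by (simp add: indicator_scaleR_eq_if)
  show "(LBINT u. indicator {-b..b} u *\<^sub>R exp (\<i> * of_real (u * L))) = of_real (2 * b * sincard (b * L))"
  proof (cases "L = 0")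
    case True
    have "(LBINT u. indicator {-b..b} u *\<^sub>R exp (\<i> * of_real (u * L))) = of_real b - of_real (- b)"
    proof (rule integral_FTC_Icc)
      show "((\<lambda>u. complex_of_real u) has_vector_derivative exp (\<i> * of_real (u * L))) (at u within {-b..b})" for u
        using True by (auto intro!: derivative_eq_intros)
    qed (use b_pos c in auto)
    then show ?thesis using True by (simp add: sincard_def)
  next
    case False
    let ?F = "\<lambda>u. exp (\<i> * of_real (u * L)) / (\<i> * of_real L)"
    have "(LBINT u. indicator {-b..b} u *\<^sub>R exp (\<i> * of_real (u * L))) = ?F b - ?F (- b)"
    proof (rule integral_FTC_Icc)
      fix u
      have "((\<lambda>z. exp (\<i> * (z * of_real L)) / (\<i> * of_real L)) has_field_derivative exp (\<i> * (of_real u * of_real L))) (at (of_real u))"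
        using False by (auto intro!: derivative_eq_intros simp: mult_ac)
      then have "((\<lambda>u. exp (\<i> * (of_real u * of_real L)) / (\<i> * of_real L)) has_vector_derivative exp (\<i> * (of_real u * of_real L))) (at u within {-b..b})"
        by (rule has_vector_derivative_real_field)
      then show "(?F has_vector_derivative exp (\<i> * of_real (u * L))) (at u within {-b..b})" by simp
    qed (use b_pos c in auto)
    also have "\<dots> = (cis (b * L) - cis (- (b * L))) / (\<i> * of_real L)"
      by (simp add: cis_conv_exp diff_divide_distrib)
    also have "cis (b * L) - cis (- (b * L)) = of_real (2 * sin (b * L)) * \<i>" by (simp add: complex_eq_iff)
    also have "\<dots> / (\<i> * of_real L) = of_real (2 * sin (b * L) / L)" using False by simp
    also have "2 * sin (b * L) / L = 2 * b * sincard (b * L)" using False b_pos by (simp add: sincard_def)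
    finally show ?thesis .
  qed
qed

lemma integral_main:
  assumes "x > 0" "y > 0"
  defines "\<delta> \<equiv> ln x - ln y"
  shows "integrable lborel (\<lambda>u. if \<bar>u\<bar> < b then main n x y u else 0)"
    and "(LBINT u. if \<bar>u\<bar> < b then main n x y u else 0)
      = of_real (exp ((real n * a - 1/2) * \<delta>) / y * (2 * b * sincard (b * (real n * \<delta>))))"
proof -
  let ?c = "complex_of_real (exp ((real n * a - 1/2) * \<delta>) / y)"
  let ?g = "\<lambda>u. ?c * (indicator {-b..b} u *\<^sub>R exp (\<i> * of_real (u * (real n * \<delta>))))"
  have g: "integrable lborel ?g" by (intro integrable_mult_right integral_exp_segment)
  have ae: "AE u in lborel. ?g u = (if \<bar>u\<bar> < b then main n x y u else 0)"
  proof (rule AE_I'[of "{-b, b}"])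
    show "{-b, b} \<in> null_sets lborel" by (rule finite_imp_null_set_lborel) simp
    show "{u \<in> space lborel. ?g u \<noteq> (if \<bar>u\<bar> < b then main n x y u else 0)} \<subseteq> {-b, b}"
      using main_eq[OF assms(1,2)] by (auto simp: indicator_def \<delta>_def abs_less_iff split: if_splits)
  qed
  have m: "(\<lambda>u. if \<bar>u\<bar> < b then main n x y u else 0) \<in> borel_measurable lborel"
  proof -
    have e: "(if \<bar>u\<bar> < b then main n x y u else 0) = indicator {-b<..<b} u *\<^sub>R (?c * exp (\<i> * of_real (u * (real n * \<delta>))))" for u
      using main_eq[OF assms(1,2)] by (auto simp: indicator_def \<delta>_def abs_less_iff)
    have "continuous_on UNIV (\<lambda>u. ?c * exp (\<i> * of_real (u * (real n * \<delta>))))" by (intro continuous_intros)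
    then have "(\<lambda>u. ?c * exp (\<i> * of_real (u * (real n * \<delta>)))) \<in> borel_measurable borel"
      by (rule borel_measurable_continuous_onI)
    then show ?thesis unfolding e by simp
  qed
  show "integrable lborel (\<lambda>u. if \<bar>u\<bar> < b then main n x y u else 0)"
    by (rule integrable_cong_AE_imp[OF g m ae])
  have "(LBINT u. if \<bar>u\<bar> < b then main n x y u else 0) = (LBINT u. ?g u)"
    by (rule integral_cong_AE[symmetric]) (use g m ae in auto)
  also have "\<dots> = ?c * of_real (2 * b * sincard (b * (real n * \<delta>)))"
    by (subst integral_mult_right_zero) (simp only: integral_exp_segment(2))
  finally show "(LBINT u. if \<bar>u\<bar> < b then main n x y u else 0)
      = of_real (exp ((real n * a - 1/2) * \<delta>) / y * (2 * b * sincard (b * (real n * \<delta>))))"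
    by (simp only: of_real_mult)
qed

lemma kernel_estimate:
  assumes e: "e \<ge> 0" and nu0: "\<nu> 0 = 0"
  obtains T N where "T \<longlonglongrightarrow> 0" "N \<ge> 1"
    "\<And>n \<Sigma> x y. n \<ge> N \<Longrightarrow> encircling_contour n \<Sigma> \<Longrightarrow> x > 0 \<Longrightarrow> y > 0 \<Longrightarrow>
      \<bar>ln x - lnXn n\<bar> \<le> e / real n \<Longrightarrow> \<bar>ln y - lnXn n\<bar> \<le> e / real n \<Longrightarrow>
      cmod (corr_kernel M \<nu> \<kappa> n \<Sigma> x y - of_real (real n / (2 * pi) *
        (exp ((real n * a - 1/2) * (ln x - ln y)) / y * (2 * b * sincard (b * (real n * (ln x - ln y))))))) \<le> real n * exp (- lnXn n) * T n"
proof -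
  obtain W T N where W: "integrable lborel W" "T \<longlonglongrightarrow> 0" "N \<ge> 1"
    "\<And>n x y u. n \<ge> N \<Longrightarrow> x > 0 \<Longrightarrow> y > 0 \<Longrightarrow> \<bar>ln x - lnXn n\<bar> \<le> e / real n \<Longrightarrow> \<bar>ln y - lnXn n\<bar> \<le> e / real n \<Longrightarrow>
      u \<noteq> 0 \<Longrightarrow> \<bar>u\<bar> \<noteq> b \<Longrightarrow>
      cmod (What n x y (pt n (Complex a u)) - (if \<bar>u\<bar> < b then main n x y u else 0)) \<le> exp (- lnXn n) * T n * W u"
    by (rule error_bound[OF e]) blast
  define T' where "T' = (\<lambda>n. 1 / (2 * pi) * (T n * (LBINT u. W u)))"
  have "T' \<longlonglongrightarrow> 1 / (2 * pi) * (0 * (LBINT u. W u))" unfolding T'_def by (intro tendsto_intros W)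
  then have T': "T' \<longlonglongrightarrow> 0" by simp
  show thesis
  proof (rule that[OF T' W(3)])
    fix n \<Sigma> x y
    assume n: "n \<ge> N" and ec: "encircling_contour n \<Sigma>" and xy: "x > 0" "y > 0"
      and l: "\<bar>ln x - lnXn n\<bar> \<le> e / real n" "\<bar>ln y - lnXn n\<bar> \<le> e / real n"
    let ?w = "\<lambda>u. What n x y (pt n (Complex a u))" and ?m = "\<lambda>u. if \<bar>u\<bar> < b then main n x y u else 0"
    let ?J = "exp ((real n * a - 1/2) * (ln x - ln y)) / y * (2 * b * sincard (b * (real n * (ln x - ln y))))"
    have n1: "n \<ge> 1" using n W(3) by simp
    have r0: "0 \<le> real n / (2 * pi)" by simp
    note k = corr_kernel_shifted[OF n1 ec xy nu0]
    note mm = integral_main[OF xy, of n]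
    have d: "integrable lborel (\<lambda>u. ?w u - ?m u)" by (intro Bochner_Integration.integrable_diff k(1) mm(1))
    have "corr_kernel M \<nu> \<kappa> n \<Sigma> x y - of_real (real n / (2 * pi) * ?J) = of_real (real n / (2 * pi)) * (LBINT u. ?w u - ?m u)"
      unfolding k(2) Bochner_Integration.integral_diff[OF k(1) mm(1)] mm(2) by (simp only: of_real_mult right_diff_distrib)
    then have E: "cmod (corr_kernel M \<nu> \<kappa> n \<Sigma> x y - of_real (real n / (2 * pi) * ?J)) = real n / (2 * pi) * cmod (LBINT u. ?w u - ?m u)"
      by (simp only: norm_mult norm_of_real abs_of_nonneg[OF r0])
    have "cmod (LBINT u. ?w u - ?m u) \<le> (LBINT u. exp (- lnXn n) * T n * W u)"
    proof (rule order_trans[OF integral_norm_bound])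
      show "(LBINT u. cmod (?w u - ?m u)) \<le> (LBINT u. exp (- lnXn n) * T n * W u)"
      proof (rule integral_mono_AE)
        show "integrable lborel (\<lambda>u. cmod (?w u - ?m u))" using d by (rule integrable_norm)
        show "integrable lborel (\<lambda>u. exp (- lnXn n) * T n * W u)" using W(1) by simp
        \<comment> \<open>At u = 0 the line may meet a zero of \<open>Phi\<close>, and at u = b and
          u = -b it meets the contour; three points form a null set.\<close>
        show "AE u in lborel. cmod (?w u - ?m u) \<le> exp (- lnXn n) * T n * W u"
        proof (rule AE_I'[of "{-b, 0, b}"])
          show "{-b, 0, b} \<in> null_sets lborel" by (rule finite_imp_null_set_lborel) simp
          show "{u \<in> space lborel. \<not> cmod (?w u - ?m u) \<le> exp (- lnXn n) * T n * W u} \<subseteq> {-b, 0, b}"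
            using W(4)[OF n xy l] by (smt (verit) insert_iff mem_Collect_eq subsetI)
        qed
      qed
    qed
    also have "\<dots> = exp (- lnXn n) * T n * (LBINT u. W u)" by simp
    finally have "cmod (corr_kernel M \<nu> \<kappa> n \<Sigma> x y - of_real (real n / (2 * pi) * ?J))
        \<le> real n / (2 * pi) * (exp (- lnXn n) * T n * (LBINT u. W u))" unfolding E using r0 by (rule mult_left_mono)
    also have "\<dots> = real n * exp (- lnXn n) * T' n" by (simp add: T'_def)
    finally show "cmod (corr_kernel M \<nu> \<kappa> n \<Sigma> x y - of_real (real n / (2 * pi) * ?J)) \<le> real n * exp (- lnXn n) * T' n" .
  qed
qed

end

section \<open>Uniform convergence of the main term\<close>

lemma abs_ln_one_plus_le:
  assumes "\<bar>t\<bar> \<le> 1/2" shows "\<bar>ln (1 + t)\<bar> \<le> 2 * \<bar>t::real\<bar>"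
proof -
  have "\<bar>t\<bar> * \<bar>t\<bar> \<le> \<bar>t\<bar> * (1/2)" using assms by (intro mult_left_mono) auto
  then have "2 * t\<^sup>2 \<le> \<bar>t\<bar>" by (simp add: power2_eq_square flip: abs_mult)
  then show ?thesis using abs_ln_one_plus_x_minus_x_bound[OF assms] by linarith
qed

text \<open>The n-th term is a fixed continuous function \<open>f\<close> of the five quantities in
  \<open>g\<close>. These converge uniformly on C \<times> C and stay in a compact box, on which
  \<open>f\<close> is uniformly continuous, so the values converge uniformly too. In the limit exp
  (a L) cancels the two conjugating exponentials, and b L = pi (\<xi> - \<eta>).\<close>

lemma uniform_limit_main_term:
  fixes x0 \<rho> c a b r :: real and C :: "real set"
  assumes pos: "x0 > 0" "\<rho> > 0" "b = pi * (\<rho> * x0)" "a = pi * c * (\<rho> * x0)" "r > 0"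
    and C: "\<And>t. t \<in> C \<Longrightarrow> \<bar>t\<bar> \<le> r"
  defines "\<delta> \<equiv> \<lambda>n \<xi> \<eta>. ln (x0 + \<xi> / (real n * \<rho>)) - ln (x0 + \<eta> / (real n * \<rho>))"
  shows "uniform_limit (C \<times> C)
    (\<lambda>n (\<xi>, \<eta>). exp (- pi * \<xi> * c) / exp (- pi * \<eta> * c) * (b / (pi * \<rho> * (x0 + \<eta> / (real n * \<rho>)))
       * exp (a * (real n * \<delta> n \<xi> \<eta>) - \<delta> n \<xi> \<eta> / 2) * sincard (b * (real n * \<delta> n \<xi> \<eta>))))
    (\<lambda>(\<xi>, \<eta>). sine_kernel \<xi> \<eta>) sequentially"
proof -
  \<comment> \<open>A bound for |t| / (\<rho> x0) on C; the relative change from x0 to x0 + t / (n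
    \<rho>) is then at most k / n.\<close>
  define k where "k = r / (\<rho> * x0)"
  have k: "k > 0" using pos by (simp add: k_def)
  \<comment> \<open>Room for n \<delta> and \<delta>, both at most 4 k in absolute value, for x0 +
    \<eta> / (n \<rho>) within a factor 2 of x0, and for \<xi> and \<eta>. The third coordinate is
    kept away from 0 because \<open>f\<close> divides by it.\<close>
  define B where "B = {- (4*k)..4*k} \<times> {- (4*k)..4*k} \<times> {x0/2..2*x0} \<times> {-r..r} \<times> {-r..r}"
  define f where "f = (\<lambda>(L, d, z, \<xi>, \<eta>). exp (- pi * \<xi> * c) / exp (- pi * \<eta> * c) * (b / (pi * \<rho> * z)
       * exp (a * L - d / 2) * sincard (b * L)))"
  define g where "g = (\<lambda>(n::nat) (\<xi>, \<eta>). (real n * \<delta> n \<xi> \<eta>, \<delta> n \<xi> \<eta>, x0 + \<eta> / (real n * \<rho>), \<xi>, \<eta>))"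
  define g' where "g' = (\<lambda>(\<xi>, \<eta>). ((\<xi> - \<eta>) / (\<rho> * x0), 0::real, x0, \<xi>, \<eta>))"
  have "compact B" unfolding B_def by (intro compact_Times compact_Icc)
  have cf: "continuous_on B f"
    unfolding f_def case_prod_unfold by (intro continuous_intros) (use pos in \<open>auto simp: B_def\<close>)
  have uc: "uniformly_continuous_on B f" using compact_uniformly_continuous[OF cf \<open>compact B\<close>] .
  have lnt: "ln (x0 + t / (real n * \<rho>)) - ln x0 = ln (1 + t / (\<rho> * x0) / real n) \<and> \<bar>t / (\<rho> * x0) / real n\<bar> \<le> k / real n
      \<and> \<bar>t / (\<rho> * x0) / real n\<bar> \<le> 1/2 \<and> \<bar>t / (\<rho> * x0)\<bar> \<le> k" if n: "real n \<ge> 1" "real n \<ge> 2 * k" and t: "t \<in> C" for n t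
  proof -
    have kt: "\<bar>t / (\<rho> * x0)\<bar> \<le> k" using C[OF t] pos by (simp add: k_def abs_mult divide_right_mono)
    then have kn: "\<bar>t / (\<rho> * x0) / real n\<bar> \<le> k / real n" 
      using divide_right_mono[OF kt, of "real n"] by (simp only: abs_divide abs_of_nat of_nat_0_le_iff simp_thms)
    have "k / real n \<le> 1/2" using n by (simp add: divide_le_eq)
    then have h: "\<bar>t / (\<rho> * x0) / real n\<bar> \<le> 1/2" using kn by linarith
    have "x0 + t / (real n * \<rho>) = x0 * (1 + t / (\<rho> * x0) / real n)" using pos n by (simp add: field_simps)
    moreover have "1 + t / (\<rho> * x0) / real n > 0" using h unfolding abs_le_iff by linarith
    ultimately have "ln (x0 + t / (real n * \<rho>)) = ln x0 + ln (1 + t / (\<rho> * x0) / real n)" using pos by (simp add: ln_mult)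
    then show ?thesis using kt kn h by simp
  qed
  have est: "\<bar>\<delta> n \<xi> \<eta>\<bar> \<le> 4 * k / real n \<and> \<bar>real n * \<delta> n \<xi> \<eta> - (\<xi> - \<eta>) / (\<rho> * x0)\<bar> \<le> 4 * k\<^sup>2 / real n
      \<and> \<bar>\<eta> / (real n * \<rho>)\<bar> \<le> k * x0 / real n"
    if n: "real n \<ge> 1" "real n \<ge> 2 * k" and t: "\<xi> \<in> C" "\<eta> \<in> C" for n \<xi> \<eta>
  proof -
    have one: "\<bar>ln (1 + t / (\<rho> * x0) / real n)\<bar> \<le> 2 * (k / real n)"
      "\<bar>real n * ln (1 + t / (\<rho> * x0) / real n) - t / (\<rho> * x0)\<bar> \<le> 2 * k\<^sup>2 / real n" if t: "t \<in> C" for t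
    proof -
      note l = lnt[OF n t]
      show "\<bar>ln (1 + t / (\<rho> * x0) / real n)\<bar> \<le> 2 * (k / real n)"
        using abs_ln_one_plus_le[of "t / (\<rho> * x0) / real n"] l by linarith
      have "\<bar>ln (1 + t / (\<rho> * x0) / real n) - t / (\<rho> * x0) / real n\<bar> \<le> 2 * (t / (\<rho> * x0) / real n)\<^sup>2"
        by (rule abs_ln_one_plus_x_minus_x_bound) (use l in blast)
      also have "\<dots> \<le> 2 * (k / real n)\<^sup>2" using l by (intro mult_left_mono) (simp_all add: abs_le_square_iff[symmetric] k less_imp_le)
      finally have "real n * \<bar>ln (1 + t / (\<rho> * x0) / real n) - t / (\<rho> * x0) / real n\<bar> \<le> real n * (2 * (k / real n)\<^sup>2)"
        by (intro mult_left_mono) auto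
      moreover have "real n * \<bar>ln (1 + t / (\<rho> * x0) / real n) - t / (\<rho> * x0) / real n\<bar>
          = \<bar>real n * (ln (1 + t / (\<rho> * x0) / real n) - t / (\<rho> * x0) / real n)\<bar>" by (simp add: abs_mult)
      moreover have "real n * (ln (1 + t / (\<rho> * x0) / real n) - t / (\<rho> * x0) / real n) = real n * ln (1 + t / (\<rho> * x0) / real n) - t / (\<rho> * x0)"
        using n by (simp add: right_diff_distrib)
      moreover have "real n * (2 * (k / real n)\<^sup>2) = 2 * k\<^sup>2 / real n" using n by (simp add: power2_eq_square)
      ultimately show "\<bar>real n * ln (1 + t / (\<rho> * x0) / real n) - t / (\<rho> * x0)\<bar> \<le> 2 * k\<^sup>2 / real n" by simp
    qed
    let ?p = "ln (1 + \<xi> / (\<rho> * x0) / real n)" and ?q = "ln (1 + \<eta> / (\<rho> * x0) / real n)"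
    have d: "\<delta> n \<xi> \<eta> = ?p - ?q" using lnt[OF n t(1)] lnt[OF n t(2)] unfolding \<delta>_def by linarith
    have 1: "\<bar>\<delta> n \<xi> \<eta>\<bar> \<le> 4 * k / real n" unfolding d using one(1)[OF t(1)] one(1)[OF t(2)] by linarith
    have "real n * \<delta> n \<xi> \<eta> - (\<xi> - \<eta>) / (\<rho> * x0) = (real n * ?p - \<xi> / (\<rho> * x0)) - (real n * ?q - \<eta> / (\<rho> * x0))"
      unfolding d by (simp add: right_diff_distrib diff_divide_distrib)
    then have 2: "\<bar>real n * \<delta> n \<xi> \<eta> - (\<xi> - \<eta>) / (\<rho> * x0)\<bar> \<le> 4 * k\<^sup>2 / real n"
      using one(2)[OF t(1)] one(2)[OF t(2)] by linarith
    have E: "\<eta> / (real n * \<rho>) = x0 * (\<eta> / (\<rho> * x0) / real n)" using pos by simp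
    have "\<bar>\<eta> / (real n * \<rho>)\<bar> = x0 * \<bar>\<eta> / (\<rho> * x0) / real n\<bar>" by (simp only: E abs_mult abs_of_pos[OF pos(1)])
    also have "\<dots> \<le> x0 * (k / real n)" using lnt[OF n t(2)] pos by (intro mult_left_mono) auto
    finally have 3: "\<bar>\<eta> / (real n * \<rho>)\<bar> \<le> k * x0 / real n" by (simp add: mult.commute)
    show ?thesis using 1 2 3 by blast
  qed
  obtain N :: nat where "real N \<ge> max 1 (2 * k)" using real_arch_simple by blast
  then have N: "real n \<ge> 1" "real n \<ge> 2 * k" if "n \<ge> N" for n using that by (auto intro: order_trans)
  have ul: "uniform_limit (C \<times> C) g g' sequentially"
  proof (rule uniform_limitI)
    fix \<epsilon> :: real assume e: "\<epsilon> > 0"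
    define K where "K = 4 * k\<^sup>2 + 4 * k + k * x0"
    have "(\<lambda>n. K / real n) \<longlonglongrightarrow> 0" by (rule lim_const_over_n)
    then have "eventually (\<lambda>n. K / real n < \<epsilon>) sequentially" using e order_tendstoD(2) by blast
    then show "eventually (\<lambda>n. \<forall>p\<in>C \<times> C. dist (g n p) (g' p) < \<epsilon>) sequentially"
      using eventually_ge_at_top[of N]
    proof eventually_elim
      fix n assume n: "K / real n < \<epsilon>" "n \<ge> N"
      show "\<forall>p\<in>C \<times> C. dist (g n p) (g' p) < \<epsilon>"
      proof (rule ballI)
        fix p assume "p \<in> C \<times> C"
        then obtain \<xi> \<eta> where p: "p = (\<xi>, \<eta>)" "\<xi> \<in> C" "\<eta> \<in> C" by blast
        note es = est[OF N[OF n(2)] p(2,3)]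
        have "dist (g n p) (g' p) = norm (real n * \<delta> n \<xi> \<eta> - (\<xi> - \<eta>) / (\<rho> * x0), \<delta> n \<xi> \<eta>, \<eta> / (real n * \<rho>), 0::real, 0::real)"
          by (simp add: g_def g'_def p dist_norm zero_prod_def)
        also have "\<dots> \<le> \<bar>real n * \<delta> n \<xi> \<eta> - (\<xi> - \<eta>) / (\<rho> * x0)\<bar> + (\<bar>\<delta> n \<xi> \<eta>\<bar> + \<bar>\<eta> / (real n * \<rho>)\<bar>)"
        proof -
          have "norm (\<eta> / (real n * \<rho>), 0::real, 0::real) \<le> \<bar>\<eta> / (real n * \<rho>)\<bar>"
            using norm_Pair_le[of "\<eta> / (real n * \<rho>)" "(0::real, 0::real)"] by (simp add: norm_Pair)
          moreover have "norm (\<delta> n \<xi> \<eta>, \<eta> / (real n * \<rho>), 0::real, 0::real) \<le> \<bar>\<delta> n \<xi> \<eta>\<bar> + norm (\<eta> / (real n * \<rho>), 0::real, 0::real)"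
            using norm_Pair_le[of "\<delta> n \<xi> \<eta>" "(\<eta> / (real n * \<rho>), 0::real, 0::real)"] by simp
          moreover have "norm (real n * \<delta> n \<xi> \<eta> - (\<xi> - \<eta>) / (\<rho> * x0), \<delta> n \<xi> \<eta>, \<eta> / (real n * \<rho>), 0::real, 0::real)
             \<le> \<bar>real n * \<delta> n \<xi> \<eta> - (\<xi> - \<eta>) / (\<rho> * x0)\<bar> + norm (\<delta> n \<xi> \<eta>, \<eta> / (real n * \<rho>), 0::real, 0::real)"
            using norm_Pair_le[of "real n * \<delta> n \<xi> \<eta> - (\<xi> - \<eta>) / (\<rho> * x0)" "(\<delta> n \<xi> \<eta>, \<eta> / (real n * \<rho>), 0::real, 0::real)"] by simp
          ultimately show ?thesis by linarith
        qed
        also have "\<dots> \<le> 4 * k\<^sup>2 / real n + (4 * k / real n + k * x0 / real n)" using es by (intro add_mono) auto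
        also have "\<dots> = K / real n" by (simp add: K_def add_divide_distrib)
        finally show "dist (g n p) (g' p) < \<epsilon>" using n by simp
      qed
    qed
  qed
  have inB: "eventually (\<lambda>n. \<forall>p\<in>C \<times> C. g n p \<in> B) sequentially"
    using eventually_ge_at_top[of N]
  proof eventually_elim
    fix n assume n: "n \<ge> N"
    note nn = N[OF n]
    show "\<forall>p\<in>C \<times> C. g n p \<in> B"
    proof (rule ballI)
      fix p assume "p \<in> C \<times> C"
      then obtain \<xi> \<eta> where p: "p = (\<xi>, \<eta>)" "\<xi> \<in> C" "\<eta> \<in> C" by blast
      note es = est[OF nn p(2,3)]
      have "k / real n \<le> 1/2" using nn by (simp add: divide_le_eq)
      then have "k / real n * x0 \<le> 1/2 * x0" using pos by (intro mult_right_mono) auto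
      then have "k * x0 / real n \<le> x0 / 2" by simp
      then have "\<bar>\<eta> / (real n * \<rho>)\<bar> \<le> x0 / 2" using conjunct2[OF conjunct2[OF es]] by linarith
      then have z: "x0 / 2 \<le> x0 + \<eta> / (real n * \<rho>)" "x0 + \<eta> / (real n * \<rho>) \<le> 2 * x0"
        using pos(1) unfolding abs_le_iff by linarith+
      have d: "\<bar>\<delta> n \<xi> \<eta>\<bar> \<le> 4 * k / real n" using es by blast
      then have "real n * \<bar>\<delta> n \<xi> \<eta>\<bar> \<le> real n * (4 * k / real n)" by (intro mult_left_mono) auto
      then have L: "\<bar>real n * \<delta> n \<xi> \<eta>\<bar> \<le> 4 * k" using nn by (simp add: abs_mult)
      have "4 * k / real n \<le> 4 * k" using nn k by (simp add: divide_le_eq mult_le_cancel_left1)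
      then have d4: "\<bar>\<delta> n \<xi> \<eta>\<bar> \<le> 4 * k" using d by linarith
      show "g n p \<in> B"
        unfolding B_def g_def p prod.case mem_Times_iff fst_conv snd_conv atLeastAtMost_iff
        using C[OF p(2)] C[OF p(3)] z L d4 unfolding abs_le_iff by linarith
    qed
  qed
  have "uniform_limit (C \<times> C) (\<lambda>n p. f (g n p)) (\<lambda>p. f (g' p)) sequentially"
    by (rule uniform_limit_compose_uniformly_continuous_on[OF ul uc inB compact_imp_closed[OF \<open>compact B\<close>]])
  moreover have "f (g' p) = (\<lambda>(\<xi>, \<eta>). sine_kernel \<xi> \<eta>) p" for p
  proof -
    obtain \<xi> \<eta> where p: "p = (\<xi>, \<eta>)" by (metis surj_pair)
    have b1: "b * ((\<xi> - \<eta>) / (\<rho> * x0)) = pi * (\<xi> - \<eta>)" and a1: "a * ((\<xi> - \<eta>) / (\<rho> * x0)) = pi * c * (\<xi> - \<eta>)"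
      and c1: "b / (pi * \<rho> * x0) = 1" using pos by simp_all
    have "exp (- pi * \<xi> * c) / exp (- pi * \<eta> * c) * exp (pi * c * (\<xi> - \<eta>)) = 1"
      unfolding exp_diff[symmetric] exp_add[symmetric] by (simp add: algebra_simps)
    then have "exp (- pi * \<xi> * c) / exp (- pi * \<eta> * c) * (1 * exp (pi * c * (\<xi> - \<eta>)) * sincard (pi * (\<xi> - \<eta>))) = sincard (pi * (\<xi> - \<eta>))"
      by (simp only: mult_1 mult.assoc[symmetric])
    then show ?thesis unfolding p f_def g'_def by (simp only: prod.case b1 a1 c1 diff_0_right div_0) (simp add: sine_kernel_def sincard_def)
  qed
  moreover have "(\<lambda>n p. f (g n p)) = (\<lambda>n (\<xi>, \<eta>). exp (- pi * \<xi> * c) / exp (- pi * \<eta> * c) * (b / (pi * \<rho> * (x0 + \<eta> / (real n * \<rho>)))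
       * exp (a * (real n * \<delta> n \<xi> \<eta>) - \<delta> n \<xi> \<eta> / 2) * sincard (b * (real n * \<delta> n \<xi> \<eta>))))"
    by (intro ext) (auto simp: f_def g_def)
  ultimately show ?thesis by (simp only: )
qed

theorem theorem4p2:
  fixes M \<kappa> :: nat and \<nu> :: "nat \<Rightarrow> nat" and \<Sigma> :: "nat \<Rightarrow> real \<Rightarrow> complex"
    and x0 \<phi> \<rho> :: real and C :: "real set"
  assumes "M \<ge> 2"
    and "\<nu> 0 = 0"
    and "\<kappa> > \<nu> 1"
    and "\<And>n. n \<ge> 1 \<Longrightarrow> encircling_contour n (\<Sigma> n)"
    and "x0 \<in> {0<..<(real M + 1) powr ((real M + 1) / 2) /
                    (2 * (real M - 1) powr ((real M - 1) / 2))}"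
    and "\<phi> \<in> {0<..<2 * pi / (real M + 1)}"
    and "x0 = sin ((real M + 1) / 2 * \<phi>) powr ((real M + 1) / 2) /
              (sin \<phi> * sin ((real M - 1) / 2 * \<phi>) powr ((real M - 1) / 2))"
    and "\<rho> = 1 / (pi * x0) *
             sqrt (sin ((real M + 1) / 2 * \<phi>) / sin ((real M - 1) / 2 * \<phi>)) * sin (\<phi> / 2)"
    and "compact C"
  shows "uniform_limit (C \<times> C)
           (\<lambda>n (\<xi>, \<eta>).
              complex_of_real (exp (- pi * \<xi> * cot (\<phi> / 2)) / exp (- pi * \<eta> * cot (\<phi> / 2)) *
                               (real n ^ (M - 2) / \<rho>)) *
              corr_kernel M \<nu> \<kappa> n (\<Sigma> n)
                (real n ^ (M - 1) * (x0 + \<xi> / (real n * \<rho>)))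
                (real n ^ (M - 1) * (x0 + \<eta> / (real n * \<rho>))))
           (\<lambda>(\<xi>, \<eta>). complex_of_real (sine_kernel \<xi> \<eta>))
           sequentially"
proof -
  interpret geometry M by unfold_locales (rule assms)
  interpret kernel_setting M \<nu> \<kappa> "\<phi> / 2"
    by unfold_locales (use assms(3,6) in \<open>auto simp: \<tau>_def mult.commute\<close>)
  note s = sin_pos[OF theta0]
  have arg: "(real M + 1) / 2 * \<phi> = (real M + 1) * (\<phi> / 2)" "(real M - 1) / 2 * \<phi> = (real M - 1) * (\<phi> / 2)"
    "sin \<phi> = sin (2 * (\<phi> / 2))" by simp_all
  have x0_pos: "x0 > 0" using assms(5) by simp
  have "ln x0 = lnX (\<phi> / 2)"
    unfolding assms(7) arg lnX_eq[OF theta0] using s by (simp add: ln_div ln_mult ln_powr)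
  then have exp_lnX: "exp (lnX (\<phi> / 2)) = x0" using x0_pos by (metis exp_ln)
  \<comment> \<open>The formula for \<rho> states that pi \<rho> x0 is the imaginary part of the
    saddle point, the square root in it being its modulus. As a = b cot (\<phi> / 2), the factor exp
    (n a (ln x - ln y)) of the main term is what the exponentials with cot (\<phi> / 2) in the
    statement compensate.\<close>
  have b: "b = pi * (\<rho> * x0)"
    unfolding assms(8) arg b_def Im_Z R_eq[OF theta0] using x0_pos by simp
  have a: "a = pi * cot (\<phi> / 2) * (\<rho> * x0)"
  proof -
    have "pi * cot (\<phi> / 2) * (\<rho> * x0) = cot (\<phi> / 2) * b" unfolding b by simp
    also have "\<dots> = a" unfolding a_def b_def Im_Z Re_Z cot_def using s(1) by simp
    finally show ?thesis ..
  qed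
  have "pi * (\<rho> * x0) > 0" using b_pos unfolding b .
  then have \<rho>_pos: "\<rho> > 0" using x0_pos by (simp add: zero_less_mult_iff)
  obtain r where r: "r > 0" "\<And>t. t \<in> C \<Longrightarrow> \<bar>t\<bar> \<le> r"
    using compact_imp_bounded[OF assms(9)] unfolding bounded_pos by auto
  \<comment> \<open>A relative change q of x0, |q| \<le> r / (\<rho> x0 n), changes its logarithm by
    at most 2 |q|, by \<open>abs_ln_one_plus_le\<close>.\<close>
  define e where "e = 2 * r / (\<rho> * x0)"
  have e: "e \<ge> 0" using r \<rho>_pos x0_pos by (simp add: e_def)
  obtain T N where T: "T \<longlonglongrightarrow> 0" and N: "N \<ge> 1" and kernel:
    "\<And>n \<Sigma> x y. n \<ge> N \<Longrightarrow> encircling_contour n \<Sigma> \<Longrightarrow> x > 0 \<Longrightarrow> y > 0 \<Longrightarrow>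
      \<bar>ln x - lnXn n\<bar> \<le> e / real n \<Longrightarrow> \<bar>ln y - lnXn n\<bar> \<le> e / real n \<Longrightarrow>
      cmod (corr_kernel M \<nu> \<kappa> n \<Sigma> x y - of_real (real n / (2 * pi) *
        (exp ((real n * a - 1/2) * (ln x - ln y)) / y * (2 * b * sincard (b * (real n * (ln x - ln y))))))) \<le> real n * exp (- lnXn n) * T n"
    by (rule kernel_estimate[OF e assms(2)]) blast
  define c where "c = cot (\<phi> / 2)"
  define z where "z = (\<lambda>n t. x0 + t / (real n * \<rho>))"
  define x where "x = (\<lambda>n t. real n ^ (M - 1) * z n t)"
  define w where "w = (\<lambda>n \<xi> \<eta>. exp (- pi * \<xi> * c) / exp (- pi * \<eta> * c) * (real n ^ (M - 2) / \<rho>))"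
  define \<delta> where "\<delta> = (\<lambda>n \<xi> \<eta>. ln (z n \<xi>) - ln (z n \<eta>))"
  \<comment> \<open>The main term of \<open>kernel_estimate\<close> multiplied by \<open>w\<close>,
    with all powers of n cancelled.\<close>
  define H where "H = (\<lambda>n \<xi> \<eta>. exp (- pi * \<xi> * c) / exp (- pi * \<eta> * c) * (b / (pi * \<rho> * z n \<eta>)
       * exp (a * (real n * \<delta> n \<xi> \<eta>) - \<delta> n \<xi> \<eta> / 2) * sincard (b * (real n * \<delta> n \<xi> \<eta>))))"
  define F where "F = (\<lambda>n \<xi> \<eta>. of_real (w n \<xi> \<eta>) * corr_kernel M \<nu> \<kappa> n (\<Sigma> n) (x n \<xi>) (x n \<eta>))"
  have H: "uniform_limit (C \<times> C) (\<lambda>n (\<xi>, \<eta>). H n \<xi> \<eta>) (\<lambda>(\<xi>, \<eta>). sine_kernel \<xi> \<eta>) sequentially"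
    unfolding H_def \<delta>_def z_def
    by (rule uniform_limit_main_term[OF x0_pos \<rho>_pos b a[folded c_def] r])
  have bd: "cmod (F n \<xi> \<eta> - of_real (H n \<xi> \<eta>)) \<le> exp (2 * pi * r * \<bar>c\<bar>) * (1 / (\<rho> * x0)) * \<bar>T n\<bar>"
    if n: "n \<ge> N" "real n \<ge> e" and t: "\<xi> \<in> C" "\<eta> \<in> C" for n \<xi> \<eta>
  proof -
    have n1: "n \<ge> 1" using n N by simp
    then have n0: "real n > 0" by simp
    have pt: "z n t > 0 \<and> ln (x n t) = (real M - 1) * ln (real n) + ln (z n t) \<and> \<bar>ln (x n t) - lnXn n\<bar> \<le> e / real n"
      if t: "t \<in> C" for t
    proof -
      define q where "q = t / (\<rho> * x0) / real n"
      define E where "E = e / real n"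
      have "\<bar>q\<bar> = \<bar>t\<bar> / (\<rho> * x0) / real n" using \<rho>_pos x0_pos by (simp add: q_def)
      also have "\<dots> \<le> r / (\<rho> * x0) / real n" using r(2)[OF t] \<rho>_pos x0_pos by (intro divide_right_mono) auto
      finally have q: "\<bar>q\<bar> \<le> E / 2" by (simp add: e_def E_def)
      have "E \<le> 1" using n(2) n0 by (simp add: E_def)
      then have q1: "\<bar>q\<bar> \<le> 1/2" using q by linarith
      have zq: "z n t = x0 * (1 + q)" using \<rho>_pos x0_pos n0 by (simp add: z_def q_def field_simps)
      have q2: "1 + q > 0" using q1 unfolding abs_le_iff by linarith
      have z0: "z n t > 0" unfolding zq using x0_pos q2 by (rule mult_pos_pos)
      have lx: "ln (x n t) = (real M - 1) * ln (real n) + ln (z n t)"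
        using z0 n0 M2 by (simp add: x_def ln_mult ln_realpow of_nat_diff)
      have "ln (z n t) = ln x0 + ln (1 + q)" unfolding zq using x0_pos q2 by (rule ln_mult_pos)
      then have "ln (x n t) - lnXn n = ln (1 + q)"
        unfolding lx lnXn_def \<open>ln x0 = lnX (\<phi> / 2)\<close>[symmetric] by simp
      then have "\<bar>ln (x n t) - lnXn n\<bar> \<le> e / real n" using abs_ln_one_plus_le[OF q1] q unfolding E_def[symmetric] by linarith
      then show ?thesis using z0 lx by blast
    qed
    have xp: "x n t > 0" if "t \<in> C" for t using pt[OF that] n0 by (simp add: x_def)
    have d: "ln (x n \<xi>) - ln (x n \<eta>) = \<delta> n \<xi> \<eta>" using pt[OF t(1)] pt[OF t(2)] by (simp add: \<delta>_def)
    let ?m = "real n / (2 * pi) * (exp ((real n * a - 1/2) * \<delta> n \<xi> \<eta>) / x n \<eta> * (2 * b * sincard (b * (real n * \<delta> n \<xi> \<eta>))))"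
    have pow: "real n ^ (M - 1) = real n ^ (M - 2) * real n"

    proof -
      obtain k where "M = 2 + k" using M2 le_Suc_ex by blast
      then show ?thesis by simp
    qed
    have wm: "w n \<xi> \<eta> * ?m = H n \<xi> \<eta>"
    proof -
      have ex: "(real n * a - 1/2) * \<delta> n \<xi> \<eta> = a * (real n * \<delta> n \<xi> \<eta>) - \<delta> n \<xi> \<eta> / 2" by (simp add: algebra_simps)
      have alg: "P * (p / \<rho>) * (k / (2 * pi) * (E / (p * k * v) * (2 * B * S))) = P * (B / (pi * \<rho> * v) * E * S)"
        if "p > 0" "k > 0" "v > 0" for P p k E v B S :: real
        using that \<rho>_pos by (simp add: field_simps)
      show ?thesis unfolding w_def H_def x_def pow ex using pt[OF t(2)] n0 by (intro alg) auto
    qed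
    have w0: "w n \<xi> \<eta> \<ge> 0" using \<rho>_pos by (simp add: w_def)
    have "F n \<xi> \<eta> - of_real (H n \<xi> \<eta>) = of_real (w n \<xi> \<eta>) * (corr_kernel M \<nu> \<kappa> n (\<Sigma> n) (x n \<xi>) (x n \<eta>) - of_real ?m)"
      unfolding F_def wm[symmetric] by (simp only: of_real_mult right_diff_distrib)
    then have "cmod (F n \<xi> \<eta> - of_real (H n \<xi> \<eta>)) = w n \<xi> \<eta> * cmod (corr_kernel M \<nu> \<kappa> n (\<Sigma> n) (x n \<xi>) (x n \<eta>) - of_real ?m)"
      by (simp only: norm_mult norm_of_real abs_of_nonneg[OF w0])
    also have "\<dots> \<le> w n \<xi> \<eta> * (real n * exp (- lnXn n) * \<bar>T n\<bar>)"
    proof (rule mult_left_mono[OF _ w0])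
      have "cmod (corr_kernel M \<nu> \<kappa> n (\<Sigma> n) (x n \<xi>) (x n \<eta>) - of_real ?m) \<le> real n * exp (- lnXn n) * T n"
        using kernel[OF n(1) assms(4)[OF n1] xp[OF t(1)] xp[OF t(2)] conjunct2[OF conjunct2[OF pt[OF t(1)]]] conjunct2[OF conjunct2[OF pt[OF t(2)]]]]
        unfolding d .
      also have "\<dots> \<le> real n * exp (- lnXn n) * \<bar>T n\<bar>" by (intro mult_left_mono) auto
      finally show "cmod (corr_kernel M \<nu> \<kappa> n (\<Sigma> n) (x n \<xi>) (x n \<eta>) - of_real ?m) \<le> real n * exp (- lnXn n) * \<bar>T n\<bar>" .
    qed
    \<comment> \<open>Since exp (lnXn n) = n^(M-1) x0, the product of n^(M-2), n and exp (- lnXn n)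
      is 1 / x0.\<close>
    also have "\<dots> = exp (- pi * \<xi> * c) / exp (- pi * \<eta> * c) * (1 / (\<rho> * x0)) * \<bar>T n\<bar>"
    proof -
      have "exp (lnXn n) = exp (ln (real n)) ^ (M - 1) * x0"
        unfolding lnXn_def exp_add exp_lnX using M2 by (simp add: of_nat_diff flip: exp_of_nat_mult)
      then have X: "exp (lnXn n) = real n ^ (M - 2) * real n * x0" using n0 by (simp only: exp_ln pow)
      have alg: "P * (p / \<rho>) * (k * (1 / (p * k * x0)) * S) = P * (1 / (\<rho> * x0)) * S"
        if "p > 0" "k > 0" for P p k S :: real
        using that \<rho>_pos x0_pos by (simp add: field_simps)
      show ?thesis unfolding w_def exp_minus[of "lnXn n"] X inverse_eq_divide using n0 by (intro alg) auto
    qed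
    also have "exp (- pi * \<xi> * c) / exp (- pi * \<eta> * c) = exp (pi * (c * (\<eta> - \<xi>)))"
      by (simp add: algebra_simps flip: exp_diff)
    also have "\<dots> * (1 / (\<rho> * x0)) * \<bar>T n\<bar> \<le> exp (2 * pi * r * \<bar>c\<bar>) * (1 / (\<rho> * x0)) * \<bar>T n\<bar>"
    proof -
      have "\<bar>\<eta> - \<xi>\<bar> \<le> 2 * r" using r(2)[OF t(1)] r(2)[OF t(2)] by linarith
      then have "\<bar>c\<bar> * \<bar>\<eta> - \<xi>\<bar> \<le> \<bar>c\<bar> * (2 * r)" by (intro mult_left_mono) auto
      then have "c * (\<eta> - \<xi>) \<le> \<bar>c\<bar> * (2 * r)" using abs_ge_self[of "c * (\<eta> - \<xi>)"] unfolding abs_mult by linarith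
      then have "pi * (c * (\<eta> - \<xi>)) \<le> pi * (\<bar>c\<bar> * (2 * r))" by (intro mult_left_mono) auto
      then have "exp (pi * (c * (\<eta> - \<xi>))) \<le> exp (2 * pi * r * \<bar>c\<bar>)" by (simp add: mult_ac)
      then show ?thesis using \<rho>_pos x0_pos by (intro mult_right_mono) auto
    qed
    finally show ?thesis .
  qed
  have "uniform_limit (C \<times> C) (\<lambda>n (\<xi>, \<eta>). F n \<xi> \<eta> - of_real (H n \<xi> \<eta>)) (\<lambda>_. 0) sequentially"
  proof (rule uniform_limit_null_comparison)
    obtain N' :: nat where N': "real N' \<ge> e" using real_arch_simple by blast
    show "eventually (\<lambda>n. \<forall>p\<in>C \<times> C. norm (case p of (\<xi>, \<eta>) \<Rightarrow> F n \<xi> \<eta> - of_real (H n \<xi> \<eta>))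
        \<le> exp (2 * pi * r * \<bar>c\<bar>) * (1 / (\<rho> * x0)) * \<bar>T n\<bar>) sequentially"
      using eventually_ge_at_top[of "max N N'"]
    proof eventually_elim
      fix n assume n: "n \<ge> max N N'"
      then have "real n \<ge> e" using N' by (meson max.boundedE of_nat_mono order_trans)
      then show "\<forall>p\<in>C \<times> C. norm (case p of (\<xi>, \<eta>) \<Rightarrow> F n \<xi> \<eta> - of_real (H n \<xi> \<eta>))
        \<le> exp (2 * pi * r * \<bar>c\<bar>) * (1 / (\<rho> * x0)) * \<bar>T n\<bar>"
        using bd n by auto
    qed
    have "(\<lambda>n. exp (2 * pi * r * \<bar>c\<bar>) * (1 / (\<rho> * x0)) * \<bar>T n\<bar>) \<longlonglongrightarrow> exp (2 * pi * r * \<bar>c\<bar>) * (1 / (\<rho> * x0)) * \<bar>0\<bar>"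
      by (intro tendsto_intros T)
    then show "uniform_limit (C \<times> C) (\<lambda>n p. exp (2 * pi * r * \<bar>c\<bar>) * (1 / (\<rho> * x0)) * \<bar>T n\<bar>) (\<lambda>_. 0) sequentially"
      by (simp add: uniform_limit_iff tendsto_iff)
  qed
  from uniform_limit_add[OF this bounded_linear.uniform_limit[OF bounded_linear_of_real H, where 'a1 = complex]]
  have "uniform_limit (C \<times> C) (\<lambda>n (\<xi>, \<eta>). F n \<xi> \<eta>) (\<lambda>(\<xi>, \<eta>). complex_of_real (sine_kernel \<xi> \<eta>)) sequentially"
    by (simp add: case_prod_unfold)
  then show ?thesis by (simp only: F_def w_def x_def z_def c_def)
qed

end
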